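(* The functors $\mathsf{R}:\mathbf{MT_R}\to\mathbf{RE}$ and $\mathcal{F}:\mathbf{RE}\to\mathbf{MT_R}$ establish an equivalence of the categories $\mathbf{MT_R}$ (MT-algebras and Raney morphisms) and $\mathbf{RE}$ (Raney extensions and their morphisms); that is, they are mutually quasi-inverse equivalences of categories.
   Context: A frame is a complete lattice with $a\wedge\bigvee S=\bigvee\{a\wedge s\mid s\in S\}$ for all elements $a$ and subsets $S$; a coframe is the order-dual notion. Frame morphisms preserve arbitrary joins and finite meets; coframe morphisms preserve arbitrary meets and finite joins. An MT-algebra is a pair $M=(B,\square)$, where $B$ is a complete Boolean algebra and $\square:B\to B$ is an interior operator: $\square 1=1$, $\square(a\wedge b)=\square a\wedge\square b$, $\square a\le a$, $\square a\le\square\square a$. We also write $M$ for $B$. An element $a$ is open if $\square a=a$ and saturated if it is a meet of open elements. $\mathsf{O}M$ and $\mathsf{S}M$ denote the sets of open and saturated elements; in the inherited order $\mathsf{O}M$ is a frame (joins and finite meets as in $M$) and $\mathsf{S}M$ is a coframe (meets and finite joins as in $M$). $\mathcal{B}\mathsf{S}M$ is the Boolean subalgebra of $M$ generated by $\mathsf{S}M$. A Raney morphism $f:M\to M'$ between MT-algebras is a function such that: (R1) $f$ restricts to a coframe morphism $\mathsf{S}M\to\mathsf{S}M'$; (R2) $f$ restricts to a frame morphism $\mathsf{O}M\to\mathsf{O}M'$; (R3) $f(a\wedge b)=f(a)\wedge f(b)$ for all $a,b\in M$; (R4) $f(x\vee y)=f(x)\vee f(y)$ for all $x,y\in\mathcal{B}\mathsf{S}M$;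 (R5) $f(a)=\bigvee\{f(x)\mid x\in\mathcal{B}\mathsf{S}M,\ x\le a\}$ for all $a\in M$. $\mathbf{MT_R}$ is the category of MT-algebras and Raney morphisms, with composition $(g\star f)(a)=\bigvee\{gf(x)\mid x\in\mathcal{B}\mathsf{S}M_1,\ x\le a\}$ for $f:M_1\to M_2$, $g:M_2\to M_3$, and identities $id_M(a)=\bigvee\{x\in\mathcal{B}\mathsf{S}M\mid x\le a\}$. For a complete lattice $C$, a subset $L\subseteq C$ is a subframe of $C$ if $L$ is a frame in the inherited order and the embedding $L\to C$ preserves arbitrary joins and finite meets. A Raney extension is a pair $R=(C,L)$ such that $C$ is a coframe, $L$ is a subframe of $C$ that meet-generates $C$ (every element of $C$ is a meet of elements of $L$), and $a\wedge\bigvee S=\bigvee\{a\wedge s\mid s\in S\}$ for all $a\in C$, $S\subseteq L$. A morphism $(C,L)\to(C',L')$ is a coframe morphism $h:C\to C'$ restricting to a frame morphism $L\to L'$. These form the category $\mathbf{RE}$ (with usual composition). The functor $\mathsf{R}$: $\mathsf{R}M=(\mathsf{S}M,\mathsf{O}M)$ and $\mathsf{R}f=f|_{\mathsf{S}M}$. The functor $\mathcal{F}$: for a Raney extension $R=(C,L)$ let $\mathcal{B}C$ be the Boolean envelope (free Boolean extension) of the bounded distributive lattice $C$ and $\mathcal{F}C$ the MacNeille completion of $\mathcal{B}C$, so $L\subseteq C\subseteq\mathcal{B}C\subseteq\mathcal{F}C$. The embedding $L\to\mathcal{F}C$ preserves all joins, so it has a right adjoint, giving the interior operator $\square a=\bigvee\{u\in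 L\mid u\le a\}$ on $\mathcal{F}C$. The Funayama envelope of $R$ is $\mathcal{F}R=(\mathcal{F}C,\square)$. For an $\mathbf{RE}$-morphism $h:C_1\to C_2$ from $(C_1,L_1)$ to $(C_2,L_2)$, let $\mathcal{B}h:\mathcal{B}C_1\to\mathcal{B}C_2$ be its unique extension to a Boolean morphism, and put $\mathcal{F}h(a)=\bigvee\{\mathcal{B}h(x)\mid x\in\mathcal{B}C_1,\ x\le a\}$ for $a\in\mathcal{F}R_1$, the join taken in $\mathcal{F}R_2$. *)

theory Defs
  imports "HOL-Algebra.Complete_Lattice"
begin

text \<open>
  All ordered structures are carrier-based (\<open>gorder\<close>, \<open>lattice\<close>, \<open>complete_lattice\<close> of
  HOL-Algebra), because saturated elements, Boolean envelopes and MacNeille completions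
  depend on terms.  A subset \<open>A\<close> of \<open>L\<close> in its inherited order is \<open>L\<lparr>carrier := A\<rparr>\<close>.
\<close>

section \<open>Frames, coframes and Boolean algebras\<close>

definition frame :: "('a, 'm) gorder_scheme \<Rightarrow> bool" where
  "frame L \<longleftrightarrow> complete_lattice L \<and>
     (\<forall>a\<in>carrier L. \<forall>S\<subseteq>carrier L. a \<sqinter>\<^bsub>L\<^esub> \<Squnion>\<^bsub>L\<^esub> S = \<Squnion>\<^bsub>L\<^esub> ((\<lambda>s. a \<sqinter>\<^bsub>L\<^esub> s) ` S))"

definition coframe :: "('a, 'm) gorder_scheme \<Rightarrow> bool" where
  "coframe L \<longleftrightarrow> complete_lattice L \<and>
     (\<forall>a\<in>carrier L. \<forall>S\<subseteq>carrier L. a \<squnion>\<^bsub>L\<^esub> \<Sqinter>\<^bsub>L\<^esub> S = \<Sqinter>\<^bsub>L\<^esub> ((\<lambda>s. a \<squnion>\<^bsub>L\<^esub> s) ` S))"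

definition frame_mor ::
    "('a, 'm) gorder_scheme \<Rightarrow> ('b, 'n) gorder_scheme \<Rightarrow> ('a \<Rightarrow> 'b) \<Rightarrow> bool" where
  "frame_mor X Y f \<longleftrightarrow> f \<in> carrier X \<rightarrow> carrier Y \<and>
     sup_pres X Y f \<and> meet_pres X Y f \<and> f \<top>\<^bsub>X\<^esub> = \<top>\<^bsub>Y\<^esub>"

definition coframe_mor ::
    "('a, 'm) gorder_scheme \<Rightarrow> ('b, 'n) gorder_scheme \<Rightarrow> ('a \<Rightarrow> 'b) \<Rightarrow> bool" where
  "coframe_mor X Y f \<longleftrightarrow> f \<in> carrier X \<rightarrow> carrier Y \<and>
     inf_pres X Y f \<and> join_pres X Y f \<and> f \<bottom>\<^bsub>X\<^esub> = \<bottom>\<^bsub>Y\<^esub>"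

definition bdd_distrib_lattice :: "('a, 'm) gorder_scheme \<Rightarrow> bool" where
  "bdd_distrib_lattice L \<longleftrightarrow> bounded_lattice L \<and>
     (\<forall>x\<in>carrier L. \<forall>y\<in>carrier L. \<forall>z\<in>carrier L.
        x \<sqinter>\<^bsub>L\<^esub> (y \<squnion>\<^bsub>L\<^esub> z) = (x \<sqinter>\<^bsub>L\<^esub> y) \<squnion>\<^bsub>L\<^esub> (x \<sqinter>\<^bsub>L\<^esub> z))"

definition is_compl :: "('a, 'm) gorder_scheme \<Rightarrow> 'a \<Rightarrow> 'a \<Rightarrow> bool" where
  "is_compl L x y \<longleftrightarrow> y \<in> carrier L \<and> x \<sqinter>\<^bsub>L\<^esub> y = \<bottom>\<^bsub>L\<^esub> \<and> x \<squnion>\<^bsub>L\<^esub> y = \<top>\<^bsub>L\<^esub>"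

definition boolean_lattice :: "('a, 'm) gorder_scheme \<Rightarrow> bool" where
  "boolean_lattice L \<longleftrightarrow> bdd_distrib_lattice L \<and> (\<forall>x\<in>carrier L. \<exists>y. is_compl L x y)"

definition bdd_lattice_hom ::
    "('a, 'm) gorder_scheme \<Rightarrow> ('b, 'n) gorder_scheme \<Rightarrow> ('a \<Rightarrow> 'b) \<Rightarrow> bool" where
  "bdd_lattice_hom X Y f \<longleftrightarrow> f \<in> carrier X \<rightarrow> carrier Y \<and>
     join_pres X Y f \<and> meet_pres X Y f \<and> f \<bottom>\<^bsub>X\<^esub> = \<bottom>\<^bsub>Y\<^esub> \<and> f \<top>\<^bsub>X\<^esub> = \<top>\<^bsub>Y\<^esub>"

text \<open>The Boolean subalgebra of \<open>L\<close> generated by \<open>X\<close>.\<close>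

inductive_set bool_gen :: "('a, 'm) gorder_scheme \<Rightarrow> 'a set \<Rightarrow> 'a set"
  for L (structure) and X where
  base: "x \<in> X \<Longrightarrow> x \<in> bool_gen L X"
| bot: "\<bottom> \<in> bool_gen L X"
| top: "\<top> \<in> bool_gen L X"
| join: "x \<in> bool_gen L X \<Longrightarrow> y \<in> bool_gen L X \<Longrightarrow> x \<squnion> y \<in> bool_gen L X"
| meet: "x \<in> bool_gen L X \<Longrightarrow> y \<in> bool_gen L X \<Longrightarrow> x \<sqinter> y \<in> bool_gen L X"
| compl: "x \<in> bool_gen L X \<Longrightarrow> is_compl L x y \<Longrightarrow> y \<in> bool_gen L X"


section \<open>The category of MT-algebras and Raney morphisms\<close>

record 'a mt = "'a gorder" +
  box :: "'a \<Rightarrow> 'a"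

definition mt_algebra :: "'a mt \<Rightarrow> bool" where
  "mt_algebra M \<longleftrightarrow> complete_lattice M \<and> boolean_lattice M \<and>
     box M \<in> carrier M \<rightarrow> carrier M \<and>
     box M \<top>\<^bsub>M\<^esub> = \<top>\<^bsub>M\<^esub> \<and>
     (\<forall>a\<in>carrier M. \<forall>b\<in>carrier M. box M (a \<sqinter>\<^bsub>M\<^esub> b) = box M a \<sqinter>\<^bsub>M\<^esub> box M b) \<and>
     (\<forall>a\<in>carrier M. box M a \<sqsubseteq>\<^bsub>M\<^esub> a) \<and>
     (\<forall>a\<in>carrier M. box M a \<sqsubseteq>\<^bsub>M\<^esub> box M (box M a))"

definition opens :: "'a mt \<Rightarrow> 'a set" where
  "opens M = {a \<in> carrier M. box M a = a}"

definition saturated :: "'a mt \<Rightarrow> 'a set" where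
  "saturated M = {a. \<exists>S\<subseteq>opens M. a = \<Sqinter>\<^bsub>M\<^esub> S}"

definition bool_sat :: "'a mt \<Rightarrow> 'a set" where
  "bool_sat M = bool_gen M (saturated M)"

text \<open>
  Morphisms are extensional functions (\<open>undefined\<close> off the carrier), so that equality of
  morphisms is equality in HOL.
\<close>

definition raney_mor :: "'a mt \<Rightarrow> 'b mt \<Rightarrow> ('a \<Rightarrow> 'b) set" where
  "raney_mor M M' = {f \<in> carrier M \<rightarrow>\<^sub>E carrier M'.
     coframe_mor (M\<lparr>carrier := saturated M\<rparr>) (M'\<lparr>carrier := saturated M'\<rparr>) f \<and>
     frame_mor (M\<lparr>carrier := opens M\<rparr>) (M'\<lparr>carrier := opens M'\<rparr>) f \<and>
     (\<forall>a\<in>carrier M. \<forall>b\<in>carrier M. f (a \<sqinter>\<^bsub>M\<^esub> b) = f a \<sqinter>\<^bsub>M'\<^esub> f b) \<and>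
     (\<forall>x\<in>bool_sat M. \<forall>y\<in>bool_sat M. f (x \<squnion>\<^bsub>M\<^esub> y) = f x \<squnion>\<^bsub>M'\<^esub> f y) \<and>
     (\<forall>a\<in>carrier M. f a = \<Squnion>\<^bsub>M'\<^esub> (f ` {x \<in> bool_sat M. x \<sqsubseteq>\<^bsub>M\<^esub> a}))}"

definition raney_comp :: "'a mt \<Rightarrow> 'c mt \<Rightarrow> ('b \<Rightarrow> 'c) \<Rightarrow> ('a \<Rightarrow> 'b) \<Rightarrow> 'a \<Rightarrow> 'c" where
  "raney_comp M\<^sub>1 M\<^sub>3 g f =
     (\<lambda>a\<in>carrier M\<^sub>1. \<Squnion>\<^bsub>M\<^sub>3\<^esub> ((\<lambda>x. g (f x)) ` {x \<in> bool_sat M\<^sub>1. x \<sqsubseteq>\<^bsub>M\<^sub>1\<^esub> a}))"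

definition raney_id :: "'a mt \<Rightarrow> 'a \<Rightarrow> 'a" where
  "raney_id M = (\<lambda>a\<in>carrier M. \<Squnion>\<^bsub>M\<^esub> {x \<in> bool_sat M. x \<sqsubseteq>\<^bsub>M\<^esub> a})"

definition raney_iso :: "'a mt \<Rightarrow> 'b mt \<Rightarrow> ('a \<Rightarrow> 'b) \<Rightarrow> bool" where
  "raney_iso M M' f \<longleftrightarrow> f \<in> raney_mor M M' \<and>
     (\<exists>g\<in>raney_mor M' M. raney_comp M M g f = raney_id M \<and> raney_comp M' M' f g = raney_id M')"


section \<open>The category of Raney extensions\<close>

text \<open>The Raney extension \<open>(C, L)\<close> is the order \<open>C\<close> together with the field \<open>sub = L\<close>.\<close>

record 'a raney = "'a gorder" +
  sub :: "'a set"

definition subframe :: "('a, 'm) gorder_scheme \<Rightarrow> 'a set \<Rightarrow> bool" where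
  "subframe C L \<longleftrightarrow> L \<subseteq> carrier C \<and> frame (C\<lparr>carrier := L\<rparr>) \<and>
     frame_mor (C\<lparr>carrier := L\<rparr>) C (\<lambda>x. x)"

definition raney_extension :: "'a raney \<Rightarrow> bool" where
  "raney_extension R \<longleftrightarrow> coframe R \<and> subframe R (sub R) \<and>
     (\<forall>c\<in>carrier R. \<exists>S\<subseteq>sub R. c = \<Sqinter>\<^bsub>R\<^esub> S) \<and>
     (\<forall>a\<in>carrier R. \<forall>S\<subseteq>sub R. a \<sqinter>\<^bsub>R\<^esub> \<Squnion>\<^bsub>R\<^esub> S = \<Squnion>\<^bsub>R\<^esub> ((\<lambda>s. a \<sqinter>\<^bsub>R\<^esub> s) ` S))"

definition re_mor :: "'a raney \<Rightarrow> 'b raney \<Rightarrow> ('a \<Rightarrow> 'b) set" where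
  "re_mor R R' = {h \<in> carrier R \<rightarrow>\<^sub>E carrier R'. coframe_mor R R' h \<and>
     frame_mor (R\<lparr>carrier := sub R\<rparr>) (R'\<lparr>carrier := sub R'\<rparr>) h}"

abbreviation re_comp :: "'a raney \<Rightarrow> ('b \<Rightarrow> 'c) \<Rightarrow> ('a \<Rightarrow> 'b) \<Rightarrow> 'a \<Rightarrow> 'c" where
  "re_comp R\<^sub>1 g f \<equiv> compose (carrier R\<^sub>1) g f"

abbreviation re_id :: "'a raney \<Rightarrow> 'a \<Rightarrow> 'a" where
  "re_id R \<equiv> (\<lambda>x\<in>carrier R. x)"

definition re_iso :: "'a raney \<Rightarrow> 'b raney \<Rightarrow> ('a \<Rightarrow> 'b) \<Rightarrow> bool" where
  "re_iso R R' h \<longleftrightarrow> h \<in> re_mor R R' \<and>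
     (\<exists>k\<in>re_mor R' R. re_comp R k h = re_id R \<and> re_comp R' h k = re_id R')"


section \<open>Boolean envelopes and MacNeille completions\<close>

text \<open>
  The Boolean envelope of a bounded distributive lattice \<open>C\<close> is taken to be the field of
  sets of prime filters of \<open>C\<close> generated by the sets \<open>benv_emb C a = {P. a \<in> P}\<close>.  The
  theorems \<open>benv_emb_hom\<close>, \<open>benv_emb_inj\<close> and \<open>benv_universal\<close> below show that this is
  the free Boolean extension.
\<close>

definition prime_filters :: "('a, 'm) gorder_scheme \<Rightarrow> 'a set set" where
  "prime_filters C = {P. P \<subseteq> carrier C \<and> \<top>\<^bsub>C\<^esub> \<in> P \<and> \<bottom>\<^bsub>C\<^esub> \<notin> P \<and>
     (\<forall>x\<in>P. \<forall>y\<in>carrier C. x \<sqsubseteq>\<^bsub>C\<^esub> y \<longrightarrow> y \<in> P) \<and>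
     (\<forall>x\<in>P. \<forall>y\<in>P. x \<sqinter>\<^bsub>C\<^esub> y \<in> P) \<and>
     (\<forall>x\<in>carrier C. \<forall>y\<in>carrier C. x \<squnion>\<^bsub>C\<^esub> y \<in> P \<longrightarrow> x \<in> P \<or> y \<in> P)}"

definition incl_order :: "'a set set \<Rightarrow> 'a set gorder" where
  "incl_order A = \<lparr>carrier = A, eq = (=), le = (\<subseteq>)\<rparr>"

definition benv_emb :: "('a, 'm) gorder_scheme \<Rightarrow> 'a \<Rightarrow> 'a set set" where
  "benv_emb C a = {P \<in> prime_filters C. a \<in> P}"

definition benv :: "('a, 'm) gorder_scheme \<Rightarrow> 'a set set gorder" where
  "benv C = incl_order (bool_gen (incl_order (Pow (prime_filters C))) (benv_emb C ` carrier C))"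

subsection \<open>The universal property of the Boolean envelope\<close>

lemma incl_order_simps [simp]:
  "carrier (incl_order A) = A" "le (incl_order A) = (\<subseteq>)" "eq (incl_order A) = (=)"
  by (simp_all add: incl_order_def)

lemma partial_order_incl_order: "partial_order (incl_order A)"
  by unfold_locales (auto simp: incl_order_def)

lemma incl_lub: "\<lbrakk>x \<in> A; y \<in> A; x \<union> y \<in> A\<rbrakk> \<Longrightarrow> is_lub (incl_order A) (x \<union> y) {x, y}"
  by (auto simp: least_def Upper_def)

lemma incl_glb: "\<lbrakk>x \<in> A; y \<in> A; x \<inter> y \<in> A\<rbrakk> \<Longrightarrow> is_glb (incl_order A) (x \<inter> y) {x, y}"
  by (auto simp: greatest_def Lower_def)

lemma incl_join: assumes "x \<in> A" "y \<in> A" "x \<union> y \<in> A" shows "x \<squnion>\<^bsub>incl_order A\<^esub> y = x \<union> y"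
proof -
  have "z = x \<union> y" if "is_lub (incl_order A) z {x, y}" for z
    using that incl_lub[OF assms] by (auto simp: least_def)
  then show ?thesis
    unfolding join_def Lattice.sup_def using incl_lub[OF assms] by (metis someI_ex)
qed

lemma incl_meet: assumes "x \<in> A" "y \<in> A" "x \<inter> y \<in> A" shows "x \<sqinter>\<^bsub>incl_order A\<^esub> y = x \<inter> y"
proof -
  have "z = x \<inter> y" if "is_glb (incl_order A) z {x, y}" for z
    using that incl_glb[OF assms] by (auto simp: greatest_def)
  then show ?thesis
    unfolding meet_def Lattice.inf_def using incl_glb[OF assms] by (metis someI_ex)
qed

lemma incl_bot: assumes "{} \<in> A" shows "\<bottom>\<^bsub>incl_order A\<^esub> = {}"
  unfolding bottom_def by (rule some_equality) (use assms in \<open>auto simp: least_def\<close>)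

lemma incl_top: assumes "X \<in> A" "A \<subseteq> Pow X" shows "\<top>\<^bsub>incl_order A\<^esub> = X"
  unfolding top_def by (rule some_equality) (use assms in \<open>auto simp: greatest_def\<close>)

lemma is_compl_incl_order:
  assumes "A \<subseteq> Pow X" "X \<in> A" "{} \<in> A" "\<And>x y. x \<in> A \<Longrightarrow> y \<in> A \<Longrightarrow> x \<union> y \<in> A \<and> x \<inter> y \<in> A"
    and "x \<in> A"
  shows "is_compl (incl_order A) x y \<longleftrightarrow> y \<in> A \<and> y = X - x"
proof (cases "y \<in> A")
  case True
  have "x \<subseteq> X" "y \<subseteq> X" using assms(1,5) True by auto
  moreover have "x \<squnion>\<^bsub>incl_order A\<^esub> y = x \<union> y" "x \<sqinter>\<^bsub>incl_order A\<^esub> y = x \<inter> y"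
    using assms(5) True assms(4)[OF assms(5) True] by (intro incl_join incl_meet; simp)+
  ultimately show ?thesis
    using True unfolding is_compl_def incl_bot[OF assms(3)] incl_top[OF assms(2,1)] by auto
qed (simp add: is_compl_def)

lemma boolean_lattice_incl_order:
  assumes "A \<subseteq> Pow X" "X \<in> A" "{} \<in> A"
    and cl: "\<And>x y. x \<in> A \<Longrightarrow> y \<in> A \<Longrightarrow> x \<union> y \<in> A \<and> x \<inter> y \<in> A"
    and co: "\<And>x. x \<in> A \<Longrightarrow> X - x \<in> A"
  shows "boolean_lattice (incl_order A)"
proof -
  interpret partial_order "incl_order A" by (rule partial_order_incl_order)
  have "bounded_lattice (incl_order A)"
  proof unfold_locales
    fix x y assume "x \<in> carrier (incl_order A)" "y \<in> carrier (incl_order A)"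
    then show "\<exists>s. is_lub (incl_order A) s {x, y}" "\<exists>s. is_glb (incl_order A) s {x, y}"
      using incl_lub incl_glb cl by (metis incl_order_simps(1))+
  next
    show "\<exists>x. least (incl_order A) x (carrier (incl_order A))"
      using assms(3) by (intro exI[of _ "{}"]) (auto simp: least_def)
    show "\<exists>x. greatest (incl_order A) x (carrier (incl_order A))"
      using assms(1,2) by (intro exI[of _ X]) (auto simp: greatest_def)
  qed
  moreover have "\<exists>y. is_compl (incl_order A) x y" if "x \<in> A" for x
    using is_compl_incl_order[OF assms(1-3) cl that] co that by blast
  ultimately show ?thesis
    unfolding boolean_lattice_def bdd_distrib_lattice_def
    by (auto simp: incl_join incl_meet cl)
qed

lemma bool_gen_Pow:
  assumes "G \<subseteq> Pow X" defines "A \<equiv> bool_gen (incl_order (Pow X)) G"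
  shows "A \<subseteq> Pow X" "X \<in> A" "{} \<in> A"
    and "\<And>x y. x \<in> A \<Longrightarrow> y \<in> A \<Longrightarrow> x \<union> y \<in> A \<and> x \<inter> y \<in> A"
    and "\<And>x. x \<in> A \<Longrightarrow> X - x \<in> A"
proof -
  have sub: "x \<in> Pow X" if "x \<in> A" for x
    using that unfolding A_def
  proof induction
    case (base x) then show ?case using assms(1) by blast
  next
    case bot show ?case by (subst incl_bot) auto
  next
    case top show ?case by (subst incl_top[of X]) auto
  next
    case (join x y) then show ?case by (subst incl_join) auto
  next
    case (meet x y) then show ?case by (subst incl_meet) auto
  next
    case (compl x y) then show ?case by (simp add: is_compl_def)
  qed
  then show "A \<subseteq> Pow X" by blast
  have b: "\<bottom>\<^bsub>incl_order (Pow X)\<^esub> = {}" by (rule incl_bot) simp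
  have t: "\<top>\<^bsub>incl_order (Pow X)\<^esub> = X" by (rule incl_top) auto
  show "X \<in> A" using bool_gen.top[of "incl_order (Pow X)" G] unfolding A_def t .
  show "{} \<in> A" using bool_gen.bot[of "incl_order (Pow X)" G] unfolding A_def b .
  fix x assume x: "x \<in> A"
  have "is_compl (incl_order (Pow X)) x (X - x)"
    by (subst is_compl_incl_order[of _ X]) (use sub[OF x] in auto)
  then show "X - x \<in> A" using x unfolding A_def by (rule bool_gen.compl[rotated])
  fix y assume y: "y \<in> A"
  have "x \<squnion>\<^bsub>incl_order (Pow X)\<^esub> y \<in> A" "x \<sqinter>\<^bsub>incl_order (Pow X)\<^esub> y \<in> A"
    using x y unfolding A_def by (auto intro: bool_gen.join bool_gen.meet)
  moreover have "x \<squnion>\<^bsub>incl_order (Pow X)\<^esub> y = x \<union> y" "x \<sqinter>\<^bsub>incl_order (Pow X)\<^esub> y = x \<inter> y"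
    using sub[OF x] sub[OF y] by (intro incl_join incl_meet; auto)+
  ultimately show "x \<union> y \<in> A \<and> x \<inter> y \<in> A" by simp
qed

lemma benv_gen_sub: "benv_emb C ` carrier C \<subseteq> Pow (prime_filters C)"
  by (auto simp: benv_emb_def)

lemmas benv_closed = bool_gen_Pow[OF benv_gen_sub[of C]] for C

lemma carrier_benv:
  "carrier (benv C) = bool_gen (incl_order (Pow (prime_filters C))) (benv_emb C ` carrier C)"
  by (simp add: benv_def)

lemma boolean_lattice_benv: "boolean_lattice (benv C)"
  unfolding benv_def by (rule boolean_lattice_incl_order[OF benv_closed])

lemma benv_ops:
  shows "\<bottom>\<^bsub>benv C\<^esub> = {}" "\<top>\<^bsub>benv C\<^esub> = prime_filters C"
    and "x \<in> carrier (benv C) \<Longrightarrow> y \<in> carrier (benv C) \<Longrightarrow> x \<squnion>\<^bsub>benv C\<^esub> y = x \<union> y"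
    and "x \<in> carrier (benv C) \<Longrightarrow> y \<in> carrier (benv C) \<Longrightarrow> x \<sqinter>\<^bsub>benv C\<^esub> y = x \<inter> y"
proof -
  note cl = benv_closed[where C=C, folded carrier_benv]
  have b: "benv C = incl_order (carrier (benv C))" by (simp add: benv_def)
  show "\<bottom>\<^bsub>benv C\<^esub> = {}" by (subst b) (rule incl_bot[OF cl(3)])
  show "\<top>\<^bsub>benv C\<^esub> = prime_filters C" by (subst b) (rule incl_top[OF cl(2,1)])
  assume xy: "x \<in> carrier (benv C)" "y \<in> carrier (benv C)"
  then show "x \<squnion>\<^bsub>benv C\<^esub> y = x \<union> y" by (subst b) (rule incl_join; simp add: cl)
  show "x \<sqinter>\<^bsub>benv C\<^esub> y = x \<inter> y" using xy by (subst b) (rule incl_meet; simp add: cl)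
qed

lemma benv_induct [consumes 1, case_names base bot top join meet compl]:
  assumes "U \<in> carrier (benv C)"
    and "\<And>a. a \<in> carrier C \<Longrightarrow> Q (benv_emb C a)" "Q {}" "Q (prime_filters C)"
    and "\<And>U V. \<lbrakk>U \<in> carrier (benv C); Q U; V \<in> carrier (benv C); Q V\<rbrakk> \<Longrightarrow> Q (U \<union> V)"
    and "\<And>U V. \<lbrakk>U \<in> carrier (benv C); Q U; V \<in> carrier (benv C); Q V\<rbrakk> \<Longrightarrow> Q (U \<inter> V)"
    and "\<And>U. \<lbrakk>U \<in> carrier (benv C); Q U\<rbrakk> \<Longrightarrow> Q (prime_filters C - U)"
  shows "Q U"
  using assms(1) unfolding carrier_benv
proof induction
  case (base x) then show ?case using assms(2) by blast
next
  case bot show ?case using assms(3) by (subst incl_bot) auto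
next
  case top show ?case using assms(4) by (subst incl_top[of "prime_filters C"]) auto
next
  case (join x y)
  then show ?case using benv_closed(1)[of C] assms(5)[of x y]
    by (subst incl_join) (auto simp: carrier_benv)
next
  case (meet x y)
  then show ?case using benv_closed(1)[of C] assms(6)[of x y]
    by (subst incl_meet) (auto simp: carrier_benv)
next
  case (compl x y)
  moreover have "y = prime_filters C - x"
    using compl benv_closed(1)[of C] is_compl_incl_order[of "Pow (prime_filters C)" "prime_filters C" x y]
    by blast
  ultimately show ?case using assms(7) by (simp add: carrier_benv)
qed

lemma prime_filter_exists:
  assumes C: "bdd_distrib_lattice C" and a: "a \<in> carrier C" and b: "b \<in> carrier C"
    and ab: "\<not> a \<sqsubseteq>\<^bsub>C\<^esub> b"
  shows "\<exists>P\<in>prime_filters C. a \<in> P \<and> b \<notin> P"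
proof -
  interpret bounded_lattice C using C by (simp add: bdd_distrib_lattice_def)
  have mm: "(p \<sqinter>\<^bsub>C\<^esub> q) \<sqinter>\<^bsub>C\<^esub> x \<sqsubseteq>\<^bsub>C\<^esub> p \<sqinter>\<^bsub>C\<^esub> x" "(p \<sqinter>\<^bsub>C\<^esub> q) \<sqinter>\<^bsub>C\<^esub> x \<sqsubseteq>\<^bsub>C\<^esub> q \<sqinter>\<^bsub>C\<^esub> x"
    if "p \<in> carrier C" "q \<in> carrier C" "x \<in> carrier C" for p q x
  proof -
    have c: "p \<sqinter>\<^bsub>C\<^esub> q \<in> carrier C" "(p \<sqinter>\<^bsub>C\<^esub> q) \<sqinter>\<^bsub>C\<^esub> x \<in> carrier C" using that by auto
    have "(p \<sqinter>\<^bsub>C\<^esub> q) \<sqinter>\<^bsub>C\<^esub> x \<sqsubseteq>\<^bsub>C\<^esub> p \<sqinter>\<^bsub>C\<^esub> q" "(p \<sqinter>\<^bsub>C\<^esub> q) \<sqinter>\<^bsub>C\<^esub> x \<sqsubseteq>\<^bsub>C\<^esub> x"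
      using c that by (auto intro: meet_left meet_right)
    moreover have "p \<sqinter>\<^bsub>C\<^esub> q \<sqsubseteq>\<^bsub>C\<^esub> p" "p \<sqinter>\<^bsub>C\<^esub> q \<sqsubseteq>\<^bsub>C\<^esub> q"
      using that by (auto intro: meet_left meet_right)
    ultimately have "(p \<sqinter>\<^bsub>C\<^esub> q) \<sqinter>\<^bsub>C\<^esub> x \<sqsubseteq>\<^bsub>C\<^esub> p" "(p \<sqinter>\<^bsub>C\<^esub> q) \<sqinter>\<^bsub>C\<^esub> x \<sqsubseteq>\<^bsub>C\<^esub> q" "(p \<sqinter>\<^bsub>C\<^esub> q) \<sqinter>\<^bsub>C\<^esub> x \<sqsubseteq>\<^bsub>C\<^esub> x"
      using c that le_trans by blast+
    then show "(p \<sqinter>\<^bsub>C\<^esub> q) \<sqinter>\<^bsub>C\<^esub> x \<sqsubseteq>\<^bsub>C\<^esub> p \<sqinter>\<^bsub>C\<^esub> x" "(p \<sqinter>\<^bsub>C\<^esub> q) \<sqinter>\<^bsub>C\<^esub> x \<sqsubseteq>\<^bsub>C\<^esub> q \<sqinter>\<^bsub>C\<^esub> x"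
      using c that meet_le by blast+
  qed
  define \<F> where "\<F> = {F. F \<subseteq> carrier C \<and> (\<forall>x\<in>F. \<forall>y\<in>carrier C. x \<sqsubseteq>\<^bsub>C\<^esub> y \<longrightarrow> y \<in> F) \<and>
    (\<forall>x\<in>F. \<forall>y\<in>F. x \<sqinter>\<^bsub>C\<^esub> y \<in> F) \<and> a \<in> F \<and> b \<notin> F}"
  define U where "U = {z \<in> carrier C. a \<sqsubseteq>\<^bsub>C\<^esub> z}"
  have "U \<in> \<F>"
    unfolding \<F>_def U_def using a b ab le_trans[OF _ _ a] by (auto simp: meet_le)
  then have ne: "\<F> \<noteq> {}" by blast
  have chain: "\<Union>K \<in> \<F>" if "K \<noteq> {}" "subset.chain \<F> K" for K
  proof -
    have "x \<sqinter>\<^bsub>C\<^esub> y \<in> \<Union>K" if xy: "x \<in> \<Union>K" "y \<in> \<Union>K" for x y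
    proof -
      obtain F G where FG: "F \<in> K" "G \<in> K" "x \<in> F" "y \<in> G" using xy by blast
      with that \<open>subset.chain \<F> K\<close> have "F \<subseteq> G \<or> G \<subseteq> F" by (auto simp: subset_chain_def)
      then obtain H where "H \<in> K" "x \<in> H" "y \<in> H" using FG by blast
      moreover have "H \<in> \<F>" using \<open>H \<in> K\<close> \<open>subset.chain \<F> K\<close> by (auto simp: subset_chain_def)
      ultimately show ?thesis unfolding \<F>_def by blast
    qed
    moreover have "K \<subseteq> \<F>" using that by (auto simp: subset_chain_def)
    ultimately show ?thesis
      using that(1) unfolding \<F>_def
      apply (intro CollectI conjI)
           apply blast
          apply (intro ballI impI, blast)
         apply blast+
      done
  qed
  obtain P where P: "P \<in> \<F>" and mx: "\<And>F. F \<in> \<F> \<Longrightarrow> P \<subseteq> F \<Longrightarrow> F = P"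
    using subset_Zorn_nonempty[OF ne chain] by blast
  have PC: "P \<subseteq> carrier C" and up: "\<And>x y. x \<in> P \<Longrightarrow> y \<in> carrier C \<Longrightarrow> x \<sqsubseteq>\<^bsub>C\<^esub> y \<Longrightarrow> y \<in> P"
    and mt: "\<And>x y. x \<in> P \<Longrightarrow> y \<in> P \<Longrightarrow> x \<sqinter>\<^bsub>C\<^esub> y \<in> P" and aP: "a \<in> P" and bP: "b \<notin> P"
    using P unfolding \<F>_def by blast+
  have ext: "\<exists>f\<in>P. f \<sqinter>\<^bsub>C\<^esub> x \<sqsubseteq>\<^bsub>C\<^esub> b" if x: "x \<in> carrier C" "x \<notin> P" for x
  proof (rule ccontr)
    assume no: "\<not> ?thesis"
    define G where "G = {z \<in> carrier C. \<exists>f\<in>P. f \<sqinter>\<^bsub>C\<^esub> x \<sqsubseteq>\<^bsub>C\<^esub> z}"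
    have PG: "P \<subseteq> G"
    proof
      fix f assume "f \<in> P"
      moreover from this have "f \<in> carrier C" using PC by blast
      ultimately show "f \<in> G" unfolding G_def using meet_left[OF _ x(1)] by blast
    qed
    have "x \<in> G" unfolding G_def using aP a x(1) by (auto intro: meet_right)
    have "y \<sqinter>\<^bsub>C\<^esub> z \<in> G" if yz: "y \<in> G" "z \<in> G" for y z
    proof -
      obtain f g where fg: "f \<in> P" "g \<in> P" "f \<sqinter>\<^bsub>C\<^esub> x \<sqsubseteq>\<^bsub>C\<^esub> y" "g \<sqinter>\<^bsub>C\<^esub> x \<sqsubseteq>\<^bsub>C\<^esub> z"
        and c: "y \<in> carrier C" "z \<in> carrier C"
        using yz unfolding G_def by blast
      have fgc: "f \<in> carrier C" "g \<in> carrier C" using fg PC by auto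
      have "(f \<sqinter>\<^bsub>C\<^esub> g) \<sqinter>\<^bsub>C\<^esub> x \<sqsubseteq>\<^bsub>C\<^esub> y" "(f \<sqinter>\<^bsub>C\<^esub> g) \<sqinter>\<^bsub>C\<^esub> x \<sqsubseteq>\<^bsub>C\<^esub> z"
        using le_trans[OF mm(1)[OF fgc x(1)] fg(3)] le_trans[OF mm(2)[OF fgc x(1)] fg(4)] fgc c x(1)
        by simp_all
      then have "(f \<sqinter>\<^bsub>C\<^esub> g) \<sqinter>\<^bsub>C\<^esub> x \<sqsubseteq>\<^bsub>C\<^esub> y \<sqinter>\<^bsub>C\<^esub> z"
        using fgc c x(1) by (simp add: meet_le)
      then show ?thesis unfolding G_def using mt[OF fg(1,2)] c by auto
    qed
    moreover have "z \<in> G" if "y \<in> G" "z \<in> carrier C" "y \<sqsubseteq>\<^bsub>C\<^esub> z" for y z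
    proof -
      obtain f where f: "f \<in> P" "f \<sqinter>\<^bsub>C\<^esub> x \<sqsubseteq>\<^bsub>C\<^esub> y" "y \<in> carrier C"
        using \<open>y \<in> G\<close> unfolding G_def by auto
      moreover have "f \<sqinter>\<^bsub>C\<^esub> x \<in> carrier C" using f(1) PC x(1) by auto
      ultimately have "f \<sqinter>\<^bsub>C\<^esub> x \<sqsubseteq>\<^bsub>C\<^esub> z" using le_trans[OF f(2) \<open>y \<sqsubseteq>\<^bsub>C\<^esub> z\<close>] that(2) by simp
      then show ?thesis unfolding G_def using f(1) that(2) by auto
    qed
    moreover have "b \<notin> G" using no unfolding G_def by blast
    moreover have "G \<subseteq> carrier C" unfolding G_def by blast
    moreover have "a \<in> G" using PG aP by blast
    ultimately have "G \<in> \<F>" unfolding \<F>_def by blast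
    then show False using mx[OF _ PG] \<open>x \<in> G\<close> x(2) by blast
  qed
  have prime: "x \<in> P \<or> y \<in> P"
    if xy: "x \<in> carrier C" "y \<in> carrier C" "x \<squnion>\<^bsub>C\<^esub> y \<in> P" for x y
  proof (rule ccontr)
    assume "\<not> ?thesis"
    then have "x \<notin> P" "y \<notin> P" by auto
    from ext[OF xy(1) this(1)] ext[OF xy(2) this(2)] obtain f g
      where fg: "f \<in> P" "g \<in> P" "f \<sqinter>\<^bsub>C\<^esub> x \<sqsubseteq>\<^bsub>C\<^esub> b" "g \<sqinter>\<^bsub>C\<^esub> y \<sqsubseteq>\<^bsub>C\<^esub> b"
      by (elim bexE)
    define k where "k = f \<sqinter>\<^bsub>C\<^esub> g"
    have "f \<in> carrier C" "g \<in> carrier C" using fg PC by auto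
    then have fgc: "f \<in> carrier C" "g \<in> carrier C" "k \<in> carrier C" by (simp_all add: k_def)
    have k: "k \<sqinter>\<^bsub>C\<^esub> x \<sqsubseteq>\<^bsub>C\<^esub> f \<sqinter>\<^bsub>C\<^esub> x" "k \<sqinter>\<^bsub>C\<^esub> y \<sqsubseteq>\<^bsub>C\<^esub> g \<sqinter>\<^bsub>C\<^esub> y"
      using mm fgc xy(1,2) unfolding k_def by auto
    have "k \<sqinter>\<^bsub>C\<^esub> x \<sqsubseteq>\<^bsub>C\<^esub> b" "k \<sqinter>\<^bsub>C\<^esub> y \<sqsubseteq>\<^bsub>C\<^esub> b"
      using le_trans[OF k(1) fg(3)] le_trans[OF k(2) fg(4)] fgc xy(1,2) b by simp_all
    then have "(k \<sqinter>\<^bsub>C\<^esub> x) \<squnion>\<^bsub>C\<^esub> (k \<sqinter>\<^bsub>C\<^esub> y) \<sqsubseteq>\<^bsub>C\<^esub> b"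
      using fgc xy b by (intro join_le) auto
    then have "k \<sqinter>\<^bsub>C\<^esub> (x \<squnion>\<^bsub>C\<^esub> y) \<sqsubseteq>\<^bsub>C\<^esub> b"
      using C fgc xy by (simp add: bdd_distrib_lattice_def)
    moreover have "k \<sqinter>\<^bsub>C\<^esub> (x \<squnion>\<^bsub>C\<^esub> y) \<in> P" using mt fg xy by (simp add: k_def)
    ultimately show False using up b bP by blast
  qed
  have "\<top>\<^bsub>C\<^esub> \<in> P" using up[OF aP] a by simp
  moreover have "\<bottom>\<^bsub>C\<^esub> \<notin> P" using up[of "\<bottom>\<^bsub>C\<^esub>" b] b bP by auto
  ultimately have "P \<in> prime_filters C"
    unfolding prime_filters_def using PC up mt prime by blast
  then show ?thesis using aP bP by blast
qed

lemma benv_emb_ops: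
  assumes "bounded_lattice C"
  shows "benv_emb C \<bottom>\<^bsub>C\<^esub> = {}" "benv_emb C \<top>\<^bsub>C\<^esub> = prime_filters C"
    and "\<lbrakk>x \<in> carrier C; y \<in> carrier C\<rbrakk> \<Longrightarrow> benv_emb C (x \<squnion>\<^bsub>C\<^esub> y) = benv_emb C x \<union> benv_emb C y"
    and "\<lbrakk>x \<in> carrier C; y \<in> carrier C\<rbrakk> \<Longrightarrow> benv_emb C (x \<sqinter>\<^bsub>C\<^esub> y) = benv_emb C x \<inter> benv_emb C y"
proof -
  interpret bounded_lattice C by fact
  show "benv_emb C \<bottom>\<^bsub>C\<^esub> = {}" "benv_emb C \<top>\<^bsub>C\<^esub> = prime_filters C"
    by (auto simp: benv_emb_def prime_filters_def)
  assume xy: "x \<in> carrier C" "y \<in> carrier C"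
  then have le: "x \<sqsubseteq>\<^bsub>C\<^esub> x \<squnion>\<^bsub>C\<^esub> y" "y \<sqsubseteq>\<^bsub>C\<^esub> x \<squnion>\<^bsub>C\<^esub> y" "x \<sqinter>\<^bsub>C\<^esub> y \<sqsubseteq>\<^bsub>C\<^esub> x" "x \<sqinter>\<^bsub>C\<^esub> y \<sqsubseteq>\<^bsub>C\<^esub> y"
    and cl: "x \<squnion>\<^bsub>C\<^esub> y \<in> carrier C" "x \<sqinter>\<^bsub>C\<^esub> y \<in> carrier C"
    by (auto intro: join_left join_right meet_left meet_right)
  show "benv_emb C (x \<squnion>\<^bsub>C\<^esub> y) = benv_emb C x \<union> benv_emb C y"
    using xy le cl unfolding benv_emb_def prime_filters_def by blast
  show "benv_emb C (x \<sqinter>\<^bsub>C\<^esub> y) = benv_emb C x \<inter> benv_emb C y"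
    using xy le cl unfolding benv_emb_def prime_filters_def by blast
qed

lemma benv_emb_closed: "a \<in> carrier C \<Longrightarrow> benv_emb C a \<in> carrier (benv C)"
  by (auto simp: carrier_benv intro: bool_gen.base)

theorem benv_emb_hom:
  assumes "bdd_distrib_lattice C"
  shows "bdd_lattice_hom C (benv C) (benv_emb C)"
proof -
  have C: "bounded_lattice C" using assms by (simp add: bdd_distrib_lattice_def)
  have B: "bounded_lattice (benv C)"
    using boolean_lattice_benv[of C] by (simp add: boolean_lattice_def bdd_distrib_lattice_def)
  show ?thesis
    unfolding bdd_lattice_hom_def join_pres_def meet_pres_def
    using bounded_lattice.axioms(1)[OF C] bounded_lattice.axioms(1)[OF B]
    by (auto simp: benv_emb_closed benv_ops benv_emb_ops[OF C])
qed

theorem benv_emb_inj: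
  assumes "bdd_distrib_lattice C"
  shows "inj_on (benv_emb C) (carrier C)"
proof (rule inj_onI)
  interpret bounded_lattice C using assms by (simp add: bdd_distrib_lattice_def)
  fix x y assume xy: "x \<in> carrier C" "y \<in> carrier C" "benv_emb C x = benv_emb C y"
  have le: "u \<sqsubseteq>\<^bsub>C\<^esub> v" if uv: "u \<in> carrier C" "v \<in> carrier C" "benv_emb C u = benv_emb C v" for u v
  proof (rule ccontr)
    assume "\<not> u \<sqsubseteq>\<^bsub>C\<^esub> v"
    then obtain P where "P \<in> prime_filters C" "u \<in> P" "v \<notin> P"
      using prime_filter_exists[OF assms uv(1,2)] by auto
    then have "P \<in> benv_emb C u" "P \<notin> benv_emb C v" by (simp_all add: benv_emb_def)
    then show False using uv(3) by simp
  qed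
  show "x = y"
    using le_antisym[OF le[OF xy] le[OF xy(2,1) xy(3)[symmetric]] xy(1,2)] .
qed

lemma is_compl_unique:
  assumes C: "bdd_distrib_lattice C" and x: "x \<in> carrier C"
    and y: "is_compl C x y" and z: "is_compl C x z"
  shows "y = z"
proof -
  interpret bounded_lattice C using C by (simp add: bdd_distrib_lattice_def)
  have c: "y \<in> carrier C" "z \<in> carrier C" using y z by (auto simp: is_compl_def)
  have "benv_emb C y = prime_filters C - benv_emb C x" if "is_compl C x y" for y
  proof -
    have "benv_emb C x \<inter> benv_emb C y = {}" "benv_emb C x \<union> benv_emb C y = prime_filters C"
      using that x benv_emb_ops[OF bounded_lattice_axioms] unfolding is_compl_def by metis+
    then show ?thesis by blast
  qed
  then have "benv_emb C y = benv_emb C z" using y z by simp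
  then show ?thesis using benv_emb_inj[OF C] c by (auto dest: inj_onD)
qed

theorem benv_universal:
  fixes C :: "('a, 'm) gorder_scheme" and B :: "('b, 'n) gorder_scheme"
  assumes C: "bdd_distrib_lattice C" and B: "boolean_lattice B" and h: "bdd_lattice_hom C B h"
  shows "\<exists>!g. g \<in> extensional (carrier (benv C)) \<and> bdd_lattice_hom (benv C) B g \<and>
    (\<forall>a\<in>carrier C. g (benv_emb C a) = h a)"
proof -
  have B': "bdd_distrib_lattice B" and cB: "\<And>x. x \<in> carrier B \<Longrightarrow> \<exists>y. is_compl B x y"
    using B by (auto simp: boolean_lattice_def)
  have bB: "bounded_lattice B" using B' by (simp add: bdd_distrib_lattice_def)
  have bC: "bounded_lattice C" using C by (simp add: bdd_distrib_lattice_def)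
  interpret B: bounded_lattice B by fact
  interpret C: bounded_lattice C by fact
  have lE: "lattice (benv C)"
    using boolean_lattice_benv[of C]
    by (auto simp: boolean_lattice_def bdd_distrib_lattice_def dest: bounded_lattice.axioms(1))
  let ?E = "carrier (benv C)"
  note Bo = benv_emb_ops[OF bB]
  have E: "{} \<in> ?E" "prime_filters C \<in> ?E"
    and E2: "\<And>U V. U \<in> ?E \<Longrightarrow> V \<in> ?E \<Longrightarrow> U \<union> V \<in> ?E \<and> U \<inter> V \<in> ?E"
    and E3: "\<And>U. U \<in> ?E \<Longrightarrow> prime_filters C - U \<in> ?E"
    and E4: "\<And>U. U \<in> ?E \<Longrightarrow> U \<subseteq> prime_filters C"
    using benv_closed[where C=C] unfolding carrier_benv by blast+
  have hC: "h x \<in> carrier B" if "x \<in> carrier C" for x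
    using h that by (auto simp: bdd_lattice_hom_def)
  have hj: "h (x \<squnion>\<^bsub>C\<^esub> y) = h x \<squnion>\<^bsub>B\<^esub> h y" "h (x \<sqinter>\<^bsub>C\<^esub> y) = h x \<sqinter>\<^bsub>B\<^esub> h y"
    if "x \<in> carrier C" "y \<in> carrier C" for x y
    using h that by (auto simp: bdd_lattice_hom_def join_pres_def meet_pres_def)
  have h01: "h \<bottom>\<^bsub>C\<^esub> = \<bottom>\<^bsub>B\<^esub>" "h \<top>\<^bsub>C\<^esub> = \<top>\<^bsub>B\<^esub>" using h by (auto simp: bdd_lattice_hom_def)
  have "isotone C B h"
    using h by (intro join_pres_isotone) (auto simp: bdd_lattice_hom_def)
  then have hmono: "h x \<sqsubseteq>\<^bsub>B\<^esub> h y" if "x \<in> carrier C" "y \<in> carrier C" "x \<sqsubseteq>\<^bsub>C\<^esub> y" for x y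
    using that by (auto simp: isotone_def)
  define pre where "pre Q = {a \<in> carrier C. h a \<in> Q}" for Q
  define inv where "inv U = {Q \<in> prime_filters B. pre Q \<in> U}" for U
  have pf: "pre Q \<in> prime_filters C" if Q: "Q \<in> prime_filters B" for Q
  proof -
    have q: "\<top>\<^bsub>B\<^esub> \<in> Q" "\<bottom>\<^bsub>B\<^esub> \<notin> Q" "\<And>x y. x \<in> Q \<Longrightarrow> y \<in> carrier B \<Longrightarrow> x \<sqsubseteq>\<^bsub>B\<^esub> y \<Longrightarrow> y \<in> Q"
      "\<And>x y. x \<in> Q \<Longrightarrow> y \<in> Q \<Longrightarrow> x \<sqinter>\<^bsub>B\<^esub> y \<in> Q"
      "\<And>x y. x \<in> carrier B \<Longrightarrow> y \<in> carrier B \<Longrightarrow> x \<squnion>\<^bsub>B\<^esub> y \<in> Q \<Longrightarrow> x \<in> Q \<or> y \<in> Q"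
      using Q unfolding prime_filters_def by blast+
    have "\<forall>x\<in>pre Q. \<forall>y\<in>carrier C. x \<sqsubseteq>\<^bsub>C\<^esub> y \<longrightarrow> y \<in> pre Q"
      using q(3) hmono hC unfolding pre_def by blast
    moreover have "\<forall>x\<in>pre Q. \<forall>y\<in>pre Q. x \<sqinter>\<^bsub>C\<^esub> y \<in> pre Q"
      using q(4) hj unfolding pre_def by simp
    moreover have "\<forall>x\<in>carrier C. \<forall>y\<in>carrier C. x \<squnion>\<^bsub>C\<^esub> y \<in> pre Q \<longrightarrow> x \<in> pre Q \<or> y \<in> pre Q"
      using q(5) hj hC unfolding pre_def by simp
    ultimately show ?thesis
      unfolding prime_filters_def using q(1,2) h01 by (auto simp: pre_def)
  qed
  have inv_ops: "inv {} = {}" "inv (prime_filters C) = prime_filters B"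
    "\<And>U V. inv (U \<union> V) = inv U \<union> inv V" "\<And>U V. inv (U \<inter> V) = inv U \<inter> inv V"
    "\<And>U. inv (prime_filters C - U) = prime_filters B - inv U"
    unfolding inv_def using pf by auto
  have inv_emb: "inv (benv_emb C a) = benv_emb B (h a)" if "a \<in> carrier C" for a
    unfolding inv_def benv_emb_def using pf that by (auto simp: pre_def)
  have inj: "b = c" if "b \<in> carrier B" "c \<in> carrier B" "benv_emb B b = benv_emb B c" for b c
    using benv_emb_inj[OF B'] that by (auto dest: inj_onD)
  have ex: "\<exists>b\<in>carrier B. benv_emb B b = inv U" if "U \<in> ?E" for U
    using that
  proof (induction rule: benv_induct)
    case (base a) then show ?case using inv_emb hC by metis
  next
    case bot show ?case using Bo(1) inv_ops(1) by auto
  next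
    case top show ?case using Bo(2) inv_ops(2) by auto
  next
    case (join U V) then show ?case using Bo(3) inv_ops(3) by (metis B.join_closed)
  next
    case (meet U V) then show ?case using Bo(4) inv_ops(4) by (metis B.meet_closed)
  next
    case (compl U)
    then obtain b c where b: "b \<in> carrier B" "benv_emb B b = inv U" "is_compl B b c"
      using cB by blast
    then have c: "c \<in> carrier B" "b \<sqinter>\<^bsub>B\<^esub> c = \<bottom>\<^bsub>B\<^esub>" "b \<squnion>\<^bsub>B\<^esub> c = \<top>\<^bsub>B\<^esub>"
      by (auto simp: is_compl_def)
    have "inv U \<inter> benv_emb B c = {}" "inv U \<union> benv_emb B c = prime_filters B"
      using Bo(4)[OF b(1) c(1)] Bo(3)[OF b(1) c(1)] Bo(1,2) b(2) c(2,3) by auto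
    then have "benv_emb B c = inv (prime_filters C - U)" unfolding inv_ops by blast
    then show ?case using c(1) by blast
  qed
  define g where "g = (\<lambda>U\<in>?E. SOME b. b \<in> carrier B \<and> benv_emb B b = inv U)"
  have g: "g U \<in> carrier B" "benv_emb B (g U) = inv U" if "U \<in> ?E" for U
    using someI_ex[OF ex[OF that, unfolded Bex_def]] that unfolding g_def by auto
  have g1: "g (benv_emb C a) = h a" if "a \<in> carrier C" for a
    using inj g benv_emb_closed that inv_emb hC by metis
  have "g (U \<union> V) = g U \<squnion>\<^bsub>B\<^esub> g V" "g (U \<inter> V) = g U \<sqinter>\<^bsub>B\<^esub> g V" if "U \<in> ?E" "V \<in> ?E" for U V
    using inj g that E2[OF that] Bo(3,4) inv_ops(3,4) by (metis B.join_closed B.meet_closed)+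
  moreover have "g {} = \<bottom>\<^bsub>B\<^esub>" "g (prime_filters C) = \<top>\<^bsub>B\<^esub>"
    using inj g E Bo(1,2) inv_ops(1,2) by (metis B.bottom_closed B.top_closed)+
  ultimately have ghom: "bdd_lattice_hom (benv C) B g"
    unfolding bdd_lattice_hom_def join_pres_def meet_pres_def
    using lE B.lattice_axioms g(1) by (auto simp: benv_ops)
  have uniq: "k U = g U"
    if k: "bdd_lattice_hom (benv C) B k" "\<forall>a\<in>carrier C. k (benv_emb C a) = h a"
      and U: "U \<in> ?E" for k U
  proof -
    have co: "is_compl B (l U) (l (prime_filters C - U))"
      if l: "bdd_lattice_hom (benv C) B l" and "U \<in> ?E" for l U
    proof -
      let ?V = "prime_filters C - U"
      have UV: "U \<in> ?E" "?V \<in> ?E" using that(2) E3 by auto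
      have eq: "U \<union> ?V = prime_filters C" "U \<inter> ?V = {}" using E4[OF that(2)] by blast+
      have lj: "\<forall>x\<in>?E. \<forall>y\<in>?E. l (x \<squnion>\<^bsub>benv C\<^esub> y) = l x \<squnion>\<^bsub>B\<^esub> l y"
        and lm: "\<forall>x\<in>?E. \<forall>y\<in>?E. l (x \<sqinter>\<^bsub>benv C\<^esub> y) = l x \<sqinter>\<^bsub>B\<^esub> l y"
        and l01: "l {} = \<bottom>\<^bsub>B\<^esub>" "l (prime_filters C) = \<top>\<^bsub>B\<^esub>" and lf: "l \<in> ?E \<rightarrow> carrier B"
        using l unfolding bdd_lattice_hom_def join_pres_def meet_pres_def benv_ops(1,2) by blast+
      have "l U \<squnion>\<^bsub>B\<^esub> l ?V = l (U \<squnion>\<^bsub>benv C\<^esub> ?V)" "l U \<sqinter>\<^bsub>B\<^esub> l ?V = l (U \<sqinter>\<^bsub>benv C\<^esub> ?V)"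
        using lj[rule_format, OF UV] lm[rule_format, OF UV] by simp_all
      then show ?thesis
        unfolding is_compl_def benv_ops(3,4)[OF UV] eq l01 using funcset_mem[OF lf UV(2)] by blast
    qed
    show ?thesis
      using U
    proof (induction rule: benv_induct)
      case (base a) then show ?case using k(2) g1 by simp
    next
      case bot show ?case using k(1) ghom by (simp add: bdd_lattice_hom_def benv_ops)
    next
      case top show ?case using k(1) ghom by (simp add: bdd_lattice_hom_def benv_ops)
    next
      case (join U V)
      then show ?case
        using k(1) ghom by (simp add: bdd_lattice_hom_def join_pres_def benv_ops)
    next
      case (meet U V)
      then show ?case
        using k(1) ghom by (simp add: bdd_lattice_hom_def meet_pres_def benv_ops)
    next
      case (compl U)
      then show ?case
        using is_compl_unique[OF B' g(1)[OF compl(1)]] co[OF k(1) compl(1)] co[OF ghom compl(1)]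
        by simp
    qed
  qed
  show ?thesis
  proof (rule ex1I[of _ g])
    show "g \<in> extensional ?E \<and> bdd_lattice_hom (benv C) B g \<and>
        (\<forall>a\<in>carrier C. g (benv_emb C a) = h a)"
      using ghom g1 by (auto simp: g_def)
  next
    fix k assume "k \<in> extensional ?E \<and> bdd_lattice_hom (benv C) B k \<and>
        (\<forall>a\<in>carrier C. k (benv_emb C a) = h a)"
    then show "k = g" using uniq by (intro extensionalityI[of k ?E g]) (auto simp: g_def)
  qed
qed

subsection \<open>Extension to the envelope, and the MacNeille completion\<close>

text \<open>
  The unique extension of a bounded lattice homomorphism from \<open>C\<close> into a Boolean algebra
  \<open>B\<close> to a Boolean homomorphism on the envelope.
\<close>

definition benv_ext ::
    "('a, 'm) gorder_scheme \<Rightarrow> ('b, 'n) gorder_scheme \<Rightarrow> ('a \<Rightarrow> 'b) \<Rightarrow> 'a set set \<Rightarrow> 'b" where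
  "benv_ext C B h = (THE g. g \<in> extensional (carrier (benv C)) \<and>
     bdd_lattice_hom (benv C) B g \<and> (\<forall>a\<in>carrier C. g (benv_emb C a) = h a))"

text \<open>The MacNeille completion as the lattice of normal ideals, and the embedding into it.\<close>

definition macneille :: "('a, 'm) gorder_scheme \<Rightarrow> 'a set gorder" where
  "macneille P = incl_order {A. A \<subseteq> carrier P \<and> Lower P (Upper P A) = A}"

definition macneille_emb :: "('a, 'm) gorder_scheme \<Rightarrow> 'a \<Rightarrow> 'a set" where
  "macneille_emb P x = {y \<in> carrier P. y \<sqsubseteq>\<^bsub>P\<^esub> x}"


section \<open>The functors and the comparison maps\<close>

text \<open>
  Objects live over arbitrary types and morphisms may connect objects over different types,
  so both categories comprise the structures over all types at once.  A fixed type would not be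
  closed under \<open>F\<close>: the MacNeille completion of the Boolean envelope of an infinite lattice
  can be larger than the type it is built from.
\<close>

definition R_ob :: "'a mt \<Rightarrow> 'a raney" where
  "R_ob M = \<lparr>carrier = saturated M, eq = (=), le = le M, sub = opens M\<rparr>"

definition R_mor :: "'a mt \<Rightarrow> ('a \<Rightarrow> 'b) \<Rightarrow> 'a \<Rightarrow> 'b" where
  "R_mor M f = restrict f (saturated M)"

type_synonym 'a funayama = "'a set set set"

abbreviation fun_emb :: "'a raney \<Rightarrow> 'a set set \<Rightarrow> 'a funayama" where
  "fun_emb R \<equiv> macneille_emb (benv R)"

definition F_ob :: "'a raney \<Rightarrow> 'a funayama mt" where
  "F_ob R = (let FC = macneille (benv R) in
     \<lparr>carrier = carrier FC, eq = (=), le = le FC,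
      box = (\<lambda>a. \<Squnion>\<^bsub>FC\<^esub> {e. \<exists>u\<in>sub R. e = fun_emb R (benv_emb R u) \<and> e \<sqsubseteq>\<^bsub>FC\<^esub> a})\<rparr>)"

definition benv_map :: "'a raney \<Rightarrow> 'b raney \<Rightarrow> ('a \<Rightarrow> 'b) \<Rightarrow> 'a set set \<Rightarrow> 'b set set" where
  "benv_map R\<^sub>1 R\<^sub>2 h = benv_ext R\<^sub>1 (benv R\<^sub>2) (\<lambda>a. benv_emb R\<^sub>2 (h a))"

definition F_mor ::
    "'a raney \<Rightarrow> 'b raney \<Rightarrow> ('a \<Rightarrow> 'b) \<Rightarrow> 'a funayama \<Rightarrow> 'b funayama" where
  "F_mor R\<^sub>1 R\<^sub>2 h = (\<lambda>a\<in>carrier (F_ob R\<^sub>1). \<Squnion>\<^bsub>F_ob R\<^sub>2\<^esub>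
     {fun_emb R\<^sub>2 (benv_map R\<^sub>1 R\<^sub>2 h x) |x.
        x \<in> carrier (benv R\<^sub>1) \<and> fun_emb R\<^sub>1 x \<sqsubseteq>\<^bsub>F_ob R\<^sub>1\<^esub> a})"

text \<open>
  The unit: the inclusion of \<open>C\<close> in its Funayama envelope, with codomain the saturated
  elements.
\<close>

definition eta :: "'a raney \<Rightarrow> 'a \<Rightarrow> 'a funayama" where
  "eta R = (\<lambda>c\<in>carrier R. fun_emb R (benv_emb R c))"

text \<open>
  The counit: \<open>benv_ext (R_ob M) M (\<lambda>a. a)\<close> extends the inclusion of the saturated elements
  to the Boolean homomorphism from their Boolean envelope onto \<open>bool_sat M\<close>; \<open>eps M\<close> extends
  it to the MacNeille completion by the same formula as in \<open>F_mor\<close>.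
\<close>

definition eps :: "'a mt \<Rightarrow> 'a funayama \<Rightarrow> 'a" where
  "eps M = (\<lambda>a\<in>carrier (F_ob (R_ob M)). \<Squnion>\<^bsub>M\<^esub>
     {benv_ext (R_ob M) M (\<lambda>a. a) x |x.
        x \<in> carrier (benv (R_ob M)) \<and> fun_emb (R_ob M) x \<sqsubseteq>\<^bsub>F_ob (R_ob M)\<^esub> a})"

end

theory Submission
  imports Defs
begin

text \<open>
  The functor \<open>R\<close> is fully faithful and \<open>eta\<close> is an isomorphism; everything else in the equivalence
  follows formally from these two facts.

  \<^bold>\<open>Faithfulness.\<close>  The formula \<open>f a = \<Squnion>{f x |x. x \<in> bool_sat M \<and> x \<sqsubseteq> a}\<close> determines a Raney
  morphism by its values on \<open>bool_sat M\<close>.  There it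
  is a Boolean homomorphism, hence determined by its values on the generators, the saturated
  elements (\<open>raney_faithful\<close>).

  \<^bold>\<open>Fullness.\<close>  A morphism \<open>k\<close> of Raney extensions between the saturated elements of \<open>M\<close> and \<open>M'\<close>
  extends to the Boolean envelope of \<open>saturated M\<close>.  This envelope is a copy of \<open>bool_sat M\<close>: every
  nonempty member of the envelope contains a nonempty difference \<open>c - d\<close> of members of the lattice
  (\<open>benv_basic_nbhd\<close>), so a homomorphism on the envelope that reflects the order of the lattice is
  injective (\<open>benv_hom_inj\<close>).  The resulting homomorphism on \<open>bool_sat M\<close> is then extended to \<open>M\<close> by
  the same formula; the extension preserves binary meets because \<open>M'\<close>, a complete Boolean algebra,
  satisfies the infinite distributive law (\<open>raney_full\<close>).

  \<^bold>\<open>The unit.\<close>  Both distributive laws of a Raney extension \<open>(C, L)\<close> are used to embed it into its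
  Funayama envelope: the law for meets over joins of elements of \<open>L\<close> says that these joins remain
  joins in the Boolean envelope, and the coframe law says the same of all meets of \<open>C\<close>.  The
  MacNeille completion preserves all existing joins and meets.  Hence the open elements of \<open>F R\<close> are
  the image of \<open>L\<close>, the saturated elements are the image of \<open>C\<close>, and \<open>eta R\<close> is an isomorphism
  (\<open>raney.eta_inverse\<close>).

  \<^bold>\<open>The rest.\<close>  A Raney morphism from \<open>F R\<close> to \<open>M\<close> is now the same as a morphism from \<open>R\<close> to \<open>R M\<close>, by
  composition with \<open>eta R\<close> (\<open>F_ob_faithful\<close>, \<open>F_ob_full\<close>).  The explicitly given maps \<open>F_mor\<close> and
  \<open>eps\<close> are the Raney morphisms that correspond in this way to \<open>eta R2 \<circ> h\<close> and to the identity of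
  \<open>R M\<close>.  All equations between Raney morphisms out of a Funayama envelope need to be checked only
  on the image of \<open>eta\<close>, and the inverse of \<open>eps M\<close> is the extension of \<open>eta (R M)\<close> given by fullness.
\<close>

section \<open>Inherited orders\<close>

text \<open>
  The same order is carried by records of different types: \<open>R_ob M\<close> has the order of
  \<open>M\<lparr>carrier := saturated M\<rparr>\<close>, and \<open>F_ob R\<close> that of the MacNeille completion.  Truncation to the
  order part identifies them, and no order-theoretic notion distinguishes a record from its
  truncation.
\<close>

lemma truncate_order [simp]:
  "carrier (gorder.truncate L) = carrier L" "le (gorder.truncate L) = le L"
  "eq (gorder.truncate L) = eq L"
  by (simp_all add: gorder.truncate_def)

lemma truncate_ops [simp]:
  "\<Squnion>\<^bsub>gorder.truncate L\<^esub> S = \<Squnion>\<^bsub>L\<^esub> S" "\<Sqinter>\<^bsub>gorder.truncate L\<^esub> S = \<Sqinter>\<^bsub>L\<^esub> S"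
  "x \<squnion>\<^bsub>gorder.truncate L\<^esub> y = x \<squnion>\<^bsub>L\<^esub> y" "x \<sqinter>\<^bsub>gorder.truncate L\<^esub> y = x \<sqinter>\<^bsub>L\<^esub> y"
  "\<top>\<^bsub>gorder.truncate L\<^esub> = \<top>\<^bsub>L\<^esub>" "\<bottom>\<^bsub>gorder.truncate L\<^esub> = \<bottom>\<^bsub>L\<^esub>"
  by (simp_all add: Lattice.sup_def Lattice.inf_def join_def meet_def top_def bottom_def
      least_def greatest_def Upper_def Lower_def)

lemma truncate_locales [simp]:
  "partial_order (gorder.truncate L) = partial_order L"
  "lattice (gorder.truncate L) = lattice L"
  "complete_lattice (gorder.truncate L) = complete_lattice L"
  "bounded_lattice (gorder.truncate L) = bounded_lattice L"
  by (simp_all add: complete_lattice_def complete_lattice_axioms_def bounded_lattice_def lattice_def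
      upper_semilattice_def upper_semilattice_axioms_def lower_semilattice_def
      lower_semilattice_axioms_def weak_partial_order_bottom_def weak_partial_order_bottom_axioms_def
      weak_partial_order_top_def weak_partial_order_top_axioms_def partial_order_def
      partial_order_axioms_def weak_partial_order_def weak_partial_order_axioms_def equivalence_def
      least_def greatest_def Upper_def Lower_def)

lemma truncate_boolean_lattice [simp]:
  "boolean_lattice (gorder.truncate L) = boolean_lattice L"
  by (simp add: boolean_lattice_def bdd_distrib_lattice_def is_compl_def)

lemma truncate_mor:
  "coframe_mor (gorder.truncate X) (gorder.truncate Y) f = coframe_mor X Y f"
  "frame_mor (gorder.truncate X) (gorder.truncate Y) f = frame_mor X Y f"
  by (simp_all add: coframe_mor_def frame_mor_def sup_pres_def inf_pres_def join_pres_def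
      meet_pres_def)

lemma image_cong_on: "S \<subseteq> A \<Longrightarrow> (\<And>x. x \<in> A \<Longrightarrow> f x = g x) \<Longrightarrow> f ` S = g ` S"
  by (rule image_cong) auto

lemma coframe_mor_cong:
  assumes "gorder.truncate X = gorder.truncate X'" "gorder.truncate Y = gorder.truncate Y'"
    and fg: "\<And>x. x \<in> carrier X \<Longrightarrow> f x = g x" and f: "coframe_mor X Y f"
  shows "coframe_mor X' Y' g"
proof -
  have l: "complete_lattice X" "lattice X"
    using f by (auto simp: coframe_mor_def inf_pres_def)
  interpret complete_lattice X by fact
  have "f ` S = g ` S" if "S \<subseteq> carrier X" for S
    using that fg by (rule image_cong_on)
  then have "coframe_mor X Y g"
    using f fg by (simp add: coframe_mor_def inf_pres_def join_pres_def Pi_iff)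
  then show ?thesis using assms(1,2) truncate_mor(1) by metis
qed

lemma frame_mor_cong:
  assumes "gorder.truncate X = gorder.truncate X'" "gorder.truncate Y = gorder.truncate Y'"
    and fg: "\<And>x. x \<in> carrier X \<Longrightarrow> f x = g x" and f: "frame_mor X Y f"
  shows "frame_mor X' Y' g"
proof -
  have l: "complete_lattice X" "lattice X"
    using f by (auto simp: frame_mor_def sup_pres_def)
  interpret complete_lattice X by fact
  have "f ` S = g ` S" if "S \<subseteq> carrier X" for S
    using that fg by (rule image_cong_on)
  then have "frame_mor X Y g"
    using f fg by (simp add: frame_mor_def sup_pres_def meet_pres_def Pi_iff)
  then show ?thesis using assms(1,2) truncate_mor(2) by metis
qed

lemma coframe_mor_compose:
  assumes "coframe_mor X Y f" "coframe_mor Y Z g"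
  shows "coframe_mor X Z (\<lambda>x. g (f x))"
proof -
  have "f \<in> carrier X \<rightarrow> carrier Y" using assms(1) by (simp add: coframe_mor_def)
  moreover have "g (\<Sqinter>\<^bsub>Y\<^esub> (f ` S)) = \<Sqinter>\<^bsub>Z\<^esub> ((\<lambda>x. g (f x)) ` S)" if "S \<subseteq> carrier X" for S
  proof -
    have "f ` S \<subseteq> carrier Y" using calculation that by auto
    then show ?thesis
      using assms(2) by (simp add: coframe_mor_def inf_pres_def image_image)
  qed
  ultimately show ?thesis
    using assms by (auto simp: coframe_mor_def inf_pres_def join_pres_def Pi_iff)
qed

lemma frame_mor_compose:
  assumes "frame_mor X Y f" "frame_mor Y Z g"
  shows "frame_mor X Z (\<lambda>x. g (f x))"
proof -
  have "f \<in> carrier X \<rightarrow> carrier Y" using assms(1) by (simp add: frame_mor_def)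
  moreover have "g (\<Squnion>\<^bsub>Y\<^esub> (f ` S)) = \<Squnion>\<^bsub>Z\<^esub> ((\<lambda>x. g (f x)) ` S)" if "S \<subseteq> carrier X" for S
  proof -
    have "f ` S \<subseteq> carrier Y" using calculation that by auto
    then show ?thesis
      using assms(2) by (simp add: frame_mor_def sup_pres_def image_image)
  qed
  ultimately show ?thesis
    using assms by (auto simp: frame_mor_def sup_pres_def meet_pres_def Pi_iff)
qed

lemma coframe_mor_inverse:
  assumes f: "coframe_mor X Y f" and g: "g \<in> carrier Y \<rightarrow> carrier X"
    and gf: "\<And>x. x \<in> carrier X \<Longrightarrow> g (f x) = x" and fg: "\<And>y. y \<in> carrier Y \<Longrightarrow> f (g y) = y"
  shows "coframe_mor Y X g"
proof -
  interpret X: complete_lattice X using f by (simp add: coframe_mor_def inf_pres_def)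
  interpret Y: complete_lattice Y using f by (simp add: coframe_mor_def inf_pres_def)
  have gc: "g y \<in> carrier X" if "y \<in> carrier Y" for y using g that by auto
  have "g (\<Sqinter>\<^bsub>Y\<^esub> S) = \<Sqinter>\<^bsub>X\<^esub> (g ` S)" if S: "S \<subseteq> carrier Y" for S
  proof -
    have gS: "g ` S \<subseteq> carrier X" using gc S by auto
    have "f ` g ` S = S" using fg S by (auto simp: image_image subset_iff cong: image_cong)
    then have "\<Sqinter>\<^bsub>Y\<^esub> S = f (\<Sqinter>\<^bsub>X\<^esub> (g ` S))" using f gS by (simp add: coframe_mor_def inf_pres_def)
    then show ?thesis using gf gS by simp
  qed
  moreover have "g (x \<squnion>\<^bsub>Y\<^esub> y) = g x \<squnion>\<^bsub>X\<^esub> g y" if "x \<in> carrier Y" "y \<in> carrier Y" for x y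
  proof -
    have "f (g x \<squnion>\<^bsub>X\<^esub> g y) = x \<squnion>\<^bsub>Y\<^esub> y"
      using f fg gc that by (simp add: coframe_mor_def join_pres_def)
    then show ?thesis using gf gc that by (metis X.join_closed)
  qed
  moreover have "g \<bottom>\<^bsub>Y\<^esub> = \<bottom>\<^bsub>X\<^esub>"
    using f gf[of "\<bottom>\<^bsub>X\<^esub>"] by (simp add: coframe_mor_def)
  ultimately show ?thesis
    using f g by (simp add: coframe_mor_def inf_pres_def join_pres_def)
qed

lemma frame_mor_inverse:
  assumes f: "frame_mor X Y f" and g: "g \<in> carrier Y \<rightarrow> carrier X"
    and gf: "\<And>x. x \<in> carrier X \<Longrightarrow> g (f x) = x" and fg: "\<And>y. y \<in> carrier Y \<Longrightarrow> f (g y) = y"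
  shows "frame_mor Y X g"
proof -
  interpret X: complete_lattice X using f by (simp add: frame_mor_def sup_pres_def)
  interpret Y: complete_lattice Y using f by (simp add: frame_mor_def sup_pres_def)
  have gc: "g y \<in> carrier X" if "y \<in> carrier Y" for y using g that by auto
  have "g (\<Squnion>\<^bsub>Y\<^esub> S) = \<Squnion>\<^bsub>X\<^esub> (g ` S)" if S: "S \<subseteq> carrier Y" for S
  proof -
    have gS: "g ` S \<subseteq> carrier X" using gc S by auto
    have "f ` g ` S = S" using fg S by (auto simp: image_image subset_iff cong: image_cong)
    then have "\<Squnion>\<^bsub>Y\<^esub> S = f (\<Squnion>\<^bsub>X\<^esub> (g ` S))" using f gS by (simp add: frame_mor_def sup_pres_def)
    then show ?thesis using gf gS by simp
  qed
  moreover have "g (x \<sqinter>\<^bsub>Y\<^esub> y) = g x \<sqinter>\<^bsub>X\<^esub> g y" if "x \<in> carrier Y" "y \<in> carrier Y" for x y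
  proof -
    have "f (g x \<sqinter>\<^bsub>X\<^esub> g y) = x \<sqinter>\<^bsub>Y\<^esub> y"
      using f fg gc that by (simp add: frame_mor_def meet_pres_def)
    then show ?thesis using gf gc that by (metis X.meet_closed)
  qed
  moreover have "g \<top>\<^bsub>Y\<^esub> = \<top>\<^bsub>X\<^esub>"
    using f gf[of "\<top>\<^bsub>X\<^esub>"] by (simp add: frame_mor_def)
  ultimately show ?thesis
    using f g by (simp add: frame_mor_def sup_pres_def meet_pres_def)
qed

text \<open>
  A subset that contains the supremum, infimum or bound formed in the ambient lattice has the same
  one in its inherited order.  This reduces all computations with open and saturated elements to
  computations in the MT-algebra.
\<close>

context complete_lattice
begin

lemma Sup_eqI:
  assumes "S \<subseteq> carrier L" "z \<in> carrier L" "\<And>x. x \<in> S \<Longrightarrow> x \<sqsubseteq> z"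
    and "\<And>u. u \<in> carrier L \<Longrightarrow> (\<And>x. x \<in> S \<Longrightarrow> x \<sqsubseteq> u) \<Longrightarrow> z \<sqsubseteq> u"
  shows "\<Squnion>S = z"
  using assms by (intro le_antisym sup_least assms(4)) (auto intro: sup_upper)

lemma Inf_eqI:
  assumes "S \<subseteq> carrier L" "z \<in> carrier L" "\<And>x. x \<in> S \<Longrightarrow> z \<sqsubseteq> x"
    and "\<And>u. u \<in> carrier L \<Longrightarrow> (\<And>x. x \<in> S \<Longrightarrow> u \<sqsubseteq> x) \<Longrightarrow> u \<sqsubseteq> z"
  shows "\<Sqinter>S = z"
  using assms by (intro le_antisym inf_greatest assms(4)) (auto intro: inf_lower)

lemma Sup_empty: "\<Squnion>{} = \<bottom>"
  by (rule Sup_eqI) auto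

lemma Inf_empty: "\<Sqinter>{} = \<top>"
  by (rule Inf_eqI) auto

lemma bounded_lattice: "bounded_lattice L"
  by unfold_locales

context
  fixes X :: "('a, 'n) gorder_scheme"
  assumes sub: "carrier X \<subseteq> carrier L" and le: "le X = le L"
begin

lemma inherited_lub:
  assumes "S \<subseteq> carrier X" "\<Squnion>S \<in> carrier X"
  shows "is_lub X (\<Squnion>S) S"
proof (rule least_UpperI)
  have S: "S \<subseteq> carrier L" using assms(1) sub by blast
  show "x \<sqsubseteq>\<^bsub>X\<^esub> \<Squnion>S" if "x \<in> S" for x using sup_upper[OF S that] le by simp
  show "\<Squnion>S \<sqsubseteq>\<^bsub>X\<^esub> y" if "y \<in> Upper X S" for y
    using that assms(1) sub sup_least[OF S, of y] le by (auto simp: Upper_def subset_iff)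
qed (use assms in auto)

lemma inherited_glb:
  assumes "S \<subseteq> carrier X" "\<Sqinter>S \<in> carrier X"
  shows "is_glb X (\<Sqinter>S) S"
proof (rule greatest_LowerI)
  have S: "S \<subseteq> carrier L" using assms(1) sub by blast
  show "\<Sqinter>S \<sqsubseteq>\<^bsub>X\<^esub> x" if "x \<in> S" for x using inf_lower[OF S that] le by simp
  show "y \<sqsubseteq>\<^bsub>X\<^esub> \<Sqinter>S" if "y \<in> Lower X S" for y
    using that assms(1) sub inf_greatest[OF S, of y] le by (auto simp: Lower_def subset_iff)
qed (use assms in auto)

lemma inherited_Sup:
  assumes "S \<subseteq> carrier X" "\<Squnion>S \<in> carrier X"
  shows "\<Squnion>\<^bsub>X\<^esub> S = \<Squnion>S"
  unfolding Lattice.sup_def[of X]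
  by (rule some_equality)
    (use inherited_lub[OF assms] sub le in \<open>auto simp: least_def subset_iff\<close>)

lemma inherited_Inf:
  assumes "S \<subseteq> carrier X" "\<Sqinter>S \<in> carrier X"
  shows "\<Sqinter>\<^bsub>X\<^esub> S = \<Sqinter>S"
  unfolding Lattice.inf_def[of X]
  by (rule some_equality)
    (use inherited_glb[OF assms] sub le in \<open>auto simp: greatest_def subset_iff\<close>)

lemma inherited_join:
  "x \<in> carrier X \<Longrightarrow> y \<in> carrier X \<Longrightarrow> x \<squnion> y \<in> carrier X \<Longrightarrow> x \<squnion>\<^bsub>X\<^esub> y = x \<squnion> y"
  unfolding join_def by (rule inherited_Sup) auto

lemma inherited_meet:
  "x \<in> carrier X \<Longrightarrow> y \<in> carrier X \<Longrightarrow> x \<sqinter> y \<in> carrier X \<Longrightarrow> x \<sqinter>\<^bsub>X\<^esub> y = x \<sqinter> y"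
  unfolding meet_def by (rule inherited_Inf) auto

lemma inherited_bottom: assumes "\<bottom> \<in> carrier X" shows "\<bottom>\<^bsub>X\<^esub> = \<bottom>"
  unfolding bottom_def[of X]
proof (rule some_equality)
  show l: "least X \<bottom> (carrier X)" using assms sub le by (auto simp: least_def)
  show "z = \<bottom>" if "least X z (carrier X)" for z
    using that l le sub by (intro le_antisym) (auto simp: least_def)
qed

lemma inherited_top: assumes "\<top> \<in> carrier X" shows "\<top>\<^bsub>X\<^esub> = \<top>"
  unfolding top_def[of X]
proof (rule some_equality)
  show g: "greatest X \<top> (carrier X)" using assms sub le by (auto simp: greatest_def)
  show "z = \<top>" if "greatest X z (carrier X)" for z
    using that g le sub by (intro le_antisym) (auto simp: greatest_def)
qed

lemma inherited_partial_order: assumes "eq X = (=)" shows "partial_order X"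
proof unfold_locales
  fix x y z assume "x \<in> carrier X" "y \<in> carrier X" "z \<in> carrier X" "x \<sqsubseteq>\<^bsub>X\<^esub> y" "y \<sqsubseteq>\<^bsub>X\<^esub> z"
  then show "x \<sqsubseteq>\<^bsub>X\<^esub> z" using le_trans[of x y z] sub le by auto
qed (use assms sub le in auto)

lemma complete_lattice_if_Inf_closed:
  assumes eq: "eq X = (=)" and cl: "\<And>S. S \<subseteq> carrier X \<Longrightarrow> \<Sqinter>S \<in> carrier X"
  shows "complete_lattice X"
proof -
  interpret X: partial_order X by (rule inherited_partial_order[OF eq])
  have glb: "is_glb X (\<Sqinter>S) S" if "S \<subseteq> carrier X" for S
    using inherited_glb that cl by blast
  show ?thesis
  proof (rule X.complete_lattice_criterion1)
    show "\<exists>g. greatest X g (carrier X)" using glb[of "{}"] by auto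
    show "\<exists>i. is_glb X i S" if "S \<subseteq> carrier X" for S using glb[OF that] by blast
  qed
qed

lemma complete_lattice_if_Sup_closed:
  assumes eq: "eq X = (=)" and cl: "\<And>S. S \<subseteq> carrier X \<Longrightarrow> \<Squnion>S \<in> carrier X"
  shows "complete_lattice X"
proof -
  interpret X: partial_order X by (rule inherited_partial_order[OF eq])
  have lub: "is_lub X (\<Squnion>S) S" if "S \<subseteq> carrier X" for S
    using inherited_lub that cl by blast
  show ?thesis
  proof
    fix S assume S: "S \<subseteq> carrier X"
    show "\<exists>s. is_lub X s S" using lub[OF S] by blast
    have "is_lub X (\<Squnion>(Lower X S)) (Lower X S)" by (rule lub) simp
    then have "is_glb X (\<Squnion>(Lower X S)) S"
      using S unfolding least_def greatest_def Upper_def Lower_def by auto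
    then show "\<exists>i. is_glb X i S" by blast
  qed
qed

end

end


section \<open>Complete Boolean algebras\<close>

locale complete_boolean_lattice = complete_lattice +
  assumes boolean: "boolean_lattice L"
begin

lemma distributive: "bdd_distrib_lattice L"
  using boolean by (simp add: boolean_lattice_def)

lemma compl_exists:
  assumes "a \<in> carrier L" obtains b where "is_compl L a b" "b \<in> carrier L"
  using assms boolean by (auto simp: boolean_lattice_def is_compl_def)

lemma meet_join_distrib:
  "\<lbrakk>x \<in> carrier L; y \<in> carrier L; z \<in> carrier L\<rbrakk> \<Longrightarrow> x \<sqinter> (y \<squnion> z) = x \<sqinter> y \<squnion> x \<sqinter> z"
  using distributive by (simp add: bdd_distrib_lattice_def)

lemma bottom_join_eq: "x \<in> carrier L \<Longrightarrow> \<bottom> \<squnion> x = x"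
  by (simp add: le_iff_meet[symmetric])

lemma top_meet_eq: "x \<in> carrier L \<Longrightarrow> \<top> \<sqinter> x = x"
  by (metis meet_comm le_iff_join top_closed top_higher)

lemma meet_mono_right:
  "\<lbrakk>x \<in> carrier L; y \<in> carrier L; z \<in> carrier L; y \<sqsubseteq> z\<rbrakk> \<Longrightarrow> x \<sqinter> y \<sqsubseteq> x \<sqinter> z"
  by (meson le_trans meet_closed meet_le meet_left meet_right)

lemma join_mono_right:
  "\<lbrakk>x \<in> carrier L; y \<in> carrier L; z \<in> carrier L; y \<sqsubseteq> z\<rbrakk> \<Longrightarrow> x \<squnion> y \<sqsubseteq> x \<squnion> z"
  by (meson le_trans join_closed join_le join_left join_right)

text \<open>
  Meeting with \<open>a\<close> is left adjoint to joining with its complement.  Both infinite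
  distributive laws follow, since left adjoints preserve joins and right adjoints meets.
\<close>

lemma meet_le_iff_compl:
  assumes ab: "is_compl L a b" and c: "a \<in> carrier L" "x \<in> carrier L" "y \<in> carrier L"
  shows "a \<sqinter> x \<sqsubseteq> y \<longleftrightarrow> x \<sqsubseteq> b \<squnion> y"
proof
  have b: "b \<in> carrier L" "a \<sqinter> b = \<bottom>" "a \<squnion> b = \<top>" using ab by (auto simp: is_compl_def)
  {
    assume le: "a \<sqinter> x \<sqsubseteq> y"
    have "x = x \<sqinter> (b \<squnion> a)"
      using b c top_meet_eq[of x] by (metis meet_comm join_comm)
    also have "\<dots> = x \<sqinter> b \<squnion> x \<sqinter> a" using b c by (simp add: meet_join_distrib)
    also have "\<dots> \<sqsubseteq> b \<squnion> y"
    proof (rule join_le)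
      show "x \<sqinter> b \<sqsubseteq> b \<squnion> y"
        by (rule le_trans[OF meet_right join_left]) (use b c in auto)
      show "x \<sqinter> a \<sqsubseteq> b \<squnion> y"
        by (subst meet_comm, rule le_trans[OF le join_right]) (use b c in auto)
    qed (use b c in auto)
    finally show "x \<sqsubseteq> b \<squnion> y" .
  }
  assume "x \<sqsubseteq> b \<squnion> y"
  then have "a \<sqinter> x \<sqsubseteq> a \<sqinter> (b \<squnion> y)" using b c by (intro meet_mono_right) auto
  also have "a \<sqinter> (b \<squnion> y) = a \<sqinter> y"
    using b c by (simp add: meet_join_distrib bottom_join_eq)
  finally show "a \<sqinter> x \<sqsubseteq> y"
    using b c le_trans[OF _ meet_right[of a y]] by simp
qed

lemma is_compl_sym: "a \<in> carrier L \<Longrightarrow> is_compl L a b \<Longrightarrow> is_compl L b a"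
  by (simp add: is_compl_def meet_comm join_comm)

lemma meet_Sup_distrib:
  assumes a: "a \<in> carrier L" and S: "S \<subseteq> carrier L"
  shows "a \<sqinter> \<Squnion>S = \<Squnion>((\<lambda>s. a \<sqinter> s) ` S)"
proof (rule Sup_eqI[symmetric])
  obtain b where b: "is_compl L a b" "b \<in> carrier L" using compl_exists[OF a] .
  have c: "\<Squnion>S \<in> carrier L" "\<And>s. s \<in> S \<Longrightarrow> s \<in> carrier L" using S by auto
  show "(\<lambda>s. a \<sqinter> s) ` S \<subseteq> carrier L" "a \<sqinter> \<Squnion>S \<in> carrier L" using a c by auto
  show "x \<sqsubseteq> a \<sqinter> \<Squnion>S" if "x \<in> (\<lambda>s. a \<sqinter> s) ` S" for x
    using that a c by (auto intro: meet_mono_right sup_upper[OF S])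
  fix u assume u: "u \<in> carrier L" "\<And>x. x \<in> (\<lambda>s. a \<sqinter> s) ` S \<Longrightarrow> x \<sqsubseteq> u"
  have "\<Squnion>S \<sqsubseteq> b \<squnion> u"
  proof (rule sup_least[OF S])
    show "b \<squnion> u \<in> carrier L" using b u by simp
    show "s \<sqsubseteq> b \<squnion> u" if "s \<in> S" for s
      using that u meet_le_iff_compl[OF b(1) a c(2) u(1)] by blast
  qed
  then show "a \<sqinter> \<Squnion>S \<sqsubseteq> u" using meet_le_iff_compl[OF b(1) a c(1) u(1)] by simp
qed

lemma join_Inf_distrib:
  assumes a: "a \<in> carrier L" and S: "S \<subseteq> carrier L"
  shows "a \<squnion> \<Sqinter>S = \<Sqinter>((\<lambda>s. a \<squnion> s) ` S)"
proof (rule Inf_eqI[symmetric])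
  obtain b where b: "is_compl L a b" "b \<in> carrier L" using compl_exists[OF a] .
  note adj = meet_le_iff_compl[OF is_compl_sym[OF a b(1)] b(2)]
  have c: "\<Sqinter>S \<in> carrier L" "\<And>s. s \<in> S \<Longrightarrow> s \<in> carrier L" using S by auto
  show "(\<lambda>s. a \<squnion> s) ` S \<subseteq> carrier L" "a \<squnion> \<Sqinter>S \<in> carrier L" using a c by auto
  show "a \<squnion> \<Sqinter>S \<sqsubseteq> x" if "x \<in> (\<lambda>s. a \<squnion> s) ` S" for x
    using that a c by (auto intro: join_mono_right inf_lower[OF S])
  fix u assume u: "u \<in> carrier L" "\<And>x. x \<in> (\<lambda>s. a \<squnion> s) ` S \<Longrightarrow> u \<sqsubseteq> x"
  have "b \<sqinter> u \<sqsubseteq> \<Sqinter>S"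
  proof (rule inf_greatest[OF S])
    show "b \<sqinter> u \<in> carrier L" using b u by simp
    show "b \<sqinter> u \<sqsubseteq> s" if "s \<in> S" for s using that u adj[OF u(1) c(2)] by blast
  qed
  then show "u \<sqsubseteq> a \<squnion> \<Sqinter>S" using adj[OF u(1) c(1)] by simp
qed

lemma Sup_meet_Sup_le:
  assumes S: "S \<subseteq> carrier L" and T: "T \<subseteq> carrier L" and z: "z \<in> carrier L"
    and le: "\<And>s t. s \<in> S \<Longrightarrow> t \<in> T \<Longrightarrow> s \<sqinter> t \<sqsubseteq> z"
  shows "\<Squnion>S \<sqinter> \<Squnion>T \<sqsubseteq> z"
proof -
  have "\<Squnion>S \<sqinter> t \<sqsubseteq> z" if t: "t \<in> T" for t
  proof -
    have tc: "t \<in> carrier L" using t T by auto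
    show ?thesis
      unfolding meet_comm[of L _ t] meet_Sup_distrib[OF tc S]
    proof (rule sup_least[OF _ z])
      show "(\<lambda>s. t \<sqinter> s) ` S \<subseteq> carrier L" using S tc by auto
      show "x \<sqsubseteq> z" if x: "x \<in> (\<lambda>s. t \<sqinter> s) ` S" for x
      proof -
        obtain s where "s \<in> S" "x = t \<sqinter> s" using x by (elim imageE)
        then show ?thesis using le[OF _ t] by (simp only: meet_comm[of L t])
      qed
    qed
  qed
  then show ?thesis
    unfolding meet_Sup_distrib[OF sup_closed[OF S] T]
    by (intro sup_least[OF _ z]) (use S T in auto)
qed

lemma bool_gen_subset_carrier:
  assumes "X \<subseteq> carrier L" shows "bool_gen L X \<subseteq> carrier L"
proof
  fix x assume "x \<in> bool_gen L X"
  then show "x \<in> carrier L"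
    by induction (use assms in \<open>auto simp: is_compl_def\<close>)
qed

end


section \<open>Open and saturated elements\<close>

locale mt = complete_boolean_lattice M for M :: "'a mt" (structure) +
  assumes mt: "mt_algebra M"

lemma mtI: "mt_algebra M \<Longrightarrow> mt M"
  by (simp add: mt_def mt_axioms_def complete_boolean_lattice_def complete_boolean_lattice_axioms_def
      mt_algebra_def)

context mt
begin

lemma box_closed: "a \<in> carrier M \<Longrightarrow> box M a \<in> carrier M"
  and box_top: "box M \<top> = \<top>"
  and box_meet: "a \<in> carrier M \<Longrightarrow> b \<in> carrier M \<Longrightarrow> box M (a \<sqinter> b) = box M a \<sqinter> box M b"
  and box_le: "a \<in> carrier M \<Longrightarrow> box M a \<sqsubseteq> a"
  using mt by (auto simp: mt_algebra_def)

lemma box_mono: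
  assumes "a \<in> carrier M" "b \<in> carrier M" "a \<sqsubseteq> b" shows "box M a \<sqsubseteq> box M b"
  using assms box_meet[of a b] by (metis box_closed le_iff_join)

lemma opens_carrier: "opens M \<subseteq> carrier M"
  by (auto simp: opens_def)

lemma opens_Sup: assumes S: "S \<subseteq> opens M" shows "\<Squnion>S \<in> opens M"
proof -
  have S': "S \<subseteq> carrier M" using S opens_carrier by blast
  have "\<Squnion>S \<sqsubseteq> box M (\<Squnion>S)"
  proof (rule sup_least[OF S'])
    show "box M (\<Squnion>S) \<in> carrier M" using S' by (simp add: box_closed)
    fix s assume s: "s \<in> S"
    then have "box M s \<sqsubseteq> box M (\<Squnion>S)" using S' by (intro box_mono sup_upper) auto
    then show "s \<sqsubseteq> box M (\<Squnion>S)" using s S by (auto simp: opens_def)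
  qed
  then show ?thesis using S' by (auto simp: opens_def box_closed intro!: le_antisym box_le)
qed

lemma opens_meet: "a \<in> opens M \<Longrightarrow> b \<in> opens M \<Longrightarrow> a \<sqinter> b \<in> opens M"
  by (simp add: opens_def box_meet)

lemma opens_top: "\<top> \<in> opens M"
  by (simp add: opens_def box_top)

lemma opens_join: "a \<in> opens M \<Longrightarrow> b \<in> opens M \<Longrightarrow> a \<squnion> b \<in> opens M"
  unfolding join_def by (rule opens_Sup) auto

lemma saturated_carrier: "saturated M \<subseteq> carrier M"
  using opens_carrier by (auto simp: saturated_def)

lemma opens_saturated: "opens M \<subseteq> saturated M"
proof
  fix a assume "a \<in> opens M"
  then show "a \<in> saturated M"
    using opens_carrier by (auto simp: saturated_def intro!: exI[of _ "{a}"])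
qed

lemma saturated_Inf: assumes T: "T \<subseteq> saturated M" shows "\<Sqinter>T \<in> saturated M"
proof -
  have T': "T \<subseteq> carrier M" using T saturated_carrier by blast
  define U where "U = {u \<in> opens M. \<Sqinter>T \<sqsubseteq> u}"
  have U: "U \<subseteq> carrier M" "U \<subseteq> opens M" using opens_carrier by (auto simp: U_def)
  have "\<Sqinter>U \<sqsubseteq> t" if t: "t \<in> T" for t
  proof -
    obtain S where S: "S \<subseteq> opens M" "t = \<Sqinter>S" using t T by (auto simp: saturated_def)
    have S': "S \<subseteq> carrier M" using S(1) opens_carrier by blast
    have "s \<in> U" if "s \<in> S" for s
    proof -
      have "\<Sqinter>T \<sqsubseteq> s"
        by (rule le_trans[OF inf_lower[OF T' t]]) (use S S' T' that inf_lower[OF S'] in auto)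
      then show ?thesis using that S(1) by (auto simp: U_def)
    qed
    then show ?thesis
      unfolding S(2) using U(1) by (intro inf_greatest[OF S'] inf_lower[OF U(1)]) auto
  qed
  then have "\<Sqinter>T = \<Sqinter>U"
    using T' U(1) by (auto intro!: le_antisym inf_greatest simp: U_def)
  then show ?thesis using U(2) by (auto simp: saturated_def)
qed

text \<open>
  If \<open>a = \<Sqinter>S\<close> and \<open>b = \<Sqinter>T\<close> with \<open>S\<close> and \<open>T\<close> sets of open elements, then \<open>a \<squnion> b\<close> is
  the meet of all \<open>s \<squnion> t\<close>, by two applications of the infinite distributive law.
\<close>

lemma saturated_join:
  assumes "a \<in> saturated M" "b \<in> saturated M" shows "a \<squnion> b \<in> saturated M"
proof -
  have open_join: "s \<squnion> c \<in> saturated M" if s: "s \<in> opens M" and c: "c \<in> saturated M" for s c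
  proof -
    obtain T where T: "T \<subseteq> opens M" "c = \<Sqinter>T" using c by (auto simp: saturated_def)
    have "s \<squnion> c = \<Sqinter>((\<lambda>t. s \<squnion> t) ` T)"
      using s T opens_carrier by (simp add: join_Inf_distrib subset_iff)
    moreover have "(\<lambda>t. s \<squnion> t) ` T \<subseteq> saturated M"
      using s T opens_join opens_saturated by auto
    ultimately show ?thesis using saturated_Inf by simp
  qed
  obtain S where S: "S \<subseteq> opens M" "a = \<Sqinter>S" using assms(1) by (auto simp: saturated_def)
  have "a \<squnion> b = \<Sqinter>((\<lambda>s. b \<squnion> s) ` S)"
    unfolding S(2) join_comm[of _ "\<Sqinter>S" b]
    using S(1) assms(2) opens_carrier saturated_carrier by (intro join_Inf_distrib) auto
  moreover have "(\<lambda>s. b \<squnion> s) ` S \<subseteq> saturated M"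
    using S(1) assms(2) open_join by (auto simp: join_comm[of _ b])
  ultimately show ?thesis using saturated_Inf by simp
qed

lemma saturated_meet: "a \<in> saturated M \<Longrightarrow> b \<in> saturated M \<Longrightarrow> a \<sqinter> b \<in> saturated M"
  unfolding meet_def by (rule saturated_Inf) auto

lemma saturated_bounds: "\<top> \<in> saturated M" "\<bottom> \<in> saturated M"
  using opens_top opens_Sup[of "{}"] opens_saturated by (auto simp: Sup_empty)

lemma bool_sat_carrier: "bool_sat M \<subseteq> carrier M"
  unfolding bool_sat_def by (rule bool_gen_subset_carrier[OF saturated_carrier])

lemma saturated_bool_sat: "saturated M \<subseteq> bool_sat M"
  by (auto simp: bool_sat_def intro: bool_gen.base)

lemma bool_sat_meet: "a \<in> bool_sat M \<Longrightarrow> b \<in> bool_sat M \<Longrightarrow> a \<sqinter> b \<in> bool_sat M"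
  unfolding bool_sat_def by (rule bool_gen.meet)

lemma R_ob_order [simp]:
  "carrier (R_ob M) = saturated M" "le (R_ob M) = le M" "eq (R_ob M) = (=)" "sub (R_ob M) = opens M"
  by (simp_all add: R_ob_def)

lemma eq_M [simp]: "eq M = (=)"
  by (rule eq_is_equal)

lemma truncate_R_ob:
  "gorder.truncate (R_ob M) = gorder.truncate (M\<lparr>carrier := saturated M\<rparr>)"
  "gorder.truncate (R_ob M\<lparr>carrier := opens M\<rparr>) = gorder.truncate (M\<lparr>carrier := opens M\<rparr>)"
  by (simp_all add: gorder.truncate_def)

lemma R_ob_ops:
  shows "S \<subseteq> saturated M \<Longrightarrow> \<Sqinter>\<^bsub>R_ob M\<^esub> S = \<Sqinter>S"
    and "S \<subseteq> saturated M \<Longrightarrow> \<Squnion>S \<in> saturated M \<Longrightarrow> \<Squnion>\<^bsub>R_ob M\<^esub> S = \<Squnion>S"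
    and "a \<in> saturated M \<Longrightarrow> b \<in> saturated M \<Longrightarrow> a \<squnion>\<^bsub>R_ob M\<^esub> b = a \<squnion> b"
    and "a \<in> saturated M \<Longrightarrow> b \<in> saturated M \<Longrightarrow> a \<sqinter>\<^bsub>R_ob M\<^esub> b = a \<sqinter> b"
    and "\<top>\<^bsub>R_ob M\<^esub> = \<top>" "\<bottom>\<^bsub>R_ob M\<^esub> = \<bottom>"
  using inherited_Inf[of "R_ob M"] inherited_Sup[of "R_ob M"] inherited_join[of "R_ob M"]
    inherited_meet[of "R_ob M"] inherited_top[of "R_ob M"] inherited_bottom[of "R_ob M"]
  by (simp_all add: saturated_carrier saturated_Inf saturated_join saturated_meet saturated_bounds)

lemma opens_ops:
  shows "S \<subseteq> opens M \<Longrightarrow> \<Squnion>\<^bsub>R_ob M\<lparr>carrier := opens M\<rparr>\<^esub> S = \<Squnion>S"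
    and "a \<in> opens M \<Longrightarrow> b \<in> opens M \<Longrightarrow> a \<sqinter>\<^bsub>R_ob M\<lparr>carrier := opens M\<rparr>\<^esub> b = a \<sqinter> b"
    and "\<top>\<^bsub>R_ob M\<lparr>carrier := opens M\<rparr>\<^esub> = \<top>"
  using inherited_Sup[of "R_ob M\<lparr>carrier := opens M\<rparr>"]
    inherited_meet[of "R_ob M\<lparr>carrier := opens M\<rparr>"] inherited_top[of "R_ob M\<lparr>carrier := opens M\<rparr>"]
  by (simp_all add: opens_carrier opens_Sup opens_meet opens_top)

lemma complete_lattice_R_ob: "complete_lattice (R_ob M)"
  by (rule complete_lattice_if_Inf_closed) (simp_all add: saturated_carrier saturated_Inf)

lemma complete_lattice_opens: "complete_lattice (R_ob M\<lparr>carrier := opens M\<rparr>)"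
  by (rule complete_lattice_if_Sup_closed) (simp_all add: opens_carrier opens_Sup)

lemma coframe_R_ob: "coframe (R_ob M)"
proof -
  have "a \<squnion>\<^bsub>R_ob M\<^esub> \<Sqinter>\<^bsub>R_ob M\<^esub> S = \<Sqinter>\<^bsub>R_ob M\<^esub> ((\<lambda>s. a \<squnion>\<^bsub>R_ob M\<^esub> s) ` S)"
    if "a \<in> saturated M" "S \<subseteq> saturated M" for a S
  proof -
    have im: "(\<lambda>s. a \<squnion>\<^bsub>R_ob M\<^esub> s) ` S = (\<lambda>s. a \<squnion> s) ` S"
      using that by (intro image_cong) (auto simp: R_ob_ops)
    have "a \<squnion> \<Sqinter>S = \<Sqinter>((\<lambda>s. a \<squnion> s) ` S)"
      using that saturated_carrier by (intro join_Inf_distrib) auto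
    moreover have "(\<lambda>s. a \<squnion> s) ` S \<subseteq> saturated M" using that saturated_join by auto
    ultimately show ?thesis unfolding im using that by (simp add: R_ob_ops saturated_Inf)
  qed
  then show ?thesis using complete_lattice_R_ob by (simp add: coframe_def)
qed

lemma bdd_distrib_R_ob: "bdd_distrib_lattice (R_ob M)"
proof -
  interpret R: complete_lattice "R_ob M" by (rule complete_lattice_R_ob)
  have "a \<sqinter> (b \<squnion> c) = a \<sqinter> b \<squnion> a \<sqinter> c"
    if "a \<in> saturated M" "b \<in> saturated M" "c \<in> saturated M" for a b c
    using that saturated_carrier by (intro meet_join_distrib) auto
  then show ?thesis
    unfolding bdd_distrib_lattice_def
    using R.bounded_lattice by (simp add: R_ob_ops saturated_join saturated_meet)
qed

text \<open>
  All three distributive laws of a Raney extension are instances of the two infinite distributive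
  laws of the complete Boolean algebra \<open>M\<close>, since the operations are inherited from \<open>M\<close>.
\<close>

lemma raney_extension_R_ob: "raney_extension (R_ob M)"
proof -
  let ?O = "R_ob M\<lparr>carrier := opens M\<rparr>"
  have sO: "S \<subseteq> saturated M" if "S \<subseteq> opens M" for S using that opens_saturated by blast
  have frame_law: "a \<sqinter> \<Squnion>S = \<Squnion>((\<lambda>s. a \<sqinter> s) ` S)" if "a \<in> saturated M" "S \<subseteq> opens M" for a S
    using that(1) sO[OF that(2)] saturated_carrier by (intro meet_Sup_distrib) auto
  have "a \<sqinter>\<^bsub>?O\<^esub> \<Squnion>\<^bsub>?O\<^esub> S = \<Squnion>\<^bsub>?O\<^esub> ((\<lambda>s. a \<sqinter>\<^bsub>?O\<^esub> s) ` S)"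
    if aS: "a \<in> opens M" "S \<subseteq> opens M" for a S
  proof -
    have im: "(\<lambda>s. a \<sqinter>\<^bsub>?O\<^esub> s) ` S = (\<lambda>s. a \<sqinter> s) ` S"
      using that by (intro image_cong) (auto simp: opens_ops)
    have "(\<lambda>s. a \<sqinter> s) ` S \<subseteq> opens M" using aS opens_meet by auto
    moreover have "a \<sqinter> \<Squnion>S = \<Squnion>((\<lambda>s. a \<sqinter> s) ` S)"
      using aS opens_saturated by (intro frame_law) auto
    ultimately show ?thesis unfolding im using aS by (simp add: opens_ops opens_Sup)
  qed
  then have "frame ?O" using complete_lattice_opens by (simp add: frame_def)
  moreover have sub_sup: "\<Squnion>\<^bsub>R_ob M\<^esub> S = \<Squnion>S" if "S \<subseteq> opens M" for S
    using that sO[OF that] opens_Sup[OF that] opens_saturated by (intro R_ob_ops(2)) auto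
  have "frame_mor ?O (R_ob M) (\<lambda>x. x)"
    using complete_lattice_opens complete_lattice_R_ob opens_saturated
    unfolding frame_mor_def sup_pres_def meet_pres_def
    by (auto simp: opens_ops R_ob_ops(4,5) sub_sup subsetD[OF opens_saturated])
  ultimately have "subframe (R_ob M) (opens M)"
    using opens_saturated by (simp add: subframe_def)
  moreover have "\<exists>S\<subseteq>opens M. c = \<Sqinter>\<^bsub>R_ob M\<^esub> S" if c: "c \<in> saturated M" for c
  proof -
    obtain S where S: "S \<subseteq> opens M" "c = \<Sqinter>S"
      using c unfolding saturated_def by blast
    then show ?thesis using R_ob_ops(1)[OF sO[OF S(1)]] by metis
  qed
  moreover have "a \<sqinter>\<^bsub>R_ob M\<^esub> \<Squnion>\<^bsub>R_ob M\<^esub> S = \<Squnion>\<^bsub>R_ob M\<^esub> ((\<lambda>s. a \<sqinter>\<^bsub>R_ob M\<^esub> s) ` S)"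
    if aS: "a \<in> saturated M" "S \<subseteq> opens M" for a S
  proof -
    have im: "(\<lambda>s. a \<sqinter>\<^bsub>R_ob M\<^esub> s) ` S = (\<lambda>s. a \<sqinter> s) ` S"
      using aS sO[OF aS(2)] by (intro image_cong) (auto simp: R_ob_ops)
    have sup: "\<Squnion>S \<in> saturated M" using aS opens_Sup opens_saturated by blast
    then have "a \<sqinter>\<^bsub>R_ob M\<^esub> \<Squnion>\<^bsub>R_ob M\<^esub> S = \<Squnion>((\<lambda>s. a \<sqinter> s) ` S)"
      using aS sO[OF aS(2)] frame_law by (simp add: R_ob_ops)
    moreover have "\<Squnion>((\<lambda>s. a \<sqinter> s) ` S) \<in> saturated M"
      using frame_law[OF aS] saturated_meet[OF aS(1) sup] by simp
    moreover have "(\<lambda>s. a \<sqinter> s) ` S \<subseteq> saturated M"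
      using aS sO[OF aS(2)] saturated_meet by auto
    ultimately show ?thesis unfolding im by (simp add: R_ob_ops)
  qed
  ultimately show ?thesis using coframe_R_ob by (simp add: raney_extension_def)
qed

end


section \<open>Homomorphisms on Boolean subalgebras and on Boolean envelopes\<close>

text \<open>
  Homomorphisms defined on a subset \<open>A\<close> of \<open>L\<close> use the operations of \<open>L\<close>, so that no lattice structure
  on \<open>A\<close> has to be provided.
\<close>

definition bool_hom_on ::
    "'a set \<Rightarrow> ('a, 'm) gorder_scheme \<Rightarrow> ('b, 'n) gorder_scheme \<Rightarrow> ('a \<Rightarrow> 'b) \<Rightarrow> bool" where
  "bool_hom_on A L N p \<longleftrightarrow> p \<in> A \<rightarrow> carrier N \<and> p \<bottom>\<^bsub>L\<^esub> = \<bottom>\<^bsub>N\<^esub> \<and> p \<top>\<^bsub>L\<^esub> = \<top>\<^bsub>N\<^esub> \<and>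
     (\<forall>x\<in>A. \<forall>y\<in>A. p (x \<squnion>\<^bsub>L\<^esub> y) = p x \<squnion>\<^bsub>N\<^esub> p y \<and> p (x \<sqinter>\<^bsub>L\<^esub> y) = p x \<sqinter>\<^bsub>N\<^esub> p y)"

lemma bool_hom_on_compl:
  assumes "bool_hom_on A L N p" "x \<in> A" "y \<in> A" "is_compl L x y"
  shows "is_compl N (p x) (p y)"
proof -
  have "p x \<squnion>\<^bsub>N\<^esub> p y = p (x \<squnion>\<^bsub>L\<^esub> y)" "p x \<sqinter>\<^bsub>N\<^esub> p y = p (x \<sqinter>\<^bsub>L\<^esub> y)"
    using assms(1-3) by (simp_all add: bool_hom_on_def)
  then show ?thesis
    using assms by (auto simp: bool_hom_on_def is_compl_def)
qed

text \<open>
  The closure of the generators under complements causes no trouble, as homomorphisms preserve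
  complements and complements in a distributive lattice are unique.
\<close>

lemma bool_hom_on_eq:
  assumes N: "bdd_distrib_lattice N"
    and p: "bool_hom_on (bool_gen L X) L N p" and q: "bool_hom_on (bool_gen L X) L N q"
    and pq: "\<And>x. x \<in> X \<Longrightarrow> p x = q x" and x: "x \<in> bool_gen L X"
  shows "p x = q x"
  using x
proof induction
  case (compl x y)
  have "y \<in> bool_gen L X" using compl(1,2) by (rule bool_gen.compl)
  then have "is_compl N (p x) (p y)" "is_compl N (p x) (q y)"
    using bool_hom_on_compl[OF p compl(1) _ compl(2)] bool_hom_on_compl[OF q compl(1) _ compl(2)]
      compl(3) by simp_all
  moreover have "p x \<in> carrier N" using p compl(1) by (auto simp: bool_hom_on_def)
  ultimately show ?case using is_compl_unique[OF N] by blast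
qed (use p q pq in \<open>simp_all add: bool_hom_on_def\<close>)

lemma bool_hom_on_image:
  assumes p: "bool_hom_on (bool_gen L X) L N p" and X: "p ` X \<subseteq> Y" and x: "x \<in> bool_gen L X"
  shows "p x \<in> bool_gen N Y"
  using x
proof induction
  case (base x) then show ?case using X by (auto intro: bool_gen.base)
next
  case (compl x y)
  have "y \<in> bool_gen L X" using compl(1,2) by (rule bool_gen.compl)
  then show ?case using bool_gen.compl[OF compl(3)] bool_hom_on_compl[OF p compl(1) _ compl(2)] by blast
qed (use p in \<open>simp_all add: bool_hom_on_def bool_gen.bot bool_gen.top bool_gen.join bool_gen.meet\<close>)

lemma benv_sets:
  shows "{} \<in> carrier (benv C)" "prime_filters C \<in> carrier (benv C)"
    and "U \<in> carrier (benv C) \<Longrightarrow> U \<subseteq> prime_filters C"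
    and "U \<in> carrier (benv C) \<Longrightarrow> V \<in> carrier (benv C) \<Longrightarrow> U \<union> V \<in> carrier (benv C)"
    and "U \<in> carrier (benv C) \<Longrightarrow> V \<in> carrier (benv C) \<Longrightarrow> U \<inter> V \<in> carrier (benv C)"
    and "U \<in> carrier (benv C) \<Longrightarrow> prime_filters C - U \<in> carrier (benv C)"
    and "U \<in> carrier (benv C) \<Longrightarrow> V \<in> carrier (benv C) \<Longrightarrow> U - V \<in> carrier (benv C)"
proof -
  note cl = benv_closed[where C=C, folded carrier_benv]
  show "{} \<in> carrier (benv C)" "prime_filters C \<in> carrier (benv C)"
    "U \<in> carrier (benv C) \<Longrightarrow> U \<subseteq> prime_filters C"
    "U \<in> carrier (benv C) \<Longrightarrow> V \<in> carrier (benv C) \<Longrightarrow> U \<union> V \<in> carrier (benv C)"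
    "U \<in> carrier (benv C) \<Longrightarrow> V \<in> carrier (benv C) \<Longrightarrow> U \<inter> V \<in> carrier (benv C)"
    "U \<in> carrier (benv C) \<Longrightarrow> prime_filters C - U \<in> carrier (benv C)"
    using cl by blast+
  show "U - V \<in> carrier (benv C)" if "U \<in> carrier (benv C)" "V \<in> carrier (benv C)"
  proof -
    have "U - V = U \<inter> (prime_filters C - V)" using that cl(1) by blast
    then show ?thesis using that cl(4,5) by auto
  qed
qed

text \<open>
  In the topology on prime filters with basis \<open>benv_emb C c - benv_emb C d\<close> all elements of the
  envelope are clopen: the sets that are open with open complement form a Boolean algebra.
\<close>

lemma benv_basic_nbhd:
  assumes C: "bounded_lattice C" and U: "U \<in> carrier (benv C)" and P: "P \<in> U"
  shows "\<exists>c\<in>carrier C. \<exists>d\<in>carrier C. P \<in> benv_emb C c - benv_emb C d \<and>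
    benv_emb C c - benv_emb C d \<subseteq> U"
proof -
  interpret bounded_lattice C by fact
  note e = benv_emb_ops[OF C]
  define \<B> where "\<B> = {benv_emb C c - benv_emb C d |c d. c \<in> carrier C \<and> d \<in> carrier C}"
  define opn where "opn V \<longleftrightarrow> (\<forall>P\<in>V. \<exists>W\<in>\<B>. P \<in> W \<and> W \<subseteq> V)" for V
  have \<B>_Int: "V \<inter> W \<in> \<B>" if VW: "V \<in> \<B>" "W \<in> \<B>" for V W
  proof -
    obtain c d c' d' where cd: "c \<in> carrier C" "d \<in> carrier C" "c' \<in> carrier C" "d' \<in> carrier C"
      and V: "V = benv_emb C c - benv_emb C d" and W: "W = benv_emb C c' - benv_emb C d'"
      using VW unfolding \<B>_def by blast
    have "V \<inter> W = benv_emb C (c \<sqinter>\<^bsub>C\<^esub> c') - benv_emb C (d \<squnion>\<^bsub>C\<^esub> d')"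
      unfolding V W using cd e(3,4) by auto
    moreover have "c \<sqinter>\<^bsub>C\<^esub> c' \<in> carrier C" "d \<squnion>\<^bsub>C\<^esub> d' \<in> carrier C" using cd by auto
    ultimately show ?thesis unfolding \<B>_def by blast
  qed
  have Un: "opn (V \<union> W)" if VW: "opn V" "opn W" for V W
    unfolding opn_def
  proof
    fix P assume "P \<in> V \<union> W"
    then obtain Z where "Z \<in> \<B>" "P \<in> Z" "Z \<subseteq> V \<or> Z \<subseteq> W"
      using VW unfolding opn_def by (metis Un_iff)
    then show "\<exists>Z\<in>\<B>. P \<in> Z \<and> Z \<subseteq> V \<union> W" by auto
  qed
  have Int: "opn (V \<inter> W)" if VW: "opn V" "opn W" for V W
    unfolding opn_def
  proof
    fix P assume "P \<in> V \<inter> W"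
    then obtain Y Z where "Y \<in> \<B>" "P \<in> Y" "Y \<subseteq> V" "Z \<in> \<B>" "P \<in> Z" "Z \<subseteq> W"
      using VW unfolding opn_def by (metis IntE)
    then show "\<exists>Z\<in>\<B>. P \<in> Z \<and> Z \<subseteq> V \<inter> W"
      using \<B>_Int by (intro bexI[of _ "Y \<inter> Z"]) auto
  qed
  have basic: "opn (benv_emb C c - benv_emb C d)" if "c \<in> carrier C" "d \<in> carrier C" for c d
  proof -
    have "benv_emb C c - benv_emb C d \<in> \<B>"
      unfolding \<B>_def by (rule CollectI, rule exI[of _ c], rule exI[of _ d]) (intro conjI HOL.refl that)
    then show ?thesis unfolding opn_def by (intro ballI bexI[of _ "benv_emb C c - benv_emb C d"] conjI subset_refl)
  qed
  have "opn U \<and> opn (prime_filters C - U)"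
    using U
  proof (induction rule: benv_induct)
    case (base a)
    then show ?case
      using basic[of a "\<bottom>\<^bsub>C\<^esub>"] basic[of "\<top>\<^bsub>C\<^esub>" a] e by simp
  next
    case bot then show ?case using basic[of "\<top>\<^bsub>C\<^esub>" "\<bottom>\<^bsub>C\<^esub>"] e by (simp add: opn_def)
  next
    case top then show ?case using basic[of "\<top>\<^bsub>C\<^esub>" "\<bottom>\<^bsub>C\<^esub>"] e by (simp add: opn_def)
  next
    case (join U V) then show ?case using Un Int by (simp add: Diff_Un)
  next
    case (meet U V) then show ?case using Un Int by (simp add: Diff_Int)
  next
    case (compl U)
    then have "prime_filters C - (prime_filters C - U) = U" using benv_sets(3) by blast
    then show ?case using compl by simp
  qed
  then obtain Z where "Z \<in> \<B>" "P \<in> Z" "Z \<subseteq> U" using P unfolding opn_def by blast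
  then show ?thesis unfolding \<B>_def by blast
qed

lemma benv_le [simp]: "le (benv C) = (\<subseteq>)"
  by (simp add: benv_def)

lemma benv_homD:
  assumes "bdd_lattice_hom (benv C) N g"
  shows "U \<in> carrier (benv C) \<Longrightarrow> g U \<in> carrier N"
    and "g {} = \<bottom>\<^bsub>N\<^esub>" "g (prime_filters C) = \<top>\<^bsub>N\<^esub>"
    and "U \<in> carrier (benv C) \<Longrightarrow> V \<in> carrier (benv C) \<Longrightarrow> g (U \<union> V) = g U \<squnion>\<^bsub>N\<^esub> g V"
    and "U \<in> carrier (benv C) \<Longrightarrow> V \<in> carrier (benv C) \<Longrightarrow> g (U \<inter> V) = g U \<sqinter>\<^bsub>N\<^esub> g V"
proof -
  have g: "g \<in> carrier (benv C) \<rightarrow> carrier N" "g \<bottom>\<^bsub>benv C\<^esub> = \<bottom>\<^bsub>N\<^esub>" "g \<top>\<^bsub>benv C\<^esub> = \<top>\<^bsub>N\<^esub>"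
    "\<forall>x\<in>carrier (benv C). \<forall>y\<in>carrier (benv C). g (x \<squnion>\<^bsub>benv C\<^esub> y) = g x \<squnion>\<^bsub>N\<^esub> g y"
    "\<forall>x\<in>carrier (benv C). \<forall>y\<in>carrier (benv C). g (x \<sqinter>\<^bsub>benv C\<^esub> y) = g x \<sqinter>\<^bsub>N\<^esub> g y"
    using assms unfolding bdd_lattice_hom_def join_pres_def meet_pres_def by blast+
  show "g {} = \<bottom>\<^bsub>N\<^esub>" "g (prime_filters C) = \<top>\<^bsub>N\<^esub>" using g(2,3) by (simp_all only: benv_ops(1,2))
  show "g U \<in> carrier N" if "U \<in> carrier (benv C)" using that g(1) by blast
  assume UV: "U \<in> carrier (benv C)" "V \<in> carrier (benv C)"
  show "g (U \<union> V) = g U \<squnion>\<^bsub>N\<^esub> g V" "g (U \<inter> V) = g U \<sqinter>\<^bsub>N\<^esub> g V"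
    using g(4,5)[rule_format, OF UV] by (simp_all only: benv_ops(3,4)[OF UV])
qed

lemma benv_hom_is_compl:
  assumes g: "bdd_lattice_hom (benv C) N g" and U: "U \<in> carrier (benv C)"
  shows "is_compl N (g U) (g (prime_filters C - U))"
proof -
  have "U \<union> (prime_filters C - U) = prime_filters C" "U \<inter> (prime_filters C - U) = {}"
    using benv_sets(3)[OF U] by auto
  then show ?thesis
    using benv_homD(1,2,3)[OF g] benv_homD(4,5)[OF g U benv_sets(6)[OF U]] benv_sets(6)[OF U]
    unfolding is_compl_def by simp
qed

lemma benv_homI:
  assumes "lattice N" and "\<And>U. U \<in> carrier (benv C) \<Longrightarrow> g U \<in> carrier N"
    and "g {} = \<bottom>\<^bsub>N\<^esub>" "g (prime_filters C) = \<top>\<^bsub>N\<^esub>"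
    and "\<And>U V. U \<in> carrier (benv C) \<Longrightarrow> V \<in> carrier (benv C) \<Longrightarrow> g (U \<union> V) = g U \<squnion>\<^bsub>N\<^esub> g V"
    and "\<And>U V. U \<in> carrier (benv C) \<Longrightarrow> V \<in> carrier (benv C) \<Longrightarrow> g (U \<inter> V) = g U \<sqinter>\<^bsub>N\<^esub> g V"
  shows "bdd_lattice_hom (benv C) N g"
proof -
  have "lattice (benv C)"
    using boolean_lattice_benv[of C]
    by (auto simp: boolean_lattice_def bdd_distrib_lattice_def dest: bounded_lattice.axioms(1))
  then show ?thesis
    using assms by (simp add: bdd_lattice_hom_def join_pres_def meet_pres_def benv_ops)
qed

text \<open>
  Used for the two embeddings of an envelope into a complete Boolean algebra, whose images are both
  of the form \<open>bool_sat M\<close>.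
\<close>

lemma benv_hom_image:
  assumes N: "bdd_distrib_lattice N" and g: "bdd_lattice_hom (benv C) N g"
  shows "g ` carrier (benv C) = bool_gen N ((\<lambda>c. g (benv_emb C c)) ` carrier C)"
    (is "_ = ?G")
proof
  note h = benv_homD[OF g]
  have "g U \<in> ?G" if "U \<in> carrier (benv C)" for U
    using that
  proof (induction rule: benv_induct)
    case (compl U)
    then show ?case using bool_gen.compl[OF _ benv_hom_is_compl[OF g]] by blast
  qed (simp_all add: h bool_gen.base bool_gen.bot bool_gen.top bool_gen.join bool_gen.meet)
  then show "g ` carrier (benv C) \<subseteq> ?G" by (rule image_subsetI)
  show "?G \<subseteq> g ` carrier (benv C)"
  proof
    fix x assume "x \<in> ?G"
    then show "x \<in> g ` carrier (benv C)"
    proof induction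
      case (base x) then show ?case by (auto intro!: imageI benv_emb_closed)
    next
      case bot show ?case using h(2) benv_sets(1) by (metis imageI)
    next
      case top show ?case using h(3) benv_sets(2) by (metis imageI)
    next
      case (join x y)
      then obtain U V where "U \<in> carrier (benv C)" "x = g U" "V \<in> carrier (benv C)" "y = g V"
        by (elim imageE)
      then show ?case using h(4) benv_sets(4) by (intro image_eqI[of _ g "U \<union> V"]) simp_all
    next
      case (meet x y)
      then obtain U V where "U \<in> carrier (benv C)" "x = g U" "V \<in> carrier (benv C)" "y = g V"
        by (elim imageE)
      then show ?case using h(5) benv_sets(5) by (intro image_eqI[of _ g "U \<inter> V"]) simp_all
    next
      case (compl x y)
      then obtain U where U: "U \<in> carrier (benv C)" "x = g U" by blast
      then have "y = g (prime_filters C - U)"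
        using is_compl_unique[OF N h(1)] compl(2) benv_hom_is_compl[OF g] by blast
      then show ?case using benv_sets(6)[OF U(1)] by blast
    qed
  qed
qed

lemma benv_ext:
  assumes "bdd_distrib_lattice C" "boolean_lattice B" "bdd_lattice_hom C B h"
  shows "bdd_lattice_hom (benv C) B (benv_ext C B h)"
    and "c \<in> carrier C \<Longrightarrow> benv_ext C B h (benv_emb C c) = h c"
  using theI'[OF benv_universal[OF assms], folded benv_ext_def] by simp_all

lemma benv_ext_eq:
  assumes "bdd_distrib_lattice C" "boolean_lattice B" "bdd_lattice_hom C B h"
    and g: "bdd_lattice_hom (benv C) B g" and gh: "\<And>c. c \<in> carrier C \<Longrightarrow> g (benv_emb C c) = h c"
    and U: "U \<in> carrier (benv C)"
  shows "benv_ext C B h U = g U"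
proof -
  let ?g = "restrict g (carrier (benv C))"
  have "bdd_lattice_hom (benv C) B ?g"
  proof (rule benv_homI)
    show "lattice B"
      using assms(2) by (auto simp: boolean_lattice_def bdd_distrib_lattice_def dest: bounded_lattice.axioms(1))
  qed (simp_all add: benv_homD[OF g] benv_sets)
  then have "benv_ext C B h = ?g"
    unfolding benv_ext_def using gh
    by (intro the1_equality[OF benv_universal[OF assms(1-3)]]) (simp add: benv_emb_closed)
  then show ?thesis using U by simp
qed

lemma benv_hom_mono:
  assumes N: "lattice N" and g: "bdd_lattice_hom (benv C) N g"
    and UV: "U \<in> carrier (benv C)" "V \<in> carrier (benv C)" "U \<subseteq> V"
  shows "g U \<sqsubseteq>\<^bsub>N\<^esub> g V"
proof -
  interpret lattice N by fact
  have "g U \<squnion>\<^bsub>N\<^esub> g V = g V" using benv_homD(4)[OF g UV(1,2)] UV(3) by (simp add: Un_absorb1)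
  then show ?thesis using benv_homD(1)[OF g] UV le_iff_meet by simp
qed

text \<open>
  A nonempty element contains a nonempty \<open>benv_emb C c - benv_emb C d\<close>.  If \<open>g\<close> sent this to bottom,
  it would send \<open>c\<close> below \<open>d\<close>, so \<open>c\<close> would lie below \<open>d\<close> and the difference would be empty.  Hence
  the kernel of \<open>g\<close> is trivial.
\<close>

lemma benv_hom_inj:
  assumes C: "bdd_distrib_lattice C" and N: "bounded_lattice N"
    and g: "bdd_lattice_hom (benv C) N g"
    and refl: "\<And>c d. \<lbrakk>c \<in> carrier C; d \<in> carrier C; g (benv_emb C c) \<sqsubseteq>\<^bsub>N\<^esub> g (benv_emb C d)\<rbrakk>
      \<Longrightarrow> c \<sqsubseteq>\<^bsub>C\<^esub> d"
  shows "inj_on g (carrier (benv C))"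
proof -
  interpret N: bounded_lattice N by fact
  have bC: "bounded_lattice C" using C by (simp add: bdd_distrib_lattice_def)
  note h = benv_homD[OF g]
  have lat: "lattice N" by unfold_locales
  have diff: "g U \<sqsubseteq>\<^bsub>N\<^esub> g V"
    if UV: "U \<in> carrier (benv C)" "V \<in> carrier (benv C)" "g (U - V) = \<bottom>\<^bsub>N\<^esub>" for U V
  proof -
    have c: "U - V \<in> carrier (benv C)" "U \<inter> V \<in> carrier (benv C)"
      using UV benv_sets(5,7) by blast+
    have "(U - V) \<union> (U \<inter> V) = U" by blast
    then have "g U = \<bottom>\<^bsub>N\<^esub> \<squnion>\<^bsub>N\<^esub> g (U \<inter> V)" using h(4)[OF c] UV(3) by simp
    also have "\<dots> = g (U \<inter> V)"
      using N.le_iff_meet[OF N.bottom_closed h(1)[OF c(2)]] h(1)[OF c(2)] by simp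
    also have "\<dots> \<sqsubseteq>\<^bsub>N\<^esub> g V" using benv_hom_mono[OF lat g c(2) UV(2)] by simp
    finally show ?thesis .
  qed
  have zero: "U = {}" if U: "U \<in> carrier (benv C)" "g U = \<bottom>\<^bsub>N\<^esub>" for U
  proof (rule ccontr)
    assume "U \<noteq> {}"
    then obtain P c d where cd: "c \<in> carrier C" "d \<in> carrier C"
      and P: "P \<in> benv_emb C c - benv_emb C d" "benv_emb C c - benv_emb C d \<subseteq> U"
      using benv_basic_nbhd[OF bC U(1)] by blast
    have e: "benv_emb C c \<in> carrier (benv C)" "benv_emb C d \<in> carrier (benv C)"
      "benv_emb C c - benv_emb C d \<in> carrier (benv C)"
      using cd by (auto intro: benv_emb_closed benv_sets(7))
    have "g (benv_emb C c - benv_emb C d) \<sqsubseteq>\<^bsub>N\<^esub> \<bottom>\<^bsub>N\<^esub>"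
      using benv_hom_mono[OF lat g e(3) U(1) P(2)] U(2) by simp
    then have "g (benv_emb C c - benv_emb C d) = \<bottom>\<^bsub>N\<^esub>"
      using h(1)[OF e(3)] by (intro N.le_antisym) auto
    then have "c \<sqsubseteq>\<^bsub>C\<^esub> d" using refl[OF cd] diff[OF e(1,2)] by blast
    then have "benv_emb C c \<subseteq> benv_emb C d"
      using cd by (auto simp: benv_emb_def prime_filters_def)
    then show False using P(1) by blast
  qed
  have sub: "U \<subseteq> V" if UV: "U \<in> carrier (benv C)" "V \<in> carrier (benv C)" "g U = g V" for U V
  proof -
    have UV': "U - V \<in> carrier (benv C)" using UV benv_sets(7) by blast
    have "g (U - V) \<sqsubseteq>\<^bsub>N\<^esub> g V"
      using benv_hom_mono[OF lat g UV' UV(1)] UV(3) by auto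
    then have "g (U - V) = g (U - V) \<sqinter>\<^bsub>N\<^esub> g V"
      using N.le_iff_join[OF h(1)[OF UV'] h(1)[OF UV(2)]] by blast
    also have "\<dots> = g ((U - V) \<inter> V)" using h(5)[OF UV' UV(2)] by simp
    also have "(U - V) \<inter> V = {}" by blast
    also note h(2)
    finally show ?thesis using zero[OF UV'] by blast
  qed
  show ?thesis by (rule inj_onI) (metis sub subset_antisym)
qed


section \<open>Raney morphisms are the extensions of morphisms of Raney extensions\<close>

lemma bdd_lattice_hom_compose:
  assumes "bdd_lattice_hom X Y f" "bdd_lattice_hom Y Z g"
  shows "bdd_lattice_hom X Z (\<lambda>x. g (f x))"
  using assms by (auto simp: bdd_lattice_hom_def join_pres_def meet_pres_def Pi_iff)

lemma coframe_mor_hom: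
  assumes f: "coframe_mor X Y f" shows "bdd_lattice_hom X Y f"
proof -
  interpret X: complete_lattice X using f by (simp add: coframe_mor_def inf_pres_def)
  interpret Y: complete_lattice Y using f by (simp add: coframe_mor_def inf_pres_def)
  have f': "\<forall>S\<subseteq>carrier X. f (\<Sqinter>\<^bsub>X\<^esub> S) = \<Sqinter>\<^bsub>Y\<^esub> (f ` S)"
    using f unfolding coframe_mor_def inf_pres_def by blast
  have "f \<top>\<^bsub>X\<^esub> = \<top>\<^bsub>Y\<^esub>"
    using f'[rule_format, of "{}"] by (simp add: X.Inf_empty Y.Inf_empty)
  moreover have "f (x \<sqinter>\<^bsub>X\<^esub> y) = f x \<sqinter>\<^bsub>Y\<^esub> f y" if "x \<in> carrier X" "y \<in> carrier X" for x y
    using f'[rule_format, of "{x, y}"] that by (simp add: meet_def)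
  ultimately show ?thesis
    using f by (simp add: coframe_mor_def bdd_lattice_hom_def join_pres_def meet_pres_def)
qed

lemma re_mor_hom: "h \<in> re_mor R R' \<Longrightarrow> bdd_lattice_hom R R' h"
  by (simp add: re_mor_def coframe_mor_hom)

lemma re_mor_closed: "h \<in> re_mor R R' \<Longrightarrow> c \<in> carrier R \<Longrightarrow> h c \<in> carrier R'"
  by (auto simp: re_mor_def)

lemma (in mt) saturated_inclusion_hom: "bdd_lattice_hom (R_ob M) M (\<lambda>a. a)"
proof -
  have "lattice (R_ob M)" using complete_lattice_R_ob by simp
  then show ?thesis
    using lattice_axioms saturated_carrier
    unfolding bdd_lattice_hom_def join_pres_def meet_pres_def by (auto simp: R_ob_ops)
qed

text \<open>
  The formula by which a Raney morphism is recovered from its restriction to \<open>bool_sat M\<close>, and which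
  also defines the identities and the composition of Raney morphisms.
\<close>

definition lower_ext ::
    "'a mt \<Rightarrow> ('b, 'n) gorder_scheme \<Rightarrow> ('a \<Rightarrow> 'b) \<Rightarrow> 'a \<Rightarrow> 'b" where
  "lower_ext M N p = (\<lambda>a\<in>carrier M. \<Squnion>\<^bsub>N\<^esub> (p ` {x \<in> bool_sat M. x \<sqsubseteq>\<^bsub>M\<^esub> a}))"

lemma raney_id_lower_ext: "raney_id M = lower_ext M M (\<lambda>x. x)"
  by (simp add: raney_id_def lower_ext_def)

lemma raney_comp_lower_ext: "raney_comp M M'' g f = lower_ext M M'' (\<lambda>x. g (f x))"
  by (simp add: raney_comp_def lower_ext_def)

locale mt_pair = M: mt M + M': mt M' for M :: "'a mt" and M' :: "'b mt"

lemma mt_pairI: "mt_algebra M \<Longrightarrow> mt_algebra M' \<Longrightarrow> mt_pair M M'"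
  by (simp add: mt_pair_def mtI)

context mt_pair
begin

lemma raney_morD:
  assumes "f \<in> raney_mor M M'"
  shows "f \<in> carrier M \<rightarrow>\<^sub>E carrier M'"
    and "coframe_mor (R_ob M) (R_ob M') f"
    and "frame_mor (R_ob M\<lparr>carrier := opens M\<rparr>) (R_ob M'\<lparr>carrier := opens M'\<rparr>) f"
    and "a \<in> carrier M \<Longrightarrow> b \<in> carrier M \<Longrightarrow> f (a \<sqinter>\<^bsub>M\<^esub> b) = f a \<sqinter>\<^bsub>M'\<^esub> f b"
    and "x \<in> bool_sat M \<Longrightarrow> y \<in> bool_sat M \<Longrightarrow> f (x \<squnion>\<^bsub>M\<^esub> y) = f x \<squnion>\<^bsub>M'\<^esub> f y"
    and "a \<in> carrier M \<Longrightarrow> f a = \<Squnion>\<^bsub>M'\<^esub> (f ` {x \<in> bool_sat M. x \<sqsubseteq>\<^bsub>M\<^esub> a})"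
proof -
  note f = assms[unfolded raney_mor_def mem_Collect_eq]
  have "coframe_mor (M\<lparr>carrier := saturated M\<rparr>) (M'\<lparr>carrier := saturated M'\<rparr>) f"
    using f by blast
  then show "coframe_mor (R_ob M) (R_ob M') f"
    by (rule coframe_mor_cong[OF M.truncate_R_ob(1)[symmetric] M'.truncate_R_ob(1)[symmetric] HOL.refl])
  have "frame_mor (M\<lparr>carrier := opens M\<rparr>) (M'\<lparr>carrier := opens M'\<rparr>) f"
    using f by blast
  then show "frame_mor (R_ob M\<lparr>carrier := opens M\<rparr>) (R_ob M'\<lparr>carrier := opens M'\<rparr>) f"
    by (rule frame_mor_cong[OF M.truncate_R_ob(2)[symmetric] M'.truncate_R_ob(2)[symmetric] HOL.refl])
qed (use assms[unfolded raney_mor_def mem_Collect_eq] in blast)+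

lemma raney_mor_closed: "f \<in> raney_mor M M' \<Longrightarrow> a \<in> carrier M \<Longrightarrow> f a \<in> carrier M'"
  using raney_morD(1) by (rule PiE_mem)

lemma R_mor_re_mor:
  assumes f: "f \<in> raney_mor M M'" shows "R_mor M f \<in> re_mor (R_ob M) (R_ob M')"
proof -
  have "coframe_mor (R_ob M) (R_ob M') (R_mor M f)"
    by (rule coframe_mor_cong[OF HOL.refl HOL.refl _ raney_morD(2)[OF f]]) (simp add: R_mor_def)
  moreover have "frame_mor (R_ob M\<lparr>carrier := opens M\<rparr>) (R_ob M'\<lparr>carrier := opens M'\<rparr>) (R_mor M f)"
    by (rule frame_mor_cong[OF HOL.refl HOL.refl _ raney_morD(3)[OF f]])
      (use M.opens_saturated in \<open>auto simp: R_mor_def\<close>)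
  ultimately show ?thesis
    by (simp add: re_mor_def coframe_mor_def PiE_def R_mor_def)
qed

lemma raney_mor_saturated: "f \<in> raney_mor M M' \<Longrightarrow> x \<in> saturated M \<Longrightarrow> f x \<in> saturated M'"
  using raney_morD(2) by (auto simp: coframe_mor_def)

lemma raney_mor_bool_hom:
  assumes f: "f \<in> raney_mor M M'" shows "bool_hom_on (bool_sat M) M M' f"
proof -
  have "bdd_lattice_hom (R_ob M) (R_ob M') f" using raney_morD(2)[OF f] by (rule coframe_mor_hom)
  then have "f \<bottom>\<^bsub>M\<^esub> = \<bottom>\<^bsub>M'\<^esub>" "f \<top>\<^bsub>M\<^esub> = \<top>\<^bsub>M'\<^esub>"
    by (simp_all add: bdd_lattice_hom_def M.R_ob_ops M'.R_ob_ops)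
  then show ?thesis
    using raney_morD(4,5)[OF f] raney_mor_closed[OF f] subsetD[OF M.bool_sat_carrier]
    unfolding bool_hom_on_def by simp
qed

lemma raney_mor_bool_sat:
  assumes f: "f \<in> raney_mor M M'" and x: "x \<in> bool_sat M" shows "f x \<in> bool_sat M'"
proof -
  have "f ` saturated M \<subseteq> saturated M'" using raney_mor_saturated[OF f] by auto
  then show ?thesis
    using bool_hom_on_image[of M "saturated M" M' f] raney_mor_bool_hom[OF f] x
    unfolding bool_sat_def by blast
qed

lemma raney_mor_eq_lower_ext:
  assumes f: "f \<in> raney_mor M M'" and p: "\<And>x. x \<in> bool_sat M \<Longrightarrow> f x = p x"
  shows "lower_ext M M' p = f"
proof (rule extensionalityI[of _ "carrier M"])
  fix a assume a: "a \<in> carrier M"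
  have "p ` {x \<in> bool_sat M. x \<sqsubseteq>\<^bsub>M\<^esub> a} = f ` {x \<in> bool_sat M. x \<sqsubseteq>\<^bsub>M\<^esub> a}"
    using p by (intro image_cong) auto
  then show "lower_ext M M' p a = f a" using raney_morD(6)[OF f a] a by (simp add: lower_ext_def)
qed (use raney_morD(1)[OF f] in \<open>auto simp: lower_ext_def PiE_def\<close>)

lemma raney_faithful:
  assumes f: "f \<in> raney_mor M M'" and g: "g \<in> raney_mor M M'"
    and fg: "\<And>x. x \<in> saturated M \<Longrightarrow> f x = g x"
  shows "f = g"
proof -
  have "f x = g x" if "x \<in> bool_sat M" for x
    using raney_mor_bool_hom[OF f] raney_mor_bool_hom[OF g] fg that unfolding bool_sat_def
    by (rule bool_hom_on_eq[OF M'.distributive])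
  then have "lower_ext M M' g = f" by (rule raney_mor_eq_lower_ext[OF f])
  moreover have "lower_ext M M' g = g" by (rule raney_mor_eq_lower_ext[OF g HOL.refl])
  ultimately show ?thesis by simp
qed

context
  fixes p assumes p: "bool_hom_on (bool_sat M) M M' p"
begin

lemma bool_hom_closed: "x \<in> bool_sat M \<Longrightarrow> p x \<in> carrier M'"
  using p by (auto simp: bool_hom_on_def)

lemma bool_hom_mono:
  assumes "x \<in> bool_sat M" "y \<in> bool_sat M" "x \<sqsubseteq>\<^bsub>M\<^esub> y" shows "p x \<sqsubseteq>\<^bsub>M'\<^esub> p y"
proof -
  have c: "x \<in> carrier M" "y \<in> carrier M" using assms(1,2) M.bool_sat_carrier by auto
  have "p x \<squnion>\<^bsub>M'\<^esub> p y = p (x \<squnion>\<^bsub>M\<^esub> y)" using p assms(1,2) by (simp add: bool_hom_on_def)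
  also have "x \<squnion>\<^bsub>M\<^esub> y = y" using M.le_iff_meet[OF c] assms(3) by (rule iffD1)
  finally show ?thesis
    by (rule iffD2[OF M'.le_iff_meet[OF bool_hom_closed[OF assms(1)] bool_hom_closed[OF assms(2)]]])
qed

lemma lower_ext_carrier: "p ` {x \<in> bool_sat M. x \<sqsubseteq>\<^bsub>M\<^esub> a} \<subseteq> carrier M'"
  using bool_hom_closed by auto

lemma lower_ext_eq: assumes x: "x \<in> bool_sat M" shows "lower_ext M M' p x = p x"
proof -
  have xc: "x \<in> carrier M" using x M.bool_sat_carrier by blast
  have "\<Squnion>\<^bsub>M'\<^esub> (p ` {y \<in> bool_sat M. y \<sqsubseteq>\<^bsub>M\<^esub> x}) = p x"
    using x xc lower_ext_carrier
    by (intro M'.Sup_eqI) (auto simp: bool_hom_closed bool_hom_mono)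
  then show ?thesis using xc by (simp add: lower_ext_def)
qed

text \<open>The essential inequality is the infinite distributive law in \<open>M'\<close>, \<open>Sup_meet_Sup_le\<close>.\<close>

lemma lower_ext_meet:
  assumes ab: "a \<in> carrier M" "b \<in> carrier M"
  shows "lower_ext M M' p (a \<sqinter>\<^bsub>M\<^esub> b) = lower_ext M M' p a \<sqinter>\<^bsub>M'\<^esub> lower_ext M M' p b"
proof -
  let ?D = "\<lambda>a. {x \<in> bool_sat M. x \<sqsubseteq>\<^bsub>M\<^esub> a}"
  let ?s = "\<lambda>a. \<Squnion>\<^bsub>M'\<^esub> (p ` ?D a)"
  have bc: "x \<in> carrier M" if "x \<in> bool_sat M" for x using that M.bool_sat_carrier by blast
  have D: "x \<in> ?D (a \<sqinter>\<^bsub>M\<^esub> b) \<longleftrightarrow> x \<in> ?D a \<and> x \<in> ?D b" for x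
  proof
    assume x: "x \<in> ?D (a \<sqinter>\<^bsub>M\<^esub> b)"
    then have xc: "x \<in> carrier M" using bc by blast
    have "x \<sqsubseteq>\<^bsub>M\<^esub> a" "x \<sqsubseteq>\<^bsub>M\<^esub> b"
      using x xc ab M.le_trans[OF _ M.meet_left[OF ab]] M.le_trans[OF _ M.meet_right[OF ab]] by simp_all
    then show "x \<in> ?D a \<and> x \<in> ?D b" using x by blast
  next
    assume "x \<in> ?D a \<and> x \<in> ?D b"
    then show "x \<in> ?D (a \<sqinter>\<^bsub>M\<^esub> b)" using ab bc by (simp add: M.meet_le)
  qed
  have sc: "?s a \<in> carrier M'" for a using lower_ext_carrier by simp
  have "?s (a \<sqinter>\<^bsub>M\<^esub> b) = ?s a \<sqinter>\<^bsub>M'\<^esub> ?s b"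
  proof (rule M'.le_antisym)
    show "?s (a \<sqinter>\<^bsub>M\<^esub> b) \<sqsubseteq>\<^bsub>M'\<^esub> ?s a \<sqinter>\<^bsub>M'\<^esub> ?s b"
    proof (rule M'.sup_least[OF lower_ext_carrier])
      fix z assume "z \<in> p ` ?D (a \<sqinter>\<^bsub>M\<^esub> b)"
      then obtain x where x: "z = p x" "x \<in> ?D a" "x \<in> ?D b" using D by blast
      have "p x \<in> carrier M'" using x(2) bool_hom_closed by blast
      then show "z \<sqsubseteq>\<^bsub>M'\<^esub> ?s a \<sqinter>\<^bsub>M'\<^esub> ?s b"
        unfolding x(1) using x(2,3) sc
        by (intro M'.meet_le M'.sup_upper[OF lower_ext_carrier] imageI)
    qed (use sc in simp)
    have bound: "p x \<sqinter>\<^bsub>M'\<^esub> p y \<sqsubseteq>\<^bsub>M'\<^esub> ?s (a \<sqinter>\<^bsub>M\<^esub> b)" if xy: "x \<in> ?D a" "y \<in> ?D b" for x y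
    proof -
      have b: "x \<in> bool_sat M" "y \<in> bool_sat M" "x \<sqsubseteq>\<^bsub>M\<^esub> a" "y \<sqsubseteq>\<^bsub>M\<^esub> b" using xy by simp_all
      have "x \<sqinter>\<^bsub>M\<^esub> y \<sqsubseteq>\<^bsub>M\<^esub> a" "x \<sqinter>\<^bsub>M\<^esub> y \<sqsubseteq>\<^bsub>M\<^esub> b"
        using M.le_trans[OF M.meet_left b(3)] M.le_trans[OF M.meet_right b(4)] bc b(1,2) ab by simp_all
      then have "x \<sqinter>\<^bsub>M\<^esub> y \<in> ?D (a \<sqinter>\<^bsub>M\<^esub> b)" using D[of "x \<sqinter>\<^bsub>M\<^esub> y"] M.bool_sat_meet b by simp
      then have "p (x \<sqinter>\<^bsub>M\<^esub> y) \<sqsubseteq>\<^bsub>M'\<^esub> ?s (a \<sqinter>\<^bsub>M\<^esub> b)"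
        by (intro M'.sup_upper[OF lower_ext_carrier] imageI)
      then show ?thesis using p b(1,2) by (simp add: bool_hom_on_def)
    qed
    show "?s a \<sqinter>\<^bsub>M'\<^esub> ?s b \<sqsubseteq>\<^bsub>M'\<^esub> ?s (a \<sqinter>\<^bsub>M\<^esub> b)"
    proof (rule M'.Sup_meet_Sup_le[OF lower_ext_carrier lower_ext_carrier sc])
      fix u v assume "u \<in> p ` ?D a" "v \<in> p ` ?D b"
      then obtain x y where "x \<in> ?D a" "u = p x" "y \<in> ?D b" "v = p y" by (elim imageE)
      then show "u \<sqinter>\<^bsub>M'\<^esub> v \<sqsubseteq>\<^bsub>M'\<^esub> ?s (a \<sqinter>\<^bsub>M\<^esub> b)" using bound by simp
    qed
  qed (use sc in simp_all)
  then show ?thesis using ab by (simp add: lower_ext_def)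
qed

text \<open>
  The extension agrees with \<open>p\<close> on \<open>bool_sat M\<close>.  So it inherits the preservation of binary joins from
  \<open>p\<close> and the behaviour on saturated and on open elements from \<open>k\<close>.
\<close>

lemma lower_ext_raney_mor:
  assumes k: "k \<in> re_mor (R_ob M) (R_ob M')" and pk: "\<And>x. x \<in> saturated M \<Longrightarrow> p x = k x"
  shows "lower_ext M M' p \<in> raney_mor M M'"
proof -
  let ?f = "lower_ext M M' p"
  have fk: "k x = ?f x" if "x \<in> saturated M" for x
    using that pk lower_ext_eq M.saturated_bool_sat by auto
  have "coframe_mor (M\<lparr>carrier := saturated M\<rparr>) (M'\<lparr>carrier := saturated M'\<rparr>) ?f"
    by (rule coframe_mor_cong[OF M.truncate_R_ob(1) M'.truncate_R_ob(1), of k])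
      (use k fk in \<open>simp_all add: re_mor_def\<close>)
  moreover have "frame_mor (M\<lparr>carrier := opens M\<rparr>) (M'\<lparr>carrier := opens M'\<rparr>) ?f"
    by (rule frame_mor_cong[OF M.truncate_R_ob(2) M'.truncate_R_ob(2), of k])
      (use k fk M.opens_saturated in \<open>auto simp: re_mor_def\<close>)
  moreover have "?f \<in> carrier M \<rightarrow>\<^sub>E carrier M'"
    using lower_ext_carrier by (simp add: lower_ext_def)
  moreover have "?f (x \<squnion>\<^bsub>M\<^esub> y) = ?f x \<squnion>\<^bsub>M'\<^esub> ?f y" if "x \<in> bool_sat M" "y \<in> bool_sat M" for x y
  proof -
    have "x \<squnion>\<^bsub>M\<^esub> y \<in> bool_sat M" using that unfolding bool_sat_def by (rule bool_gen.join)
    then show ?thesis using that p by (simp add: lower_ext_eq bool_hom_on_def)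
  qed
  moreover have "?f a = \<Squnion>\<^bsub>M'\<^esub> (?f ` {x \<in> bool_sat M. x \<sqsubseteq>\<^bsub>M\<^esub> a})" if "a \<in> carrier M" for a
  proof -
    have "?f ` {x \<in> bool_sat M. x \<sqsubseteq>\<^bsub>M\<^esub> a} = p ` {x \<in> bool_sat M. x \<sqsubseteq>\<^bsub>M\<^esub> a}"
      by (intro image_cong) (auto simp: lower_ext_eq)
    then show ?thesis using that by (simp add: lower_ext_def)
  qed
  ultimately show ?thesis
    using lower_ext_meet unfolding raney_mor_def by blast
qed

end

text \<open>
  The inclusion of the saturated elements extends to an isomorphism of their envelope with
  \<open>bool_sat M\<close>, so \<open>k\<close> extends to \<open>bool_sat M\<close>.
\<close>

lemma raney_full:
  assumes k: "k \<in> re_mor (R_ob M) (R_ob M')"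
  obtains f where "f \<in> raney_mor M M'" "\<And>x. x \<in> saturated M \<Longrightarrow> f x = k x"
proof -
  let ?B = "carrier (benv (R_ob M))"
  define \<beta> where "\<beta> = benv_ext (R_ob M) M (\<lambda>a. a)"
  define \<kappa> where "\<kappa> = benv_ext (R_ob M) M' k"
  have khom: "bdd_lattice_hom (R_ob M) M' k"
    using bdd_lattice_hom_compose[OF re_mor_hom[OF k] M'.saturated_inclusion_hom] .
  have \<beta>: "bdd_lattice_hom (benv (R_ob M)) M \<beta>"
    "\<And>c. c \<in> saturated M \<Longrightarrow> \<beta> (benv_emb (R_ob M) c) = c"
    unfolding \<beta>_def
    using benv_ext[OF M.bdd_distrib_R_ob M.boolean M.saturated_inclusion_hom] by simp_all
  have \<kappa>: "bdd_lattice_hom (benv (R_ob M)) M' \<kappa>"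
    "\<And>c. c \<in> saturated M \<Longrightarrow> \<kappa> (benv_emb (R_ob M) c) = k c"
    unfolding \<kappa>_def using benv_ext[OF M.bdd_distrib_R_ob M'.boolean khom] by simp_all
  \<comment> \<open>The inclusion of the saturated elements reflects the order, so this homomorphism is injective.\<close>
  have inj: "inj_on \<beta> ?B"
    by (rule benv_hom_inj[OF M.bdd_distrib_R_ob M.bounded_lattice \<beta>(1)]) (simp add: \<beta>(2))
  have "(\<lambda>c. \<beta> (benv_emb (R_ob M) c)) ` carrier (R_ob M) = saturated M" using \<beta>(2) by simp
  then have image: "\<beta> ` ?B = bool_sat M"
    using benv_hom_image[OF M.distributive \<beta>(1)] by (simp add: bool_sat_def)
  define \<gamma> where "\<gamma> = the_inv_into ?B \<beta>"
  have \<gamma>\<beta>: "\<gamma> (\<beta> U) = U" if "U \<in> ?B" for U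
    unfolding \<gamma>_def using inj that by (rule the_inv_into_f_f)
  define p where "p x = \<kappa> (\<gamma> x)" for x
  have p\<beta>: "p (\<beta> U) = \<kappa> U" if "U \<in> ?B" for U by (simp add: p_def \<gamma>\<beta> that)
  note b = benv_homD[OF \<beta>(1)] and kh = benv_homD[OF \<kappa>(1)]
  have "p \<bottom>\<^bsub>M\<^esub> = \<bottom>\<^bsub>M'\<^esub>" "p \<top>\<^bsub>M\<^esub> = \<top>\<^bsub>M'\<^esub>"
    using p\<beta>[OF benv_sets(1)] p\<beta>[OF benv_sets(2)] b(2,3) kh(2,3) by simp_all
  moreover have "p x \<in> carrier M'" if "x \<in> bool_sat M" for x
    using that kh(1) p\<beta> unfolding image[symmetric] by auto
  moreover have "p (x \<squnion>\<^bsub>M\<^esub> y) = p x \<squnion>\<^bsub>M'\<^esub> p y \<and> p (x \<sqinter>\<^bsub>M\<^esub> y) = p x \<sqinter>\<^bsub>M'\<^esub> p y"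
    if xy: "x \<in> bool_sat M" "y \<in> bool_sat M" for x y
  proof -
    obtain U V where U: "U \<in> ?B" "x = \<beta> U" and V: "V \<in> ?B" "y = \<beta> V"
      using xy unfolding image[symmetric] by blast
    have "x \<squnion>\<^bsub>M\<^esub> y = \<beta> (U \<union> V)" "x \<sqinter>\<^bsub>M\<^esub> y = \<beta> (U \<inter> V)" using U V b(4,5) by simp_all
    then show ?thesis
      using U V p\<beta> kh(4,5) benv_sets(4,5)[OF U(1) V(1)] by simp
  qed
  ultimately have p: "bool_hom_on (bool_sat M) M M' p" by (simp add: bool_hom_on_def)
  have pk: "p x = k x" if "x \<in> saturated M" for x
  proof -
    have "benv_emb (R_ob M) x \<in> ?B" using that by (simp add: benv_emb_closed)
    then show ?thesis using p\<beta> \<beta>(2)[OF that] \<kappa>(2)[OF that] by metis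
  qed
  show thesis
  proof (rule that)
    show "lower_ext M M' p \<in> raney_mor M M'" by (rule lower_ext_raney_mor[OF p k pk])
    show "lower_ext M M' p x = k x" if "x \<in> saturated M" for x
      using lower_ext_eq[OF p] pk that M.saturated_bool_sat by auto
  qed
qed

end

section \<open>The two categories\<close>

lemma re_id_mor: assumes R: "raney_extension R" shows "re_id R \<in> re_mor R R"
proof -
  have c: "complete_lattice R" "complete_lattice (R\<lparr>carrier := sub R\<rparr>)" "sub R \<subseteq> carrier R"
    using R by (auto simp: raney_extension_def coframe_def subframe_def frame_def)
  have "coframe_mor R R (\<lambda>x. x)" using c(1) by (simp add: coframe_mor_def inf_pres_def join_pres_def)
  then have "coframe_mor R R (re_id R)"
    by (rule coframe_mor_cong[OF HOL.refl HOL.refl, rotated]) simp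
  moreover have "frame_mor (R\<lparr>carrier := sub R\<rparr>) (R\<lparr>carrier := sub R\<rparr>) (\<lambda>x. x)"
    using c(2) by (simp add: frame_mor_def sup_pres_def meet_pres_def)
  then have "frame_mor (R\<lparr>carrier := sub R\<rparr>) (R\<lparr>carrier := sub R\<rparr>) (re_id R)"
    by (rule frame_mor_cong[OF HOL.refl HOL.refl, rotated]) (use c(3) in auto)
  ultimately show ?thesis by (simp add: re_mor_def)
qed

lemma re_comp_mor:
  assumes R: "sub R \<subseteq> carrier R" and h: "h \<in> re_mor R R'" and k: "k \<in> re_mor R' R''"
  shows "re_comp R k h \<in> re_mor R R''"
proof -
  have "coframe_mor R R'' (re_comp R k h)"
    by (rule coframe_mor_cong[OF HOL.refl HOL.refl _ coframe_mor_compose[of R R' h R'' k]])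
      (use h k in \<open>simp_all add: re_mor_def compose_def\<close>)
  moreover have "frame_mor (R\<lparr>carrier := sub R\<rparr>) (R''\<lparr>carrier := sub R''\<rparr>) (re_comp R k h)"
    by (rule frame_mor_cong[OF HOL.refl HOL.refl _ frame_mor_compose[of _ "R'\<lparr>carrier := sub R'\<rparr>" h _ k]])
      (use h k R in \<open>auto simp: re_mor_def compose_def\<close>)
  ultimately show ?thesis
    using h k by (auto simp: re_mor_def compose_def)
qed

lemma re_mor_inverse:
  assumes h: "h \<in> re_mor R R'" and sub: "sub R' \<subseteq> carrier R'"
    and g: "g \<in> carrier R' \<rightarrow>\<^sub>E carrier R" "g \<in> sub R' \<rightarrow> sub R" and subR: "sub R \<subseteq> carrier R"
    and gh: "\<And>x. x \<in> carrier R \<Longrightarrow> g (h x) = x" and hg: "\<And>y. y \<in> carrier R' \<Longrightarrow> h (g y) = y"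
  shows "g \<in> re_mor R' R"
proof -
  have "coframe_mor R' R g"
    by (rule coframe_mor_inverse[of R R' h]) (use h g gh hg in \<open>auto simp: re_mor_def\<close>)
  moreover have "frame_mor (R'\<lparr>carrier := sub R'\<rparr>) (R\<lparr>carrier := sub R\<rparr>) g"
    by (rule frame_mor_inverse[of _ _ h]) (use h g gh hg sub subR in \<open>auto simp: re_mor_def\<close>)
  ultimately show ?thesis using g by (simp add: re_mor_def)
qed

lemma raney_id_mor:
  assumes M: "mt_algebra M"
  shows "raney_id M \<in> raney_mor M M" and "x \<in> bool_sat M \<Longrightarrow> raney_id M x = x"
proof -
  interpret mt_pair M M using M M by (rule mt_pairI)
  have id: "bool_hom_on (bool_sat M) M M (\<lambda>x. x)"
    using M.bool_sat_carrier by (auto simp: bool_hom_on_def)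
  show "raney_id M \<in> raney_mor M M"
    unfolding raney_id_lower_ext
    by (rule lower_ext_raney_mor[OF id re_id_mor[OF M.raney_extension_R_ob]]) simp
  show "raney_id M x = x" if "x \<in> bool_sat M"
    unfolding raney_id_lower_ext using id that by (rule lower_ext_eq)
qed

text \<open>
  Since \<open>f\<close> maps \<open>bool_sat M1\<close> into \<open>bool_sat M2\<close>, where \<open>g\<close> preserves joins, the composite is a
  homomorphism on \<open>bool_sat M1\<close>; the composition of the category is its lower extension.
\<close>

lemma raney_comp_mor:
  assumes M: "mt_algebra M1" "mt_algebra M2" "mt_algebra M3"
    and f: "f \<in> raney_mor M1 M2" and g: "g \<in> raney_mor M2 M3"
  shows "raney_comp M1 M3 g f \<in> raney_mor M1 M3"
    and "x \<in> bool_sat M1 \<Longrightarrow> raney_comp M1 M3 g f x = g (f x)"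
proof -
  interpret f: mt_pair M1 M2 using M(1,2) by (rule mt_pairI)
  interpret g: mt_pair M2 M3 using M(2,3) by (rule mt_pairI)
  interpret gf: mt_pair M1 M3 using M(1,3) by (rule mt_pairI)
  have hom: "bool_hom_on (bool_sat M1) M1 M3 (\<lambda>x. g (f x))"
    using f.raney_mor_bool_hom[OF f] g.raney_mor_bool_hom[OF g] f.raney_mor_bool_sat[OF f]
    by (auto simp: bool_hom_on_def)
  have sub: "sub (R_ob M1) \<subseteq> carrier (R_ob M1)" using f.M.opens_saturated by simp
  show "raney_comp M1 M3 g f \<in> raney_mor M1 M3"
    unfolding raney_comp_lower_ext
    by (rule gf.lower_ext_raney_mor[OF hom re_comp_mor[OF sub f.R_mor_re_mor[OF f] g.R_mor_re_mor[OF g]]])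
      (simp add: compose_def R_mor_def f.raney_mor_saturated[OF f])
  show "raney_comp M1 M3 g f x = g (f x)" if "x \<in> bool_sat M1"
    unfolding raney_comp_lower_ext using hom that by (rule gf.lower_ext_eq)
qed


section \<open>The MacNeille completion of a field of sets\<close>

locale field_of_sets =
  fixes X :: "'a set" and A :: "'a set set"
  assumes A_Pow: "A \<subseteq> Pow X" and top_A: "X \<in> A" and empty_A: "{} \<in> A"
    and Un_A: "\<And>x y. x \<in> A \<Longrightarrow> y \<in> A \<Longrightarrow> x \<union> y \<in> A"
    and Diff_A: "\<And>x y. x \<in> A \<Longrightarrow> y \<in> A \<Longrightarrow> x - y \<in> A"
begin

lemma Int_A: "x \<in> A \<Longrightarrow> y \<in> A \<Longrightarrow> x \<inter> y \<in> A"
  using Diff_A[of x "x - y"] Diff_A[of x y] by (simp add: Diff_Diff_Int)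

text \<open>
  The least normal ideal containing \<open>S\<close>: the lower bounds of the upper bounds.
\<close>

definition cl :: "'a set set \<Rightarrow> 'a set set" where
  "cl S = {y \<in> A. \<forall>u\<in>A. (\<forall>x\<in>S. x \<subseteq> u) \<longrightarrow> y \<subseteq> u}"

abbreviation FC :: "'a set set gorder" where "FC \<equiv> macneille (incl_order A)"

lemma le_FC [simp]: "le FC = (\<subseteq>)" and eq_FC [simp]: "eq FC = (=)"
  by (simp_all add: macneille_def)

lemma carrier_FC: "carrier FC = {I. I \<subseteq> A \<and> cl I = I}"
proof -
  have "Lower (incl_order A) (Upper (incl_order A) I) = cl I" if "I \<subseteq> A" for I
    using that by (auto simp: Lower_def Upper_def cl_def)
  then show ?thesis by (auto simp: macneille_def)
qed

lemma cl_subset: "cl S \<subseteq> A" by (auto simp: cl_def)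

lemma cl_upper: "S \<subseteq> A \<Longrightarrow> S \<subseteq> cl S" by (auto simp: cl_def)

lemma cl_least: "S \<subseteq> I \<Longrightarrow> I \<in> carrier FC \<Longrightarrow> cl S \<subseteq> I"
proof -
  assume "S \<subseteq> I" and I: "I \<in> carrier FC"
  then have "cl S \<subseteq> cl I" unfolding cl_def by blast
  then show "cl S \<subseteq> I" using I by (simp add: carrier_FC)
qed

lemma cl_closed: assumes "S \<subseteq> A" shows "cl S \<in> carrier FC"
proof -
  have "cl (cl S) \<subseteq> cl S" unfolding cl_def by blast
  then have "cl (cl S) = cl S" using cl_upper[OF cl_subset] by (rule subset_antisym)
  then show ?thesis using cl_subset by (simp add: carrier_FC)
qed

lemma FC_memI:
  assumes I: "I \<in> carrier FC" and y: "y \<in> A"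
    and le: "\<And>u. u \<in> A \<Longrightarrow> (\<And>x. x \<in> I \<Longrightarrow> x \<subseteq> u) \<Longrightarrow> y \<subseteq> u"
  shows "y \<in> I"
proof -
  have "y \<in> cl I" using y le by (simp add: cl_def)
  then show ?thesis using I by (simp add: carrier_FC)
qed

lemma FC_subset: "I \<in> carrier FC \<Longrightarrow> I \<subseteq> A"
  by (simp add: carrier_FC)

lemma FC_down: "I \<in> carrier FC \<Longrightarrow> x \<in> I \<Longrightarrow> y \<in> A \<Longrightarrow> y \<subseteq> x \<Longrightarrow> y \<in> I"
  by (erule FC_memI) blast+

lemma FC_empty: "I \<in> carrier FC \<Longrightarrow> {} \<in> I"
  by (rule FC_memI) (auto simp: empty_A)

lemma FC_Inter: assumes "T \<subseteq> carrier FC" shows "A \<inter> \<Inter>T \<in> carrier FC"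
proof -
  have "cl (A \<inter> \<Inter>T) \<subseteq> I" if "I \<in> T" for I
    using that assms by (intro cl_least) auto
  then have "cl (A \<inter> \<Inter>T) \<subseteq> A \<inter> \<Inter>T" using cl_subset by blast
  then have "cl (A \<inter> \<Inter>T) = A \<inter> \<Inter>T" using cl_upper[OF Int_lower1] by (rule subset_antisym)
  then show ?thesis by (simp add: carrier_FC)
qed

lemma FC_Int: "I \<in> carrier FC \<Longrightarrow> J \<in> carrier FC \<Longrightarrow> I \<inter> J \<in> carrier FC"
  using FC_Inter[of "{I, J}"] FC_subset[of I] by (simp add: Int_absorb1 Int_assoc[symmetric])

lemma partial_order_FC: "partial_order FC"
  unfolding macneille_def by (rule partial_order_incl_order)

lemma complete_lattice_FC: "complete_lattice FC"
proof -
  interpret partial_order FC by (rule partial_order_FC)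
  show ?thesis
  proof (rule complete_lattice_criterion1)
    have "A \<in> carrier FC" using FC_Inter[of "{}"] by simp
    then have "greatest FC A (carrier FC)" using FC_subset by (auto simp: greatest_def)
    then show "\<exists>g. greatest FC g (carrier FC)" ..
    fix T assume T: "T \<subseteq> carrier FC"
    have "is_glb FC (A \<inter> \<Inter>T) T"
    proof (rule greatest_LowerI)
      show "y \<sqsubseteq>\<^bsub>FC\<^esub> A \<inter> \<Inter>T" if "y \<in> Lower FC T" for y
        using that T FC_subset[of y] by (auto simp: Lower_def)
    qed (use T FC_Inter in auto)
    then show "\<exists>i. is_glb FC i T" ..
  qed
qed

sublocale FC: complete_lattice FC by (rule complete_lattice_FC)

lemma Inf_FC: "T \<subseteq> carrier FC \<Longrightarrow> \<Sqinter>\<^bsub>FC\<^esub> T = A \<inter> \<Inter>T"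
  by (rule FC.Inf_eqI) (use FC_Inter FC_subset in auto)

lemma Sup_FC: assumes T: "T \<subseteq> carrier FC" shows "\<Squnion>\<^bsub>FC\<^esub> T = cl (\<Union>T)"
proof (rule FC.Sup_eqI[OF T])
  have "\<Union>T \<subseteq> A" using T FC_subset by blast
  then show "cl (\<Union>T) \<in> carrier FC" "\<And>I. I \<in> T \<Longrightarrow> I \<sqsubseteq>\<^bsub>FC\<^esub> cl (\<Union>T)"
    using cl_closed cl_upper[of "\<Union>T"] by auto
  show "cl (\<Union>T) \<sqsubseteq>\<^bsub>FC\<^esub> J" if "J \<in> carrier FC" "\<And>I. I \<in> T \<Longrightarrow> I \<sqsubseteq>\<^bsub>FC\<^esub> J" for J
    using that cl_least[of "\<Union>T" J] by (simp add: Union_least)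
qed

lemma meet_FC: "I \<in> carrier FC \<Longrightarrow> J \<in> carrier FC \<Longrightarrow> I \<sqinter>\<^bsub>FC\<^esub> J = I \<inter> J"
  unfolding meet_def using Inf_FC[of "{I, J}"] FC_subset[of I] by auto

lemma join_FC: "I \<in> carrier FC \<Longrightarrow> J \<in> carrier FC \<Longrightarrow> I \<squnion>\<^bsub>FC\<^esub> J = cl (I \<union> J)"
  unfolding join_def using Sup_FC[of "{I, J}"] by simp

lemma top_FC: "\<top>\<^bsub>FC\<^esub> = A"
  using Inf_FC[of "{}"] by (simp add: FC.Inf_empty)

lemma bottom_FC: "\<bottom>\<^bsub>FC\<^esub> = {{}}"
proof -
  have "cl {} = {{}}" using empty_A by (auto simp: cl_def)
  then show ?thesis using Sup_FC[of "{}"] by (simp add: FC.Sup_empty)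
qed

text \<open>The complement of \<open>I\<close> consists of the elements disjoint from all elements of \<open>I\<close>.\<close>

lemma FC_compl:
  assumes I: "I \<in> carrier FC" shows "\<exists>J. is_compl FC I J"
proof -
  define J where "J = {y \<in> A. \<forall>x\<in>I. x \<inter> y = {}}"
  have "cl J \<subseteq> J"
  proof
    fix y assume y: "y \<in> cl J"
    have "y \<subseteq> X - x" if x: "x \<in> I" for x
    proof -
      have "X - x \<in> A" using x I FC_subset Diff_A[OF top_A] by blast
      moreover have "\<forall>z\<in>J. z \<subseteq> X - x" using x A_Pow by (auto simp: J_def)
      ultimately show ?thesis using y by (simp add: cl_def)
    qed
    then show "y \<in> J" using y cl_subset by (auto simp: J_def)
  qed
  moreover have JA: "J \<subseteq> A" by (auto simp: J_def)
  ultimately have J: "J \<in> carrier FC" using cl_upper[OF JA] by (simp add: carrier_FC subset_antisym)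
  have "I \<inter> J = {{}}"
    using FC_empty[OF I] FC_empty[OF J] by (auto simp: J_def)
  moreover have "A \<subseteq> cl (I \<union> J)"
  proof
    fix y assume y: "y \<in> A"
    have "y \<subseteq> u" if u: "u \<in> A" "\<forall>x\<in>I \<union> J. x \<subseteq> u" for u
    proof -
      have "X - u \<in> J" using u Diff_A[OF top_A] by (auto simp: J_def)
      then have "X - u \<subseteq> u" using u by blast
      then show ?thesis using y A_Pow by blast
    qed
    then show "y \<in> cl (I \<union> J)" using y by (simp add: cl_def)
  qed
  then have "cl (I \<union> J) = A" using cl_subset by (intro subset_antisym)
  ultimately have "is_compl FC I J"
    using I J by (simp add: is_compl_def meet_FC join_FC top_FC bottom_FC)
  then show ?thesis ..
qed

text \<open>
  If \<open>u\<close> bounds \<open>I \<inter> J\<close> and \<open>I \<inter> K\<close>, and \<open>x \<in> I\<close>, then \<open>(X - x) \<union> u\<close> bounds \<open>J\<close> and \<open>K\<close>.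
\<close>

lemma FC_distrib:
  assumes I: "I \<in> carrier FC" "J \<in> carrier FC" "K \<in> carrier FC"
  shows "I \<sqinter>\<^bsub>FC\<^esub> (J \<squnion>\<^bsub>FC\<^esub> K) = I \<sqinter>\<^bsub>FC\<^esub> J \<squnion>\<^bsub>FC\<^esub> I \<sqinter>\<^bsub>FC\<^esub> K"
proof -
  have sub: "I \<subseteq> A" "J \<subseteq> A" "K \<subseteq> A" using I FC_subset by simp_all
  have cJK: "cl (J \<union> K) \<in> carrier FC" using sub by (intro cl_closed) auto
  have "I \<inter> cl (J \<union> K) \<subseteq> cl (I \<inter> J \<union> I \<inter> K)"
  proof
    fix x assume x: "x \<in> I \<inter> cl (J \<union> K)"
    have xA: "x \<in> A" using x sub by blast
    have "x \<subseteq> u" if u: "u \<in> A" "\<forall>z\<in>I \<inter> J \<union> I \<inter> K. z \<subseteq> u" for u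
    proof -
      have "y \<subseteq> (X - x) \<union> u" if y: "y \<in> J \<union> K" for y
      proof -
        have yA: "y \<in> A" using y sub by blast
        have "x \<inter> y \<in> I" using FC_down[OF I(1), of x] x Int_A[OF xA yA] by blast
        moreover have "x \<inter> y \<in> J \<union> K"
          using FC_down[OF I(2), of y] FC_down[OF I(3), of y] y Int_A[OF xA yA] by blast
        ultimately have "x \<inter> y \<subseteq> u" using u(2) by blast
        then show ?thesis using yA A_Pow by blast
      qed
      moreover have "(X - x) \<union> u \<in> A" using Un_A[OF Diff_A[OF top_A xA] u(1)] .
      ultimately have "x \<subseteq> (X - x) \<union> u" using x by (simp add: cl_def)
      then show ?thesis by blast
    qed
    then show "x \<in> cl (I \<inter> J \<union> I \<inter> K)" using xA by (simp add: cl_def)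
  qed
  moreover have "cl (I \<inter> J \<union> I \<inter> K) \<subseteq> I \<inter> cl (J \<union> K)"
    using cl_upper[of "J \<union> K"] sub by (intro cl_least FC_Int I(1) cJK) auto
  ultimately show ?thesis using I FC_Int cJK by (simp add: meet_FC join_FC)
qed

lemma boolean_lattice_FC: "boolean_lattice FC"
  unfolding boolean_lattice_def bdd_distrib_lattice_def
  using FC.bounded_lattice FC_compl FC_distrib by blast

abbreviation emb :: "'a set \<Rightarrow> 'a set set" where "emb \<equiv> macneille_emb (incl_order A)"

lemma emb_def: "emb x = {y \<in> A. y \<subseteq> x}"
  by (simp add: macneille_emb_def)

lemma emb_closed: "x \<in> A \<Longrightarrow> emb x \<in> carrier FC"
proof -
  assume x: "x \<in> A"
  have "cl (emb x) \<subseteq> emb x" using x by (auto simp: cl_def emb_def)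
  moreover have "emb x \<subseteq> A" by (auto simp: emb_def)
  ultimately show ?thesis using cl_upper[of "emb x"] by (simp add: carrier_FC subset_antisym)
qed

lemma emb_le_iff: "I \<in> carrier FC \<Longrightarrow> x \<in> A \<Longrightarrow> emb x \<subseteq> I \<longleftrightarrow> x \<in> I"
  using FC_down[of I x] by (auto simp: emb_def)

lemma emb_mono_iff: "x \<in> A \<Longrightarrow> y \<in> A \<Longrightarrow> emb x \<subseteq> emb y \<longleftrightarrow> x \<subseteq> y"
  by (auto simp: emb_def)

text \<open>
  The completion preserves the joins and meets that exist in \<open>A\<close>; these need not be unions and
  intersections.
\<close>

lemma Sup_emb:
  assumes T: "T \<subseteq> A" and x: "x \<in> A" and ub: "\<And>t. t \<in> T \<Longrightarrow> t \<subseteq> x"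
    and lub: "\<And>u. u \<in> A \<Longrightarrow> (\<And>t. t \<in> T \<Longrightarrow> t \<subseteq> u) \<Longrightarrow> x \<subseteq> u"
  shows "\<Squnion>\<^bsub>FC\<^esub> (emb ` T) = emb x"
proof (rule FC.Sup_eqI)
  show "J \<sqsubseteq>\<^bsub>FC\<^esub> emb x" if "J \<in> emb ` T" for J
    using that ub by (fastforce simp: emb_def)
next
  fix I assume I: "I \<in> carrier FC" "\<And>J. J \<in> emb ` T \<Longrightarrow> J \<sqsubseteq>\<^bsub>FC\<^esub> I"
  have "x \<in> I"
  proof (rule FC_memI[OF I(1) x])
    have "t \<in> I" if "t \<in> T" for t using I(2)[of "emb t"] that T emb_le_iff[OF I(1)] by auto
    then show "x \<subseteq> u" if "u \<in> A" "\<And>y. y \<in> I \<Longrightarrow> y \<subseteq> u" for u using that lub by blast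
  qed
  then show "emb x \<sqsubseteq>\<^bsub>FC\<^esub> I" using emb_le_iff I(1) x by simp
qed (use T x emb_closed in auto)

lemma Inf_emb:
  assumes T: "T \<subseteq> A" and x: "x \<in> A" and lb: "\<And>t. t \<in> T \<Longrightarrow> x \<subseteq> t"
    and glb: "\<And>u. u \<in> A \<Longrightarrow> (\<And>t. t \<in> T \<Longrightarrow> u \<subseteq> t) \<Longrightarrow> u \<subseteq> x"
  shows "\<Sqinter>\<^bsub>FC\<^esub> (emb ` T) = emb x"
proof -
  have "emb ` T \<subseteq> carrier FC" using T emb_closed by auto
  moreover have "A \<inter> \<Inter>(emb ` T) = emb x" using lb glb by (fastforce simp: emb_def)
  ultimately show ?thesis by (simp add: Inf_FC)
qed

lemma emb_ops:
  shows "emb {} = \<bottom>\<^bsub>FC\<^esub>" "emb X = \<top>\<^bsub>FC\<^esub>"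
    and "x \<in> A \<Longrightarrow> y \<in> A \<Longrightarrow> emb (x \<union> y) = emb x \<squnion>\<^bsub>FC\<^esub> emb y"
    and "x \<in> A \<Longrightarrow> y \<in> A \<Longrightarrow> emb (x \<inter> y) = emb x \<sqinter>\<^bsub>FC\<^esub> emb y"
proof -
  show "emb {} = \<bottom>\<^bsub>FC\<^esub>" "emb X = \<top>\<^bsub>FC\<^esub>"
    using empty_A A_Pow by (auto simp: emb_def bottom_FC top_FC)
  show "emb (x \<union> y) = emb x \<squnion>\<^bsub>FC\<^esub> emb y" if "x \<in> A" "y \<in> A"
    using Sup_emb[of "{x, y}" "x \<union> y"] that Un_A by (auto simp: join_def)
  show "emb (x \<inter> y) = emb x \<sqinter>\<^bsub>FC\<^esub> emb y" if "x \<in> A" "y \<in> A"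
    using Inf_emb[of "{x, y}" "x \<inter> y"] that Int_A by (auto simp: meet_def)
qed

end

lemma coframe_distrib:
  assumes C: "coframe C" shows "bdd_distrib_lattice C"
proof -
  interpret complete_lattice C using C by (simp add: coframe_def)
  have d: "x \<squnion>\<^bsub>C\<^esub> (y \<sqinter>\<^bsub>C\<^esub> z) = (x \<squnion>\<^bsub>C\<^esub> y) \<sqinter>\<^bsub>C\<^esub> (x \<squnion>\<^bsub>C\<^esub> z)"
    if "x \<in> carrier C" "y \<in> carrier C" "z \<in> carrier C" for x y z
  proof -
    have "x \<squnion>\<^bsub>C\<^esub> \<Sqinter>\<^bsub>C\<^esub> {y, z} = \<Sqinter>\<^bsub>C\<^esub> ((\<lambda>s. x \<squnion>\<^bsub>C\<^esub> s) ` {y, z})"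
      using C that unfolding coframe_def by (metis empty_subsetI insert_subset)
    then show ?thesis by (simp add: meet_def)
  qed
  have "x \<sqinter>\<^bsub>C\<^esub> (y \<squnion>\<^bsub>C\<^esub> z) = (x \<sqinter>\<^bsub>C\<^esub> y) \<squnion>\<^bsub>C\<^esub> (x \<sqinter>\<^bsub>C\<^esub> z)"
    if c: "x \<in> carrier C" "y \<in> carrier C" "z \<in> carrier C" for x y z
  proof -
    have abs: "(x \<sqinter>\<^bsub>C\<^esub> y) \<squnion>\<^bsub>C\<^esub> x = x"
      using le_iff_meet[of "x \<sqinter>\<^bsub>C\<^esub> y" x] c by (simp add: meet_left)
    have abs': "x \<sqinter>\<^bsub>C\<^esub> (z \<squnion>\<^bsub>C\<^esub> x) = x"
      using le_iff_join[of x "z \<squnion>\<^bsub>C\<^esub> x"] c by (simp add: join_right)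
    have "(x \<sqinter>\<^bsub>C\<^esub> y) \<squnion>\<^bsub>C\<^esub> (x \<sqinter>\<^bsub>C\<^esub> z) = ((x \<sqinter>\<^bsub>C\<^esub> y) \<squnion>\<^bsub>C\<^esub> x) \<sqinter>\<^bsub>C\<^esub> ((x \<sqinter>\<^bsub>C\<^esub> y) \<squnion>\<^bsub>C\<^esub> z)"
      using c by (simp add: d)
    also have "\<dots> = x \<sqinter>\<^bsub>C\<^esub> (z \<squnion>\<^bsub>C\<^esub> (x \<sqinter>\<^bsub>C\<^esub> y))" by (simp only: abs join_comm[of C z])
    also have "\<dots> = x \<sqinter>\<^bsub>C\<^esub> ((z \<squnion>\<^bsub>C\<^esub> x) \<sqinter>\<^bsub>C\<^esub> (z \<squnion>\<^bsub>C\<^esub> y))" using c by (simp only: d)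
    also have "\<dots> = (x \<sqinter>\<^bsub>C\<^esub> (z \<squnion>\<^bsub>C\<^esub> x)) \<sqinter>\<^bsub>C\<^esub> (z \<squnion>\<^bsub>C\<^esub> y)" using c by (simp add: meet_assoc)
    also have "\<dots> = x \<sqinter>\<^bsub>C\<^esub> (y \<squnion>\<^bsub>C\<^esub> z)" by (simp only: abs' join_comm[of C y])
    finally show ?thesis by (rule HOL.sym)
  qed
  then show ?thesis using bounded_lattice by (simp add: bdd_distrib_lattice_def)
qed


section \<open>The Funayama envelope\<close>

locale raney =
  fixes R :: "'a raney" (structure)
  assumes raney_extension: "raney_extension R"
begin

abbreviation L :: "'a raney" where "L \<equiv> R\<lparr>carrier := sub R\<rparr>"

lemma coframe: "coframe R"
  using raney_extension by (simp add: raney_extension_def)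

sublocale complete_lattice R
  using coframe by (simp add: coframe_def)

lemma distributive: "bdd_distrib_lattice R"
  using coframe by (rule coframe_distrib)

lemma sub_carrier: "sub R \<subseteq> carrier R"
  and complete_lattice_sub: "complete_lattice L"
  and sub_inclusion: "frame_mor L R (\<lambda>x. x)"
  using raney_extension by (auto simp: raney_extension_def subframe_def frame_def)

lemma sub_Sup:
  assumes S: "S \<subseteq> sub R" shows "\<Squnion>\<^bsub>L\<^esub> S = \<Squnion>S" and "\<Squnion>S \<in> sub R"
proof -
  interpret L: complete_lattice L by (rule complete_lattice_sub)
  show "\<Squnion>\<^bsub>L\<^esub> S = \<Squnion>S" using sub_inclusion S by (simp add: frame_mor_def sup_pres_def)
  then show "\<Squnion>S \<in> sub R" using L.sup_closed[of S] S by simp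
qed

lemma sub_meet:
  assumes u: "u \<in> sub R" "v \<in> sub R"
  shows "u \<sqinter>\<^bsub>L\<^esub> v = u \<sqinter> v" and "u \<sqinter> v \<in> sub R"
proof -
  interpret L: complete_lattice L by (rule complete_lattice_sub)
  show "u \<sqinter>\<^bsub>L\<^esub> v = u \<sqinter> v" using sub_inclusion u by (simp add: frame_mor_def meet_pres_def)
  then show "u \<sqinter> v \<in> sub R" using L.meet_closed[of u v] u by simp
qed

lemma sub_top: "\<top>\<^bsub>L\<^esub> = \<top>" "\<top> \<in> sub R"
proof -
  interpret L: complete_lattice L by (rule complete_lattice_sub)
  show "\<top>\<^bsub>L\<^esub> = \<top>" using sub_inclusion by (simp add: frame_mor_def)
  then show "\<top> \<in> sub R" using L.top_closed by simp
qed

lemma meet_generated: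
  assumes "c \<in> carrier R" obtains S where "S \<subseteq> sub R" "c = \<Sqinter>S"
  using assms raney_extension by (auto simp: raney_extension_def)

lemma meet_Sup_sub: "a \<in> carrier R \<Longrightarrow> S \<subseteq> sub R \<Longrightarrow> a \<sqinter> \<Squnion>S = \<Squnion>((\<lambda>s. a \<sqinter> s) ` S)"
  using raney_extension by (simp add: raney_extension_def)

lemma join_Inf: "a \<in> carrier R \<Longrightarrow> S \<subseteq> carrier R \<Longrightarrow> a \<squnion> \<Sqinter>S = \<Sqinter>((\<lambda>s. a \<squnion> s) ` S)"
  using coframe by (simp add: coframe_def)

lemma benv_emb_le_iff:
  assumes "a \<in> carrier R" "b \<in> carrier R"
  shows "benv_emb R a \<subseteq> benv_emb R b \<longleftrightarrow> a \<sqsubseteq> b"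
proof
  show "a \<sqsubseteq> b" if "benv_emb R a \<subseteq> benv_emb R b"
    using that prime_filter_exists[OF distributive assms] by (auto simp: benv_emb_def)
  show "benv_emb R a \<subseteq> benv_emb R b" if "a \<sqsubseteq> b"
    using that assms by (auto simp: benv_emb_def prime_filters_def)
qed

lemmas benv_emb_lattice = benv_emb_ops[OF bounded_lattice]

lemma benv_emb_diff_disjoint_iff:
  assumes "a \<in> carrier R" "c \<in> carrier R" "d \<in> carrier R"
  shows "benv_emb R a \<inter> (benv_emb R c - benv_emb R d) = {} \<longleftrightarrow> c \<sqinter> a \<sqsubseteq> d"
proof -
  have "benv_emb R a \<inter> (benv_emb R c - benv_emb R d) = {} \<longleftrightarrow> benv_emb R (c \<sqinter> a) \<subseteq> benv_emb R d"
    using assms benv_emb_lattice(4)[of c a] by auto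
  then show ?thesis using assms by (simp add: benv_emb_le_iff)
qed

lemma benv_emb_diff_subset_iff:
  assumes "a \<in> carrier R" "c \<in> carrier R" "d \<in> carrier R"
  shows "benv_emb R c - benv_emb R d \<subseteq> benv_emb R a \<longleftrightarrow> c \<sqsubseteq> d \<squnion> a"
proof -
  have "benv_emb R c - benv_emb R d \<subseteq> benv_emb R a \<longleftrightarrow> benv_emb R c \<subseteq> benv_emb R (d \<squnion> a)"
    using assms benv_emb_lattice(3)[of d a] by auto
  then show ?thesis using assms by (simp add: benv_emb_le_iff)
qed

text \<open>
  A point of the join outside an upper
  bound \<open>U\<close> has a neighbourhood \<open>benv_emb R c - benv_emb R d\<close> outside \<open>U\<close>, so
  \<open>c \<sqinter> s \<sqsubseteq> d\<close> for all \<open>s \<in> S\<close>, and the distributive law of the Raney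
  extension gives \<open>c \<sqinter> \<Squnion>S \<sqsubseteq> d\<close>.  Hence joins of elements of \<open>sub R\<close> remain joins in
  the envelope.
\<close>

lemma benv_emb_Sup_least:
  assumes S: "S \<subseteq> sub R" and U: "U \<in> carrier (benv R)"
    and ub: "\<And>s. s \<in> S \<Longrightarrow> benv_emb R s \<subseteq> U"
  shows "benv_emb R (\<Squnion>S) \<subseteq> U"
proof
  fix P assume P: "P \<in> benv_emb R (\<Squnion>S)"
  have Sc: "S \<subseteq> carrier R" using S sub_carrier by blast
  show "P \<in> U"
  proof (rule ccontr)
    assume "P \<notin> U"
    then have "P \<in> prime_filters R - U" using P by (simp add: benv_emb_def)
    then obtain c d where cd: "c \<in> carrier R" "d \<in> carrier R"
      and nb: "P \<in> benv_emb R c - benv_emb R d" "benv_emb R c - benv_emb R d \<subseteq> prime_filters R - U"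
      using benv_basic_nbhd[OF bounded_lattice benv_sets(6)[OF U]] by metis
    have "c \<sqinter> s \<sqsubseteq> d" if s: "s \<in> S" for s
    proof -
      have "benv_emb R s \<inter> (benv_emb R c - benv_emb R d) = {}" using ub[OF s] nb(2) by blast
      then show ?thesis using benv_emb_diff_disjoint_iff[OF _ cd] s Sc by blast
    qed
    then have "c \<sqinter> \<Squnion>S \<sqsubseteq> d"
      unfolding meet_Sup_sub[OF cd(1) S] using cd Sc by (intro sup_least) auto
    then have "benv_emb R (\<Squnion>S) \<inter> (benv_emb R c - benv_emb R d) = {}"
      using benv_emb_diff_disjoint_iff[OF _ cd] Sc by simp
    then show False using P nb(1) by blast
  qed
qed

text \<open>
  Dually, a neighbourhood \<open>benv_emb R c - benv_emb R d\<close> inside the lower bound \<open>U\<close> gives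
  \<open>c \<sqsubseteq> d \<squnion> t\<close> for all \<open>t \<in> T\<close>, and the coframe law gives \<open>c \<sqsubseteq> d \<squnion> \<Sqinter>T\<close>.
\<close>

lemma benv_emb_Inf_greatest:
  assumes T: "T \<subseteq> carrier R" and U: "U \<in> carrier (benv R)"
    and lb: "\<And>t. t \<in> T \<Longrightarrow> U \<subseteq> benv_emb R t"
  shows "U \<subseteq> benv_emb R (\<Sqinter>T)"
proof
  fix P assume P: "P \<in> U"
  obtain c d where cd: "c \<in> carrier R" "d \<in> carrier R"
    and nb: "P \<in> benv_emb R c - benv_emb R d" "benv_emb R c - benv_emb R d \<subseteq> U"
    using benv_basic_nbhd[OF bounded_lattice U P] by metis
  have "c \<sqsubseteq> d \<squnion> t" if t: "t \<in> T" for t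
    using benv_emb_diff_subset_iff[OF _ cd, of t] lb[OF t] nb(2) t T by blast
  then have "c \<sqsubseteq> d \<squnion> \<Sqinter>T"
    unfolding join_Inf[OF cd(2) T] using cd T by (intro inf_greatest) auto
  then have "benv_emb R c - benv_emb R d \<subseteq> benv_emb R (\<Sqinter>T)"
    using benv_emb_diff_subset_iff[OF _ cd] T by simp
  then show "P \<in> benv_emb R (\<Sqinter>T)" using nb(1) by blast
qed

sublocale F: field_of_sets "prime_filters R" "carrier (benv R)"
  using benv_sets[where C=R] by unfold_locales auto

lemma incl_order_benv: "incl_order (carrier (benv R)) = benv R"
  by (simp add: benv_def)

text \<open>The unit before restriction to the carrier.\<close>

abbreviation e :: "'a \<Rightarrow> 'a funayama" where "e c \<equiv> fun_emb R (benv_emb R c)"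

lemma truncate_F_ob: "gorder.truncate (F_ob R) = macneille (benv R)"
  by (simp add: F_ob_def gorder.truncate_def Let_def macneille_def incl_order_def)

lemma F_ob_order [simp]:
  "carrier (F_ob R) = carrier (macneille (benv R))" "le (F_ob R) = (\<subseteq>)" "eq (F_ob R) = (=)"
  by (simp_all add: F_ob_def Let_def macneille_def)

lemma F_ob_ops:
  "\<Squnion>\<^bsub>F_ob R\<^esub> S = \<Squnion>\<^bsub>macneille (benv R)\<^esub> S" "\<Sqinter>\<^bsub>F_ob R\<^esub> S = \<Sqinter>\<^bsub>macneille (benv R)\<^esub> S"
  "x \<squnion>\<^bsub>F_ob R\<^esub> y = x \<squnion>\<^bsub>macneille (benv R)\<^esub> y" "x \<sqinter>\<^bsub>F_ob R\<^esub> y = x \<sqinter>\<^bsub>macneille (benv R)\<^esub> y"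
  "\<top>\<^bsub>F_ob R\<^esub> = \<top>\<^bsub>macneille (benv R)\<^esub>" "\<bottom>\<^bsub>F_ob R\<^esub> = \<bottom>\<^bsub>macneille (benv R)\<^esub>"
  by (simp_all only: truncate_ops[of "F_ob R", symmetric] truncate_F_ob)

lemma complete_boolean_F_ob: "complete_lattice (F_ob R)" "boolean_lattice (F_ob R)"
  using F.complete_lattice_FC F.boolean_lattice_FC
  by (simp_all only: incl_order_benv truncate_F_ob[symmetric] truncate_locales truncate_boolean_lattice)

sublocale FM: complete_lattice "F_ob R" by (rule complete_boolean_F_ob)

lemma fun_emb_hom: "bdd_lattice_hom (benv R) (F_ob R) (fun_emb R)"
proof (rule benv_homI)
  show "lattice (F_ob R)" by unfold_locales
qed (use F.emb_ops F.emb_closed in \<open>simp_all add: F_ob_ops incl_order_benv\<close>)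

lemma fun_emb_closed: "U \<in> carrier (benv R) \<Longrightarrow> fun_emb R U \<in> carrier (F_ob R)"
  using fun_emb_hom by (rule benv_homD(1))

lemma e_closed: "c \<in> carrier R \<Longrightarrow> e c \<in> carrier (F_ob R)"
  by (rule fun_emb_closed) (rule benv_emb_closed)

lemma e_hom: "bdd_lattice_hom R (F_ob R) e"
  using bdd_lattice_hom_compose[OF benv_emb_hom[OF distributive] fun_emb_hom] .

lemma e_ops:
  shows "e \<bottom> = \<bottom>\<^bsub>F_ob R\<^esub>" "e \<top> = \<top>\<^bsub>F_ob R\<^esub>"
    and "a \<in> carrier R \<Longrightarrow> b \<in> carrier R \<Longrightarrow> e (a \<squnion> b) = e a \<squnion>\<^bsub>F_ob R\<^esub> e b"
    and "a \<in> carrier R \<Longrightarrow> b \<in> carrier R \<Longrightarrow> e (a \<sqinter> b) = e a \<sqinter>\<^bsub>F_ob R\<^esub> e b"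
  using e_hom unfolding bdd_lattice_hom_def join_pres_def meet_pres_def by blast+

lemma e_le_iff: "a \<in> carrier R \<Longrightarrow> b \<in> carrier R \<Longrightarrow> e a \<subseteq> e b \<longleftrightarrow> a \<sqsubseteq> b"
  using F.emb_mono_iff[of "benv_emb R a" "benv_emb R b"]
  by (simp add: incl_order_benv benv_emb_closed benv_emb_le_iff)

lemma e_inj: "a \<in> carrier R \<Longrightarrow> b \<in> carrier R \<Longrightarrow> e a = e b \<Longrightarrow> a = b"
  using e_le_iff[of a b] e_le_iff[of b a] le_antisym[of a b] by simp

text \<open>
  Joins of elements of \<open>sub R\<close> and meets of elements of \<open>R\<close> survive both steps, the passage to the Boolean
  envelope and the completion.
\<close>

lemma e_Sup: assumes S: "S \<subseteq> sub R" shows "\<Squnion>\<^bsub>F_ob R\<^esub> (e ` S) = e (\<Squnion>S)"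
proof -
  have Sc: "S \<subseteq> carrier R" using S sub_carrier by blast
  have "\<Squnion>\<^bsub>macneille (benv R)\<^esub> (fun_emb R ` (benv_emb R ` S)) = e (\<Squnion>S)"
  proof (rule F.Sup_emb[unfolded incl_order_benv])
    show "benv_emb R ` S \<subseteq> carrier (benv R)" using Sc by (blast intro: benv_emb_closed)
    show "benv_emb R (\<Squnion>S) \<in> carrier (benv R)" using Sc by (simp add: benv_emb_closed)
    show "V \<subseteq> benv_emb R (\<Squnion>S)" if V: "V \<in> benv_emb R ` S" for V
    proof -
      obtain s where s: "s \<in> S" "V = benv_emb R s" using V by (elim imageE)
      have "s \<in> carrier R" using s(1) Sc by auto
      then show ?thesis using s Sc sup_upper[OF Sc s(1)] by (simp add: benv_emb_le_iff)
    qed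
    show "benv_emb R (\<Squnion>S) \<subseteq> U"
      if "U \<in> carrier (benv R)" "\<And>V. V \<in> benv_emb R ` S \<Longrightarrow> V \<subseteq> U" for U
      using S that by (intro benv_emb_Sup_least) auto
  qed
  then show ?thesis by (simp add: F_ob_ops image_image)
qed

lemma e_Inf: assumes T: "T \<subseteq> carrier R" shows "\<Sqinter>\<^bsub>F_ob R\<^esub> (e ` T) = e (\<Sqinter>T)"
proof -
  have "\<Sqinter>\<^bsub>macneille (benv R)\<^esub> (fun_emb R ` (benv_emb R ` T)) = e (\<Sqinter>T)"
  proof (rule F.Inf_emb[unfolded incl_order_benv])
    show "benv_emb R ` T \<subseteq> carrier (benv R)" using T by (blast intro: benv_emb_closed)
    show "benv_emb R (\<Sqinter>T) \<in> carrier (benv R)" using T by (simp add: benv_emb_closed)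
    show "benv_emb R (\<Sqinter>T) \<subseteq> V" if V: "V \<in> benv_emb R ` T" for V
    proof -
      obtain t where t: "t \<in> T" "V = benv_emb R t" using V by (elim imageE)
      have "t \<in> carrier R" using t(1) T by auto
      then show ?thesis using t T inf_lower[OF T t(1)] by (simp add: benv_emb_le_iff)
    qed
    show "U \<subseteq> benv_emb R (\<Sqinter>T)"
      if "U \<in> carrier (benv R)" "\<And>V. V \<in> benv_emb R ` T \<Longrightarrow> U \<subseteq> V" for U
      using T that by (intro benv_emb_Inf_greatest) auto
  qed
  then show ?thesis by (simp add: F_ob_ops image_image)
qed

text \<open>
  The join that defines the interior is a join of elements of \<open>sub R\<close>, so the interior of \<open>a\<close> is the
  greatest element below \<open>a\<close> of the image of \<open>sub R\<close>.  The axioms of an interior operator then follow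
  from the closure of \<open>sub R\<close> under finite meets.
\<close>

lemma box_F_ob: "box (F_ob R) a = e (\<Squnion>{u \<in> sub R. e u \<subseteq> a})"
proof -
  have le: "le (macneille (benv R)) = (\<subseteq>)" by (simp add: macneille_def)
  have "box (F_ob R) a = \<Squnion>\<^bsub>macneille (benv R)\<^esub> {v. \<exists>u\<in>sub R. v = e u \<and> v \<subseteq> a}"
    by (simp add: F_ob_def Let_def le)
  also have "{v. \<exists>u\<in>sub R. v = e u \<and> v \<subseteq> a} = e ` {u \<in> sub R. e u \<subseteq> a}" by auto
  finally show ?thesis by (simp add: F_ob_ops(1)[symmetric] e_Sup)
qed

lemma box_F_ob_open: "\<exists>u\<in>sub R. box (F_ob R) a = e u"
proof -
  have "\<Squnion>{u \<in> sub R. e u \<subseteq> a} \<in> sub R" by (rule sub_Sup(2)) simp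
  then show ?thesis using box_F_ob by blast
qed

lemma box_F_ob_le: assumes a: "a \<in> carrier (F_ob R)" shows "box (F_ob R) a \<subseteq> a"
proof -
  have S: "{u \<in> sub R. e u \<subseteq> a} \<subseteq> sub R" by simp
  have "\<Squnion>\<^bsub>F_ob R\<^esub> (e ` {u \<in> sub R. e u \<subseteq> a}) \<sqsubseteq>\<^bsub>F_ob R\<^esub> a"
    by (rule FM.sup_least) (use a sub_carrier e_closed in auto)
  then show ?thesis unfolding box_F_ob e_Sup[OF S] by simp
qed

lemma box_F_ob_greatest: assumes u: "u \<in> sub R" "e u \<subseteq> a" shows "e u \<subseteq> box (F_ob R) a"
proof -
  have S: "{u \<in> sub R. e u \<subseteq> a} \<subseteq> carrier R" using sub_carrier by auto
  have "u \<in> carrier R" using u(1) sub_carrier by auto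
  then show ?thesis unfolding box_F_ob using sup_upper[OF S, of u] u S by (simp add: e_le_iff)
qed

lemma box_F_ob_e: "u \<in> sub R \<Longrightarrow> box (F_ob R) (e u) = e u"
  using box_F_ob_le[OF e_closed, of u] box_F_ob_greatest[of u "e u"] subsetD[OF sub_carrier, of u]
  by (intro equalityI) simp_all

lemma meet_F_ob: "a \<in> carrier (F_ob R) \<Longrightarrow> b \<in> carrier (F_ob R) \<Longrightarrow> a \<sqinter>\<^bsub>F_ob R\<^esub> b = a \<inter> b"
  using F.meet_FC[of a b] by (simp add: F_ob_ops incl_order_benv)

lemma mt_algebra_F_ob: "mt_algebra (F_ob R)"
proof -
  let ?b = "box (F_ob R)"
  have closed: "?b a \<in> carrier (F_ob R)" for a
    using box_F_ob_open[of a] sub_carrier e_closed by (metis subsetD)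
  have mono: "?b a \<subseteq> ?b b" if "a \<in> carrier (F_ob R)" "a \<subseteq> b" for a b
  proof -
    obtain u where u: "u \<in> sub R" "?b a = e u" using box_F_ob_open by blast
    then have "e u \<subseteq> b" using box_F_ob_le[OF that(1)] that(2) by simp
    then show ?thesis using u box_F_ob_greatest by simp
  qed
  have meet: "?b (a \<inter> b) = ?b a \<inter> ?b b"
    if ab: "a \<in> carrier (F_ob R)" "b \<in> carrier (F_ob R)" for a b
  proof (rule equalityI)
    have "a \<inter> b \<in> carrier (F_ob R)" using FM.meet_closed[OF ab] meet_F_ob[OF ab] by simp
    then show "?b (a \<inter> b) \<subseteq> ?b a \<inter> ?b b" using mono by simp
    obtain u v where u: "u \<in> sub R" "?b a = e u" and v: "v \<in> sub R" "?b b = e v"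
      using box_F_ob_open by metis
    have uv: "u \<in> carrier R" "v \<in> carrier R" using u(1) v(1) sub_carrier by auto
    have "?b a \<inter> ?b b = e (u \<sqinter> v)"
      using u v uv e_ops(4)[OF uv] meet_F_ob[OF e_closed[OF uv(1)] e_closed[OF uv(2)]] by simp
    moreover have "?b a \<inter> ?b b \<subseteq> a \<inter> b" using box_F_ob_le ab by (intro Int_mono)
    ultimately show "?b a \<inter> ?b b \<subseteq> ?b (a \<inter> b)"
      using box_F_ob_greatest[OF sub_meet(2)[OF u(1) v(1)]] by simp
  qed
  have idem: "?b a \<subseteq> ?b (?b a)" for a
    using box_F_ob_open[of a] box_F_ob_e by auto
  have "?b \<top>\<^bsub>F_ob R\<^esub> = \<top>\<^bsub>F_ob R\<^esub>"
    using box_F_ob_e[OF sub_top(2)] by (simp only: e_ops)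
  moreover have "?b (a \<sqinter>\<^bsub>F_ob R\<^esub> b) = ?b a \<sqinter>\<^bsub>F_ob R\<^esub> ?b b"
    if "a \<in> carrier (F_ob R)" "b \<in> carrier (F_ob R)" for a b
    using meet[OF that] meet_F_ob[OF that] meet_F_ob[OF closed closed] by simp
  ultimately show ?thesis
    unfolding mt_algebra_def F_ob_order(2)
    using complete_boolean_F_ob closed box_F_ob_le idem by blast
qed

sublocale FM: mt "F_ob R" by (rule mtI) (rule mt_algebra_F_ob)

lemma opens_F_ob: "opens (F_ob R) = e ` sub R"
proof (rule equalityI)
  show "opens (F_ob R) \<subseteq> e ` sub R"
  proof
    fix a assume "a \<in> opens (F_ob R)"
    then have "box (F_ob R) a = a" by (simp add: opens_def)
    then show "a \<in> e ` sub R" using box_F_ob_open[of a] by auto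
  qed
  show "e ` sub R \<subseteq> opens (F_ob R)"
  proof (rule image_subsetI)
    fix u assume u: "u \<in> sub R"
    then have "u \<in> carrier R" using sub_carrier by auto
    then show "e u \<in> opens (F_ob R)"
      using box_F_ob_e[OF u] e_closed unfolding opens_def by blast
  qed
qed

text \<open>
  Saturated elements are meets of images of elements of \<open>sub R\<close>.  The embedding preserves these meets,
  and by meet-generation they yield exactly the elements of \<open>R\<close>.
\<close>

lemma saturated_F_ob: "saturated (F_ob R) = e ` carrier R"
proof (rule equalityI)
  show "saturated (F_ob R) \<subseteq> e ` carrier R"
  proof
    fix a assume "a \<in> saturated (F_ob R)"
    then obtain S where S: "S \<subseteq> e ` sub R" "a = \<Sqinter>\<^bsub>F_ob R\<^esub> S"
      unfolding saturated_def opens_F_ob by blast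
    obtain T where T: "T \<subseteq> sub R" "S = e ` T" using S(1) unfolding subset_image_iff by blast
    have "T \<subseteq> carrier R" using T(1) sub_carrier by blast
    then show "a \<in> e ` carrier R" unfolding S(2) T(2) by (simp add: e_Inf)
  qed
  show "e ` carrier R \<subseteq> saturated (F_ob R)"
  proof (rule image_subsetI)
    fix c assume "c \<in> carrier R"
    then obtain S where S: "S \<subseteq> sub R" "c = \<Sqinter>S" by (rule meet_generated)
    have "S \<subseteq> carrier R" using S(1) sub_carrier by blast
    then have "e c = \<Sqinter>\<^bsub>F_ob R\<^esub> (e ` S)" unfolding S(2) by (rule e_Inf[symmetric])
    moreover have "e ` S \<subseteq> opens (F_ob R)" unfolding opens_F_ob using S(1) by (rule image_mono)
    ultimately show "e c \<in> saturated (F_ob R)" unfolding saturated_def by blast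
  qed
qed

lemma bool_sat_F_ob: "bool_sat (F_ob R) = fun_emb R ` carrier (benv R)"
  unfolding bool_sat_def saturated_F_ob
  by (rule benv_hom_image[OF FM.distributive fun_emb_hom, symmetric])

lemma eta_simp: "c \<in> carrier R \<Longrightarrow> eta R c = e c"
  by (simp add: eta_def)

lemma eta_re_mor: "eta R \<in> re_mor R (R_ob (F_ob R))"
proof -
  have e_img: "e ` T \<subseteq> saturated (F_ob R)" if "T \<subseteq> carrier R" for T
    using that saturated_F_ob by auto
  have es: "e c \<in> saturated (F_ob R)" if "c \<in> carrier R" for c using that saturated_F_ob by auto
  have eo: "e u \<in> opens (F_ob R)" if "u \<in> sub R" for u using that opens_F_ob by auto
  have eo_img: "e ` S \<subseteq> opens (F_ob R)" if "S \<subseteq> sub R" for S using that opens_F_ob by auto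
  have lat: "lattice R" "complete_lattice R" by unfold_locales
  have uc: "u \<in> carrier R" if "u \<in> sub R" for u using that sub_carrier by auto
  have "coframe_mor R (R_ob (F_ob R)) e"
    unfolding coframe_mor_def inf_pres_def join_pres_def
    using lat FM.complete_lattice_R_ob es e_img
    by (auto simp: FM.R_ob_ops e_Inf e_ops)
  then have "coframe_mor R (R_ob (F_ob R)) (eta R)"
    by (rule coframe_mor_cong[OF HOL.refl HOL.refl, rotated]) (simp add: eta_simp)
  moreover have "frame_mor L (R_ob (F_ob R)\<lparr>carrier := opens (F_ob R)\<rparr>) e"
    unfolding frame_mor_def sup_pres_def meet_pres_def
    using complete_lattice_sub FM.complete_lattice_opens eo eo_img uc
    by (auto simp: FM.opens_ops e_Sup e_ops sub_Sup(1) sub_meet(1) sub_top(1))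
  then have "frame_mor L (R_ob (F_ob R)\<lparr>carrier := opens (F_ob R)\<rparr>) (eta R)"
    by (rule frame_mor_cong[OF HOL.refl HOL.refl, rotated]) (simp add: eta_simp uc)
  ultimately show ?thesis using es by (simp add: re_mor_def eta_def)
qed

lemma eta_inverse:
  obtains g where "g \<in> re_mor (R_ob (F_ob R)) R" "\<And>c. c \<in> carrier R \<Longrightarrow> g (eta R c) = c"
    "\<And>a. a \<in> saturated (F_ob R) \<Longrightarrow> eta R (g a) = a"
proof -
  define g where "g = restrict (the_inv_into (carrier R) e) (saturated (F_ob R))"
  have inj: "inj_on e (carrier R)" by (rule inj_onI) (rule e_inj)
  have ge: "g (e c) = c" if "c \<in> carrier R" for c
    using that the_inv_into_f_f[OF inj that] saturated_F_ob by (simp add: g_def)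
  have eg: "eta R (g a) = a" if "a \<in> saturated (F_ob R)" for a
    using that ge unfolding saturated_F_ob by (auto simp: eta_simp)
  have "g \<in> re_mor (R_ob (F_ob R)) R"
  proof (rule re_mor_inverse[OF eta_re_mor])
    show "g \<in> carrier (R_ob (F_ob R)) \<rightarrow>\<^sub>E carrier R"
    proof (rule PiE_I)
      show "g a \<in> carrier R" if "a \<in> carrier (R_ob (F_ob R))" for a
        using that ge by (auto simp: saturated_F_ob)
    qed (simp add: g_def)
    show "g \<in> sub (R_ob (F_ob R)) \<rightarrow> sub R"
    proof (rule funcsetI)
      fix a assume "a \<in> sub (R_ob (F_ob R))"
      then obtain u where "u \<in> sub R" "a = e u" by (auto simp: opens_F_ob)
      then show "g a \<in> sub R" using ge sub_carrier by auto
    qed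
  qed (use ge eg sub_carrier FM.opens_saturated in \<open>simp_all add: eta_simp\<close>)
  then show thesis using that ge eg by (simp add: eta_simp)
qed

end


section \<open>The functors and the natural isomorphisms\<close>

lemma raneyI: "raney_extension R \<Longrightarrow> raney R"
  by (simp add: raney_def)

text \<open>
  As the image of \<open>eta R\<close> consists of all saturated elements, Raney morphisms from \<open>F_ob R\<close> to \<open>M\<close>
  correspond to morphisms from \<open>R\<close> to \<open>R_ob M\<close>.
\<close>

lemma F_ob_faithful:
  assumes R: "raney_extension R" and M: "mt_algebra M"
    and f: "f \<in> raney_mor (F_ob R) M" and g: "g \<in> raney_mor (F_ob R) M"
    and fg: "\<And>c. c \<in> carrier R \<Longrightarrow> f (eta R c) = g (eta R c)"
  shows "f = g"
proof -
  interpret raney R using R by (rule raneyI)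
  interpret mt_pair "F_ob R" M using mt_algebra_F_ob M by (rule mt_pairI)
  show ?thesis
    using f g by (rule raney_faithful) (use fg in \<open>auto simp: saturated_F_ob eta_simp\<close>)
qed

lemma F_ob_full:
  assumes R: "raney_extension R" and M: "mt_algebra M" and k: "k \<in> re_mor R (R_ob M)"
  obtains f where "f \<in> raney_mor (F_ob R) M" "\<And>c. c \<in> carrier R \<Longrightarrow> f (eta R c) = k c"
proof -
  interpret raney R using R by (rule raneyI)
  interpret P: mt_pair "F_ob R" M using mt_algebra_F_ob M by (rule mt_pairI)
  obtain g where g: "g \<in> re_mor (R_ob (F_ob R)) R" "\<And>c. c \<in> carrier R \<Longrightarrow> g (eta R c) = c"
    using eta_inverse by metis
  have "re_comp (R_ob (F_ob R)) k g \<in> re_mor (R_ob (F_ob R)) (R_ob M)"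
    by (rule re_comp_mor[OF _ g(1) k]) (simp add: FM.opens_saturated)
  then obtain f where f: "f \<in> raney_mor (F_ob R) M"
    "\<And>x. x \<in> saturated (F_ob R) \<Longrightarrow> f x = re_comp (R_ob (F_ob R)) k g x"
    using P.raney_full by metis
  have "f (eta R c) = k c" if c: "c \<in> carrier R" for c
  proof -
    have "eta R c \<in> saturated (F_ob R)" using re_mor_closed[OF eta_re_mor c] by simp
    then show ?thesis using f(2) g(2)[OF c] by (simp add: compose_def)
  qed
  then show thesis using that f(1) by blast
qed

text \<open>
  On \<open>bool_sat (F_ob R)\<close>, a copy of the Boolean envelope of \<open>R\<close>, the morphism is a homomorphism with
  prescribed values on \<open>R\<close>.  The formula is the one that defines \<open>F_mor\<close> and \<open>eps\<close>.
\<close>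

lemma raney_mor_F_ob_formula:
  assumes R: "raney_extension R" and M: "mt_algebra M" and f: "f \<in> raney_mor (F_ob R) M"
    and h: "bdd_lattice_hom R M h" and fh: "\<And>c. c \<in> carrier R \<Longrightarrow> f (eta R c) = h c"
  shows "f = (\<lambda>a\<in>carrier (F_ob R). \<Squnion>\<^bsub>M\<^esub>
    {benv_ext R M h x |x. x \<in> carrier (benv R) \<and> fun_emb R x \<sqsubseteq>\<^bsub>F_ob R\<^esub> a})"
proof -
  interpret raney R using R by (rule raneyI)
  interpret P: mt_pair "F_ob R" M using mt_algebra_F_ob M by (rule mt_pairI)
  have emb: "fun_emb R U \<in> bool_sat (F_ob R)" if "U \<in> carrier (benv R)" for U
    using that bool_sat_F_ob by auto
  note fun_emb = benv_homD[OF fun_emb_hom]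
  have fhom: "bool_hom_on (bool_sat (F_ob R)) (F_ob R) M f" by (rule P.raney_mor_bool_hom[OF f])
  have "bdd_lattice_hom (benv R) M (\<lambda>x. f (fun_emb R x))"
  proof (rule benv_homI)
    show "lattice M" by (rule P.M'.lattice_axioms)
    show "f (fun_emb R U) \<in> carrier M" if "U \<in> carrier (benv R)" for U
      using fhom emb[OF that] by (auto simp: bool_hom_on_def)
    show "f (fun_emb R {}) = \<bottom>\<^bsub>M\<^esub>" "f (fun_emb R (prime_filters R)) = \<top>\<^bsub>M\<^esub>"
      using fhom fun_emb(2,3) by (simp_all add: bool_hom_on_def)
    show "f (fun_emb R (U \<union> V)) = f (fun_emb R U) \<squnion>\<^bsub>M\<^esub> f (fun_emb R V)"
      "f (fun_emb R (U \<inter> V)) = f (fun_emb R U) \<sqinter>\<^bsub>M\<^esub> f (fun_emb R V)"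
      if "U \<in> carrier (benv R)" "V \<in> carrier (benv R)" for U V
      using fhom emb that fun_emb(4,5)[OF that] by (simp_all add: bool_hom_on_def)
  qed
  then have ext: "benv_ext R M h x = f (fun_emb R x)" if "x \<in> carrier (benv R)" for x
    by (rule benv_ext_eq[OF distributive P.M'.boolean h]) (use fh that in \<open>simp_all add: eta_simp\<close>)
  have "lower_ext (F_ob R) M f = f" by (rule P.raney_mor_eq_lower_ext[OF f HOL.refl])
  moreover have "f ` {x \<in> bool_sat (F_ob R). x \<sqsubseteq>\<^bsub>F_ob R\<^esub> a} =
      {benv_ext R M h x |x. x \<in> carrier (benv R) \<and> fun_emb R x \<sqsubseteq>\<^bsub>F_ob R\<^esub> a}" for a
  proof -
    have "{benv_ext R M h x |x. x \<in> carrier (benv R) \<and> fun_emb R x \<sqsubseteq>\<^bsub>F_ob R\<^esub> a} =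
        {f (fun_emb R x) |x. x \<in> carrier (benv R) \<and> fun_emb R x \<sqsubseteq>\<^bsub>F_ob R\<^esub> a}"
      using ext by (metis (no_types, lifting))
    then show ?thesis unfolding bool_sat_F_ob by auto
  qed
  ultimately show "f = (\<lambda>a\<in>carrier (F_ob R). \<Squnion>\<^bsub>M\<^esub>
      {benv_ext R M h x |x. x \<in> carrier (benv R) \<and> fun_emb R x \<sqsubseteq>\<^bsub>F_ob R\<^esub> a})"
    by (simp add: lower_ext_def)
qed

text \<open>
  The counit is the Raney morphism that corresponds to the identity of \<open>R_ob M\<close>.
\<close>

lemma eps_mor:
  assumes M: "mt_algebra M"
  shows "eps M \<in> raney_mor (F_ob (R_ob M)) M"
    and "c \<in> saturated M \<Longrightarrow> eps M (eta (R_ob M) c) = c"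
proof -
  interpret mt M using M by (rule mtI)
  have R: "raney_extension (R_ob M)" by (rule raney_extension_R_ob)
  obtain f where f: "f \<in> raney_mor (F_ob (R_ob M)) M"
    "\<And>c. c \<in> saturated M \<Longrightarrow> f (eta (R_ob M) c) = c"
    using F_ob_full[OF R M re_id_mor[OF R]] by auto
  have "f = eps M"
    unfolding eps_def
    by (rule raney_mor_F_ob_formula[OF R M f(1) saturated_inclusion_hom]) (simp add: f(2))
  then show "eps M \<in> raney_mor (F_ob (R_ob M)) M"
    "c \<in> saturated M \<Longrightarrow> eps M (eta (R_ob M) c) = c" using f by simp_all
qed

text \<open>
  \<open>F_mor R1 R2 h\<close> is the Raney morphism that corresponds to \<open>eta R2 \<circ> h\<close>: on the envelope of \<open>R1\<close>, both
  \<open>fun_emb R2 \<circ> benv_map R1 R2 h\<close> and the extension of \<open>eta R2 \<circ> h\<close> are homomorphisms with the same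
  values on \<open>R1\<close>.
\<close>

lemma F_mor_mor:
  assumes R1: "raney_extension R1" and R2: "raney_extension R2" and h: "h \<in> re_mor R1 R2"
  shows "F_mor R1 R2 h \<in> raney_mor (F_ob R1) (F_ob R2)"
    and "c \<in> carrier R1 \<Longrightarrow> F_mor R1 R2 h (eta R1 c) = eta R2 (h c)"
proof -
  interpret R1: raney R1 using R1 by (rule raneyI)
  interpret R2: raney R2 using R2 by (rule raneyI)
  note hc = re_mor_closed[OF h]
  have k: "re_comp R1 (eta R2) h \<in> re_mor R1 (R_ob (F_ob R2))"
    using R1.sub_carrier h R2.eta_re_mor by (rule re_comp_mor)
  obtain f where f: "f \<in> raney_mor (F_ob R1) (F_ob R2)"
    "\<And>c. c \<in> carrier R1 \<Longrightarrow> f (eta R1 c) = re_comp R1 (eta R2) h c"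
    using F_ob_full[OF R1 R2.mt_algebra_F_ob k] by metis
  have feta: "f (eta R1 c) = fun_emb R2 (benv_emb R2 (h c))" if "c \<in> carrier R1" for c
    using f(2)[OF that] that hc[OF that] by (simp add: compose_def R2.eta_simp)
  have hom: "bdd_lattice_hom R1 (benv R2) (\<lambda>c. benv_emb R2 (h c))"
    using bdd_lattice_hom_compose[OF re_mor_hom[OF h] benv_emb_hom[OF R2.distributive]] .
  have hom': "bdd_lattice_hom R1 (F_ob R2) (\<lambda>c. fun_emb R2 (benv_emb R2 (h c)))"
    using bdd_lattice_hom_compose[OF hom R2.fun_emb_hom] .
  note ext = benv_ext[OF R1.distributive boolean_lattice_benv hom]
  have ext_eq: "benv_ext R1 (F_ob R2) (\<lambda>c. fun_emb R2 (benv_emb R2 (h c))) x =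
      fun_emb R2 (benv_map R1 R2 h x)" if "x \<in> carrier (benv R1)" for x
    unfolding benv_map_def
    by (rule benv_ext_eq[OF R1.distributive R2.FM.boolean hom' _ _ that])
      (use bdd_lattice_hom_compose[OF ext(1) R2.fun_emb_hom] ext(2) in simp_all)
  have "{benv_ext R1 (F_ob R2) (\<lambda>c. fun_emb R2 (benv_emb R2 (h c))) x |x.
        x \<in> carrier (benv R1) \<and> fun_emb R1 x \<sqsubseteq>\<^bsub>F_ob R1\<^esub> a} =
      {fun_emb R2 (benv_map R1 R2 h x) |x. x \<in> carrier (benv R1) \<and> fun_emb R1 x \<sqsubseteq>\<^bsub>F_ob R1\<^esub> a}"
    for a using ext_eq by (metis (no_types, lifting))
  then have "f = F_mor R1 R2 h"
    using raney_mor_F_ob_formula[OF R1 R2.mt_algebra_F_ob f(1) hom' feta]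
    unfolding F_mor_def by simp
  then show "F_mor R1 R2 h \<in> raney_mor (F_ob R1) (F_ob R2)"
    "c \<in> carrier R1 \<Longrightarrow> F_mor R1 R2 h (eta R1 c) = eta R2 (h c)"
    using f(1) feta hc by (simp_all add: R2.eta_simp)
qed

lemma eta_saturated:
  assumes R: "raney_extension R" and c: "c \<in> carrier R"
  shows "eta R c \<in> saturated (F_ob R)" "eta R c \<in> bool_sat (F_ob R)"
proof -
  interpret raney R using R by (rule raneyI)
  show "eta R c \<in> saturated (F_ob R)" using c by (simp add: saturated_F_ob eta_simp)
  then show "eta R c \<in> bool_sat (F_ob R)" using FM.saturated_bool_sat by blast
qed

lemma raney_comp_id:
  assumes M: "mt_algebra M1" "mt_algebra M2" and f: "f \<in> raney_mor M1 M2"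
  shows "raney_comp M1 M2 f (raney_id M1) = f" "raney_comp M1 M2 (raney_id M2) f = f"
proof -
  interpret mt_pair M1 M2 using M by (rule mt_pairI)
  show "raney_comp M1 M2 f (raney_id M1) = f" "raney_comp M1 M2 (raney_id M2) f = f"
    unfolding raney_comp_lower_ext
    by (rule raney_mor_eq_lower_ext[OF f],
        simp add: raney_id_mor(2)[OF M(1)] raney_id_mor(2)[OF M(2)] raney_mor_bool_sat[OF f])+
qed

lemma raney_comp_assoc:
  assumes M: "mt_algebra M1" "mt_algebra M2" "mt_algebra M3" "mt_algebra M4"
    and f: "f \<in> raney_mor M1 M2" and g: "g \<in> raney_mor M2 M3" and h: "h \<in> raney_mor M3 M4"
  shows "raney_comp M1 M4 h (raney_comp M1 M3 g f) = raney_comp M1 M4 (raney_comp M2 M4 h g) f"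
proof -
  interpret f: mt_pair M1 M2 using M(1,2) by (rule mt_pairI)
  interpret mt_pair M1 M4 using M(1,4) by (rule mt_pairI)
  note gf = raney_comp_mor[OF M(1-3) f g]
  note hg = raney_comp_mor[OF M(2-4) g h]
  show ?thesis
  proof (rule raney_faithful)
    show "raney_comp M1 M4 h (raney_comp M1 M3 g f) \<in> raney_mor M1 M4"
      by (rule raney_comp_mor(1)[OF M(1,3,4) gf(1) h])
    show "raney_comp M1 M4 (raney_comp M2 M4 h g) f \<in> raney_mor M1 M4"
      by (rule raney_comp_mor(1)[OF M(1,2,4) f hg(1)])
    fix x assume "x \<in> saturated M1"
    then have x: "x \<in> bool_sat M1" using f.M.saturated_bool_sat by blast
    show "raney_comp M1 M4 h (raney_comp M1 M3 g f) x = raney_comp M1 M4 (raney_comp M2 M4 h g) f x"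
      using raney_comp_mor(2)[OF M(1,3,4) gf(1) h x] raney_comp_mor(2)[OF M(1,2,4) f hg(1) x]
        gf(2)[OF x] hg(2)[OF f.raney_mor_bool_sat[OF f x]] by simp
  qed
qed

lemma re_comp_id:
  assumes "h \<in> re_mor R R'"
  shows "re_comp R h (re_id R) = h" "re_comp R (re_id R') h = h"
  using assms by (auto simp: re_mor_def PiE_def intro: compose_Id Id_compose)

lemma re_comp_assoc:
  assumes "h \<in> re_mor R R'"
  shows "re_comp R l (re_comp R k h) = re_comp R (re_comp R' l k) h"
  by (rule compose_assoc) (use re_mor_closed[OF assms] in blast)

lemma R_mor_apply: "x \<in> saturated M \<Longrightarrow> R_mor M f x = f x"
  by (simp add: R_mor_def)

lemma R_mor_id: assumes M: "mt_algebra M" shows "R_mor M (raney_id M) = re_id (R_ob M)"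
proof -
  interpret mt M using M by (rule mtI)
  show ?thesis
    using raney_id_mor(2)[OF M] saturated_bool_sat by (auto simp: R_mor_def fun_eq_iff)
qed

lemma R_mor_comp:
  assumes M: "mt_algebra M1" "mt_algebra M2" "mt_algebra M3"
    and f: "f \<in> raney_mor M1 M2" and g: "g \<in> raney_mor M2 M3"
  shows "R_mor M1 (raney_comp M1 M3 g f) = re_comp (R_ob M1) (R_mor M2 g) (R_mor M1 f)"
proof -
  interpret mt_pair M1 M2 using M(1,2) by (rule mt_pairI)
  show ?thesis
    using raney_comp_mor(2)[OF M f g] M.saturated_bool_sat raney_mor_saturated[OF f]
    by (auto simp: R_mor_def compose_def fun_eq_iff)
qed

lemma F_mor_id:
  assumes R: "raney_extension R" shows "F_mor R R (re_id R) = raney_id (F_ob R)"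
proof -
  interpret raney R using R by (rule raneyI)
  note F = F_mor_mor[OF R R re_id_mor[OF R]]
  show ?thesis
    by (rule F_ob_faithful[OF R mt_algebra_F_ob F(1) raney_id_mor(1)[OF mt_algebra_F_ob]])
      (simp add: F(2) raney_id_mor(2)[OF mt_algebra_F_ob] eta_saturated[OF R])
qed

lemma F_mor_comp:
  assumes R: "raney_extension R1" "raney_extension R2" "raney_extension R3"
    and h: "h \<in> re_mor R1 R2" and k: "k \<in> re_mor R2 R3"
  shows "F_mor R1 R3 (re_comp R1 k h) =
    raney_comp (F_ob R1) (F_ob R3) (F_mor R2 R3 k) (F_mor R1 R2 h)"
proof -
  interpret R1: raney R1 using R(1) by (rule raneyI)
  interpret R2: raney R2 using R(2) by (rule raneyI)
  interpret R3: raney R3 using R(3) by (rule raneyI)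
  note FM = R1.mt_algebra_F_ob R2.mt_algebra_F_ob R3.mt_algebra_F_ob
  note Fh = F_mor_mor[OF R(1,2) h] and Fk = F_mor_mor[OF R(2,3) k]
  note Fkh = F_mor_mor[OF R(1,3) re_comp_mor[OF R1.sub_carrier h k]]
  note comp = raney_comp_mor[OF FM Fh(1) Fk(1)]
  show ?thesis
    by (rule F_ob_faithful[OF R(1) FM(3) Fkh(1) comp(1)])
      (simp add: Fkh(2)[unfolded compose_def] comp(2) Fh(2) Fk(2) eta_saturated[OF R(1)] re_mor_closed[OF h] compose_def)
qed

lemma eta_iso: assumes R: "raney_extension R" shows "re_iso R (R_ob (F_ob R)) (eta R)"
proof -
  interpret raney R using R by (rule raneyI)
  obtain g where g: "g \<in> re_mor (R_ob (F_ob R)) R" "\<And>c. c \<in> carrier R \<Longrightarrow> g (eta R c) = c"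
    "\<And>a. a \<in> saturated (F_ob R) \<Longrightarrow> eta R (g a) = a"
    using eta_inverse by metis
  have "re_comp R g (eta R) = re_id R" "re_comp (R_ob (F_ob R)) (eta R) g = re_id (R_ob (F_ob R))"
    using g(2,3) by (auto simp: compose_def fun_eq_iff)
  then show ?thesis using eta_re_mor g(1) unfolding re_iso_def by blast
qed

lemma eta_natural:
  assumes R: "raney_extension R1" "raney_extension R2" and h: "h \<in> re_mor R1 R2"
  shows "re_comp R1 (R_mor (F_ob R1) (F_mor R1 R2 h)) (eta R1) = re_comp R1 (eta R2) h"
  using F_mor_mor(2)[OF R h] eta_saturated(1)[OF R(1)]
  by (auto simp: compose_def R_mor_def fun_eq_iff)

text \<open>
  Fullness extends \<open>eta (R_ob M)\<close> to a Raney morphism \<open>g\<close>.  Both composites of \<open>g\<close> with \<open>eps M\<close> restrict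
  to identities on saturated elements, so they are identities by faithfulness.
\<close>

lemma eps_iso: assumes M: "mt_algebra M" shows "raney_iso (F_ob (R_ob M)) M (eps M)"
proof -
  interpret mt M using M by (rule mtI)
  let ?R = "R_ob M"
  have R: "raney_extension ?R" by (rule raney_extension_R_ob)
  interpret R: raney ?R using R by (rule raneyI)
  have F: "mt_algebra (F_ob ?R)" by (rule R.mt_algebra_F_ob)
  interpret P: mt_pair M "F_ob ?R" using M F by (rule mt_pairI)
  interpret PM: mt_pair M M using M M by (rule mt_pairI)
  note eps = eps_mor[OF M]
  obtain g where g: "g \<in> raney_mor M (F_ob ?R)" "\<And>c. c \<in> saturated M \<Longrightarrow> g c = eta ?R c"
    using P.raney_full[OF R.eta_re_mor] by metis
  note ge = raney_comp_mor[OF F M F eps(1) g(1)] and eg = raney_comp_mor[OF M F M g(1) eps(1)]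
  have "raney_comp (F_ob ?R) (F_ob ?R) g (eps M) = raney_id (F_ob ?R)"
    by (rule F_ob_faithful[OF R F ge(1) raney_id_mor(1)[OF F]])
      (simp add: ge(2) eps(2) g(2) raney_id_mor(2)[OF F] eta_saturated[OF R])
  moreover have "raney_comp M M (eps M) g = raney_id M"
    by (rule PM.raney_faithful[OF eg(1) raney_id_mor(1)[OF M]])
      (use saturated_bool_sat in \<open>simp add: eg(2) eps(2) g(2) raney_id_mor(2)[OF M] subsetD\<close>)
  ultimately show ?thesis using eps(1) g(1) unfolding raney_iso_def by blast
qed

lemma eps_natural:
  assumes M: "mt_algebra M1" "mt_algebra M2" and f: "f \<in> raney_mor M1 M2"
  shows "raney_comp (F_ob (R_ob M1)) M2 f (eps M1) =
    raney_comp (F_ob (R_ob M1)) M2 (eps M2) (F_mor (R_ob M1) (R_ob M2) (R_mor M1 f))"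
proof -
  interpret mt_pair M1 M2 using M by (rule mt_pairI)
  have R: "raney_extension (R_ob M1)" "raney_extension (R_ob M2)"
    by (rule M.raney_extension_R_ob, rule M'.raney_extension_R_ob)
  interpret R1: raney "R_ob M1" using R(1) by (rule raneyI)
  interpret R2: raney "R_ob M2" using R(2) by (rule raneyI)
  note F = R1.mt_algebra_F_ob R2.mt_algebra_F_ob
  note Ff = F_mor_mor[OF R R_mor_re_mor[OF f]]
  note l = raney_comp_mor[OF F(1) M eps_mor(1)[OF M(1)] f]
  note r = raney_comp_mor[OF F(1,2) M(2) Ff(1) eps_mor(1)[OF M(2)]]
  show ?thesis
    by (rule F_ob_faithful[OF R(1) M(2) l(1) r(1)])
      (simp add: l(2) r(2) Ff(2) eps_mor(2)[OF M(1)] eps_mor(2)[OF M(2)] eta_saturated[OF R(1)]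
        R_mor_apply raney_mor_saturated[OF f])
qed


section \<open>The equivalence\<close>

theorem theorem5p7:
  shows
  \<comment> \<open>MT-algebras and Raney morphisms form a category\<close>
  "((\<forall>M :: 'a mt. mt_algebra M \<longrightarrow> raney_id M \<in> raney_mor M M) \<and>
    (\<forall>(M1 :: 'a mt) (M2 :: 'b mt) (M3 :: 'c mt) f g.
       mt_algebra M1 \<and> mt_algebra M2 \<and> mt_algebra M3 \<and>
       f \<in> raney_mor M1 M2 \<and> g \<in> raney_mor M2 M3 \<longrightarrow>
       raney_comp M1 M3 g f \<in> raney_mor M1 M3) \<and>
    (\<forall>(M1 :: 'a mt) (M2 :: 'b mt) f.
       mt_algebra M1 \<and> mt_algebra M2 \<and> f \<in> raney_mor M1 M2 \<longrightarrow>
       raney_comp M1 M2 f (raney_id M1) = f \<and> raney_comp M1 M2 (raney_id M2) f = f) \<and>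
    (\<forall>(M1 :: 'a mt) (M2 :: 'b mt) (M3 :: 'c mt) (M4 :: 'd mt) f g h.
       mt_algebra M1 \<and> mt_algebra M2 \<and> mt_algebra M3 \<and> mt_algebra M4 \<and>
       f \<in> raney_mor M1 M2 \<and> g \<in> raney_mor M2 M3 \<and> h \<in> raney_mor M3 M4 \<longrightarrow>
       raney_comp M1 M4 h (raney_comp M1 M3 g f) = raney_comp M1 M4 (raney_comp M2 M4 h g) f)) \<and>

   (\<comment> \<open>Raney extensions and their morphisms form a category\<close>
    (\<forall>R :: 'a raney. raney_extension R \<longrightarrow> re_id R \<in> re_mor R R) \<and>
    (\<forall>(R1 :: 'a raney) (R2 :: 'b raney) (R3 :: 'c raney) h k.
       raney_extension R1 \<and> raney_extension R2 \<and> raney_extension R3 \<and>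
       h \<in> re_mor R1 R2 \<and> k \<in> re_mor R2 R3 \<longrightarrow> re_comp R1 k h \<in> re_mor R1 R3) \<and>
    (\<forall>(R1 :: 'a raney) (R2 :: 'b raney) h.
       raney_extension R1 \<and> raney_extension R2 \<and> h \<in> re_mor R1 R2 \<longrightarrow>
       re_comp R1 h (re_id R1) = h \<and> re_comp R1 (re_id R2) h = h) \<and>
    (\<forall>(R1 :: 'a raney) (R2 :: 'b raney) (R3 :: 'c raney) (R4 :: 'd raney) h k l.
       raney_extension R1 \<and> raney_extension R2 \<and> raney_extension R3 \<and> raney_extension R4 \<and>
       h \<in> re_mor R1 R2 \<and> k \<in> re_mor R2 R3 \<and> l \<in> re_mor R3 R4 \<longrightarrow>
       re_comp R1 l (re_comp R1 k h) = re_comp R1 (re_comp R2 l k) h)) \<and>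

   (\<comment> \<open>R is a functor\<close>
    (\<forall>M :: 'a mt. mt_algebra M \<longrightarrow>
       raney_extension (R_ob M) \<and> R_mor M (raney_id M) = re_id (R_ob M)) \<and>
    (\<forall>(M1 :: 'a mt) (M2 :: 'b mt) f.
       mt_algebra M1 \<and> mt_algebra M2 \<and> f \<in> raney_mor M1 M2 \<longrightarrow>
       R_mor M1 f \<in> re_mor (R_ob M1) (R_ob M2)) \<and>
    (\<forall>(M1 :: 'a mt) (M2 :: 'b mt) (M3 :: 'c mt) f g.
       mt_algebra M1 \<and> mt_algebra M2 \<and> mt_algebra M3 \<and>
       f \<in> raney_mor M1 M2 \<and> g \<in> raney_mor M2 M3 \<longrightarrow>
       R_mor M1 (raney_comp M1 M3 g f) = re_comp (R_ob M1) (R_mor M2 g) (R_mor M1 f))) \<and>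

   (\<comment> \<open>F is a functor\<close>
    (\<forall>R :: 'a raney. raney_extension R \<longrightarrow>
       mt_algebra (F_ob R) \<and> F_mor R R (re_id R) = raney_id (F_ob R)) \<and>
    (\<forall>(R1 :: 'a raney) (R2 :: 'b raney) h.
       raney_extension R1 \<and> raney_extension R2 \<and> h \<in> re_mor R1 R2 \<longrightarrow>
       F_mor R1 R2 h \<in> raney_mor (F_ob R1) (F_ob R2)) \<and>
    (\<forall>(R1 :: 'a raney) (R2 :: 'b raney) (R3 :: 'c raney) h k.
       raney_extension R1 \<and> raney_extension R2 \<and> raney_extension R3 \<and>
       h \<in> re_mor R1 R2 \<and> k \<in> re_mor R2 R3 \<longrightarrow>
       F_mor R1 R3 (re_comp R1 k h) =
         raney_comp (F_ob R1) (F_ob R3) (F_mor R2 R3 k) (F_mor R1 R2 h))) \<and>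

   (\<comment> \<open>eta is a natural isomorphism from the identity of RE to RF\<close>
    (\<forall>R :: 'a raney. raney_extension R \<longrightarrow> re_iso R (R_ob (F_ob R)) (eta R)) \<and>
    (\<forall>(R1 :: 'a raney) (R2 :: 'b raney) h.
       raney_extension R1 \<and> raney_extension R2 \<and> h \<in> re_mor R1 R2 \<longrightarrow>
       re_comp R1 (R_mor (F_ob R1) (F_mor R1 R2 h)) (eta R1) = re_comp R1 (eta R2) h)) \<and>

   (\<comment> \<open>eps is a natural isomorphism from FR to the identity of MT_R\<close>
    (\<forall>M :: 'a mt. mt_algebra M \<longrightarrow> raney_iso (F_ob (R_ob M)) M (eps M)) \<and>
    (\<forall>(M1 :: 'a mt) (M2 :: 'b mt) f.
       mt_algebra M1 \<and> mt_algebra M2 \<and> f \<in> raney_mor M1 M2 \<longrightarrow>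
       raney_comp (F_ob (R_ob M1)) M2 f (eps M1) =
         raney_comp (F_ob (R_ob M1)) M2 (eps M2) (F_mor (R_ob M1) (R_ob M2) (R_mor M1 f))))"
  by (intro conjI allI impI; (elim conjE)?;
      (rule raney_id_mor(1) raney_comp_mor(1) raney_comp_id raney_comp_assoc
        re_id_mor re_comp_mor[OF raney.sub_carrier[OF raneyI]] re_comp_id re_comp_assoc
        mt.raney_extension_R_ob[OF mtI] R_mor_id mt_pair.R_mor_re_mor[OF mt_pairI] R_mor_comp
        raney.mt_algebra_F_ob[OF raneyI] F_mor_id F_mor_mor(1) F_mor_comp
        eta_iso eta_natural eps_iso eps_natural; assumption))

end
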